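(* Let $f:\mathbb R\to\mathbb R$ be smooth, let $I=[a,b]\subset\mathbb R$, let $L\in\mathbb R$ satisfy $\tilde I:=I+L=[a+L,b+L]\subset(0,\infty)$, and let $K\in\mathbb R$ satisfy $K<\min_{\sigma\in\tilde I}\{\sigma f'(\sigma-L)-f(\sigma-L)\}$. Put $$g(\sigma)=f(\sigma-L)+K,\qquad G(\sigma)=\frac{g(\sigma)}{\sigma}\qquad(\sigma\in\tilde I).$$ Let $\sigma_0:\mathbb R\to\tilde I$ have bounded total variation, and let $(\eta,v)\in\mathcal C((0,\infty);BV^2)$ be the admissible weak solution of $$\eta_t-G\left(\frac{v}{\eta}\right)_x=0,\quad \eta(x,0)=1,\qquad\qquad v_t=0,\quad v(x,0)=\sigma_0(x),\qquad x\in\mathbb R,\ t>0.$$ Let $\gamma$ be the distributional solution of $$\gamma_x(x,t)=\eta(x,t),\qquad \gamma_t(x,t)=G\left(\frac{v(x,t)}{\eta(x,t)}\right),\qquad\gamma(x,0)=x,$$ and for each $t$ let $\gamma^{-1}(\cdot,t)$ be the inverse of the map $x\mapsto\gamma(x,t)$. Define $$\sigma(x,t):=\frac{v\left(\gamma^{-1}(x,t),t\right)}{\eta\left(\gamma^{-1}(x,t),t\right)}.$$ Then $\sigma$ is an admissible weak solution of the scalar Cauchy problem $$\sigma_t+g(\sigma)_x=0,\qquad\sigma(x,0)=\sigma_0(x),\qquad x\in\mathbb R,\ t>0.$$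
   Context: The condition on $K$ gives $G'>0$ on $\tilde I$. It may be taken as known that the $2\times2$ system has a unique admissible weak solution in $\mathcal C((0,\infty);BV^2)$, and that $\gamma$ is well defined and, for each $t$, the map $x\mapsto\gamma(x,t)$ is absolutely continuous and invertible with absolutely continuous inverse. State space of the system: $\Omega=\{(\eta,v)\in\mathbb R^2:\eta>0,\ v/\eta\in\tilde I\}$; solutions take values in $\Omega$. Weak solution (of the system, values in $\Omega$, or of the scalar equation, values in $\tilde I$): a bounded measurable function $w$ on $\mathbb R\times[0,\infty)$ such that $t\mapsto w(\cdot,t)$ is continuous from $[0,\infty)$ into $L^1_{loc}(\mathbb R)$, attains the prescribed initial data at $t=0$, and satisfies the equation(s) in the sense of distributions on $\mathbb R\times(0,\infty)$. Convex extension of the system: a pair $(\mathcal E,\mathcal Q)$ of $\mathcal C^1$ functions on $\Omega$ with $\mathcal E$ smooth and convex, $\mathcal Q_\eta=\mathcal E_\eta\frac{v}{\eta^2}G'(\frac v\eta)$ and $\mathcal Q_v=-\mathcal E_\eta\frac1\eta G'(\frac v\eta)$. Convex extension of the scalar equation: a pair $(\mathcal E,\mathcal Q)$ of $\mathcal C^1$ functions of $\sigma$ with $\mathcal E$ smooth and convex and $\mathcal Q'(\sigma)=\mathcal E'(\sigma)g'(\sigma)$. Admissible (entropy admissible) weak solution: a weak solution $w$ such that for every convex extension $(\mathcal E,\mathcal Q)$ and every nonnegative $\psi\in\mathcal C^1_c(\mathbb R\times(0,\infty))$ one has $\iint(\psi_t\,\mathcal E(w)+\psi_x\,\mathcal Q(w))\,dx\,dt\ge0$.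 $(\eta,v)\in\mathcal C((0,\infty);BV^2)$ means: for each $t>0$, $\eta(\cdot,t)$ and $v(\cdot,t)$ have bounded total variation on $\mathbb R$, and $t\mapsto(\eta,v)(\cdot,t)$ is continuous in $L^1_{loc}(\mathbb R)$. *)

theory Defs
  imports "HOL-Analysis.Analysis"
begin

section \<open>Regularity and bounded variation\<close>

text \<open>
  Derivatives are taken within the set, i.e. they are one-sided at boundary points. This matters for the
  non-open domains below (a compact interval, a closed wedge); on an open set the notion is the usual
  \<open>C\<^sup>k\<close>. In finite dimension, continuity of all directional derivatives \<open>\<lambda>x. f' x h\<close> is continuity
  of the derivative.
\<close>

primrec Ck_on :: "nat \<Rightarrow> 'a::real_normed_vector set \<Rightarrow> ('a \<Rightarrow> 'b::real_normed_vector) \<Rightarrow> bool" where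
  "Ck_on 0 S f \<longleftrightarrow> continuous_on S f"
| "Ck_on (Suc k) S f \<longleftrightarrow>
     (\<exists>f'. (\<forall>x\<in>S. (f has_derivative f' x) (at x within S)) \<and> (\<forall>h. Ck_on k S (\<lambda>x. f' x h)))"

definition smooth_on :: "'a::real_normed_vector set \<Rightarrow> ('a \<Rightarrow> 'b::real_normed_vector) \<Rightarrow> bool" where
  "smooth_on S f \<longleftrightarrow> (\<forall>k. Ck_on k S f)"

definition bounded_total_variation :: "(real \<Rightarrow> 'a::real_normed_vector) \<Rightarrow> bool" where
  "bounded_total_variation f \<longleftrightarrow>
     (\<exists>C. \<forall>n. \<forall>x::nat \<Rightarrow> real. mono x \<longrightarrow> (\<Sum>i<n. norm (f (x (Suc i)) - f (x i))) \<le> C)"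


section \<open>Functions of space and time\<close>

text \<open>
  Functions of \<open>x\<close> and \<open>t\<close> are curried and total. For solutions, only the values at times \<open>t \<ge> 0\<close>
  are relevant; test functions are defined on the whole plane and vanish for \<open>t \<le> 0\<close>.
\<close>

definition supported_in_upper :: "(real \<Rightarrow> real \<Rightarrow> real) \<Rightarrow> bool" where
  "supported_in_upper \<psi> \<longleftrightarrow>
     compact (closure {(x, t). \<psi> x t \<noteq> 0}) \<and> closure {(x, t). \<psi> x t \<noteq> 0} \<subseteq> UNIV \<times> {0<..}"

definition test_function :: "(real \<Rightarrow> real \<Rightarrow> real) \<Rightarrow> bool" where
  "test_function \<psi> \<longleftrightarrow> smooth_on UNIV (\<lambda>(x, t). \<psi> x t) \<and> supported_in_upper \<psi>"

definition C1_test_function :: "(real \<Rightarrow> real \<Rightarrow> real) \<Rightarrow> bool" where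
  "C1_test_function \<psi> \<longleftrightarrow> Ck_on 1 UNIV (\<lambda>(x, t). \<psi> x t) \<and> supported_in_upper \<psi>"

definition L1loc_continuous_on :: "real set \<Rightarrow> (real \<Rightarrow> real \<Rightarrow> 'a::euclidean_space) \<Rightarrow> bool" where
  "L1loc_continuous_on T w \<longleftrightarrow>
     (\<forall>C::real set. compact C \<longrightarrow>
        (\<forall>t\<in>T. (\<lambda>x. w x t) absolutely_integrable_on C) \<and>
        (\<forall>s\<in>T. ((\<lambda>t. LINT x:C|lebesgue. norm (w x t - w x s)) \<longlongrightarrow> 0) (at s within T)))"

definition in_C_BV2 :: "(real \<Rightarrow> real \<Rightarrow> real) \<Rightarrow> (real \<Rightarrow> real \<Rightarrow> real) \<Rightarrow> bool" where
  "in_C_BV2 \<eta> v \<longleftrightarrow>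
     (\<forall>t>0. bounded_total_variation (\<lambda>x. \<eta> x t) \<and> bounded_total_variation (\<lambda>x. v x t)) \<and>
     L1loc_continuous_on {0<..} (\<lambda>x t. (\<eta> x t, v x t))"


section \<open>Admissible weak solutions of conservation laws\<close>

text \<open>
  Weak solutions of \<open>w\<^sub>t + F(w)\<^sub>x = 0\<close>, \<open>w(x,0) = w\<^sub>0(x)\<close> with values in \<open>S\<close>; \<open>w\<close> is scalar or
  vector valued. The initial datum is attained as an element of \<open>L\<^sup>1\<^sub>l\<^sub>o\<^sub>c\<close>, i.e. almost everywhere.
\<close>

definition weak_solution ::
  "'a::euclidean_space set \<Rightarrow> ('a \<Rightarrow> 'a) \<Rightarrow> (real \<Rightarrow> 'a) \<Rightarrow> (real \<Rightarrow> real \<Rightarrow> 'a) \<Rightarrow> bool" where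
  "weak_solution S F w0 w \<longleftrightarrow>
     (\<forall>x. \<forall>t\<ge>0. w x t \<in> S) \<and>
     bounded ((\<lambda>(x, t). w x t) ` (UNIV \<times> {0..})) \<and>
     (\<lambda>(x, t). w x t) \<in> borel_measurable (lebesgue_on (UNIV \<times> {0..})) \<and>
     L1loc_continuous_on {0..} w \<and>
     (AE x in lebesgue. w x 0 = w0 x) \<and>
     (\<forall>\<psi>. test_function \<psi> \<longrightarrow>
        (LINT (x, t):UNIV \<times> {0<..}|lebesgue.
           deriv (\<lambda>s. \<psi> x s) t *\<^sub>R w x t + deriv (\<lambda>y. \<psi> y t) x *\<^sub>R F (w x t)) = 0)"

text \<open>
  \<open>ext E Q\<close> states that \<open>(E, Q)\<close> is a convex extension of the equation.
\<close>

definition admissible_weak_solution ::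
  "'a::euclidean_space set \<Rightarrow> ('a \<Rightarrow> 'a) \<Rightarrow> (('a \<Rightarrow> real) \<Rightarrow> ('a \<Rightarrow> real) \<Rightarrow> bool) \<Rightarrow>
   (real \<Rightarrow> 'a) \<Rightarrow> (real \<Rightarrow> real \<Rightarrow> 'a) \<Rightarrow> bool" where
  "admissible_weak_solution S F ext w0 w \<longleftrightarrow>
     weak_solution S F w0 w \<and>
     (\<forall>E Q \<psi>. ext E Q \<and> C1_test_function \<psi> \<and> (\<forall>x t. \<psi> x t \<ge> 0) \<longrightarrow>
        (LINT (x, t):UNIV \<times> {0<..}|lebesgue.
           deriv (\<lambda>s. \<psi> x s) t * E (w x t) + deriv (\<lambda>y. \<psi> y t) x * Q (w x t)) \<ge> 0)"


section \<open>The scalar equation and the system\<close>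

definition scalar_convex_extension ::
  "real set \<Rightarrow> (real \<Rightarrow> real) \<Rightarrow> (real \<Rightarrow> real) \<Rightarrow> (real \<Rightarrow> real) \<Rightarrow> bool" where
  "scalar_convex_extension J g E Q \<longleftrightarrow>
     smooth_on J E \<and> convex_on J E \<and> Ck_on 1 J Q \<and>
     (\<forall>\<sigma>\<in>J. \<exists>E'. (E has_real_derivative E') (at \<sigma> within J) \<and>
                  (Q has_real_derivative E' * deriv g \<sigma>) (at \<sigma> within J))"

definition state_space :: "real set \<Rightarrow> (real \<times> real) set" where
  "state_space J = {(\<eta>, v). \<eta> > 0 \<and> v / \<eta> \<in> J}"

definition system_flux :: "(real \<Rightarrow> real) \<Rightarrow> real \<times> real \<Rightarrow> real \<times> real" where
  "system_flux G = (\<lambda>(\<eta>, v). (- G (v / \<eta>), 0))"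

text \<open>
  The numbers \<open>E\<eta>\<close> and \<open>Ev\<close> are the partial derivatives of \<open>E\<close> at \<open>(\<eta>, v)\<close>; the coefficients of \<open>h\<close>
  and \<open>k\<close> in the derivative of \<open>Q\<close> are its partial derivatives with respect to \<open>\<eta>\<close> and \<open>v\<close>.
\<close>

definition system_convex_extension ::
  "real set \<Rightarrow> (real \<Rightarrow> real) \<Rightarrow> (real \<times> real \<Rightarrow> real) \<Rightarrow> (real \<times> real \<Rightarrow> real) \<Rightarrow> bool" where
  "system_convex_extension J G E Q \<longleftrightarrow>
     smooth_on (state_space J) E \<and> convex_on (state_space J) E \<and> Ck_on 1 (state_space J) Q \<and>
     (\<forall>(\<eta>, v)\<in>state_space J. \<exists>E\<eta> Ev.
        (E has_derivative (\<lambda>(h, k). E\<eta> * h + Ev * k)) (at (\<eta>, v) within state_space J) \<and>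
        (Q has_derivative
           (\<lambda>(h, k). (E\<eta> * (v / \<eta>\<^sup>2) * deriv G (v / \<eta>)) * h + (- (E\<eta> * (1 / \<eta>) * deriv G (v / \<eta>))) * k))
          (at (\<eta>, v) within state_space J))"

text \<open>
  Distributional solutions of \<open>\<gamma>\<^sub>x = \<eta>\<close>, \<open>\<gamma>\<^sub>t = u\<close>, \<open>\<gamma>(x,0) = x\<close>. A distribution whose first derivatives
  are bounded functions is a locally Lipschitz function; \<open>\<gamma>\<close> denotes its continuous representative, which
  gives a meaning to the initial condition and to \<open>\<gamma>(\<cdot>,t)\<close> for every single \<open>t\<close>.
\<close>

definition lagrangian_map ::
  "(real \<Rightarrow> real \<Rightarrow> real) \<Rightarrow> (real \<Rightarrow> real \<Rightarrow> real) \<Rightarrow> (real \<Rightarrow> real \<Rightarrow> real) \<Rightarrow> bool" where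
  "lagrangian_map \<eta> u \<gamma> \<longleftrightarrow>
     continuous_on (UNIV \<times> {0..}) (\<lambda>(x, t). \<gamma> x t) \<and>
     (\<forall>\<psi>. test_function \<psi> \<longrightarrow>
        (LINT (x, t):UNIV \<times> {0<..}|lebesgue. \<gamma> x t * deriv (\<lambda>y. \<psi> y t) x) =
          - (LINT (x, t):UNIV \<times> {0<..}|lebesgue. \<eta> x t * \<psi> x t) \<and>
        (LINT (x, t):UNIV \<times> {0<..}|lebesgue. \<gamma> x t * deriv (\<lambda>s. \<psi> x s) t) =
          - (LINT (x, t):UNIV \<times> {0<..}|lebesgue. u x t * \<psi> x t)) \<and>
     (\<forall>x. \<gamma> x 0 = x)"

end

theory Submission
  imports Defs
begin

text \<open>
  If \<open>(E, Q)\<close> is a convex extension of the scalar equation, then \<open>\<eta> E(v/\<eta>)\<close> and \<open>(Q - G E)(v/\<eta>)\<close> form a convex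
  extension of the system: the perspective of a convex function is convex. For a test function
  \<open>\<psi>\<close> put \<open>\<phi>(x,t) = \<psi>(\<gamma>(x,t),t)\<close>; the chain rule and \<open>\<gamma>\<^sub>x = \<eta>\<close>, \<open>\<gamma>\<^sub>t = G(v/\<eta>)\<close> turn the integrand
  \<open>\<phi>\<^sub>t \<eta> E + \<phi>\<^sub>x (Q - G E)\<close> into \<open>(\<psi>\<^sub>t E + \<psi>\<^sub>x Q) \<eta>\<close>, which the substitution \<open>x = \<gamma>(y,t)\<close>
  transforms into the scalar entropy integral. As \<open>\<phi>\<close> is only Lipschitz, \<open>\<gamma>\<close> is
  first replaced by its averages over the space intervals \<open>[x, x + h]\<close>. These are already
  continuously differentiable, and since \<open>\<eta>\<close> and \<open>v\<close> have bounded variation, their derivatives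
  converge outside a countable set for each \<open>t > 0\<close>.
\<close>

section \<open>Smooth functions and test functions\<close>

text \<open>The hypotheses speak of test functions on the half-plane, whereas substitution and
  averaging need statements at every single time. These come from testing with products p(x) q(t),
  combined with continuity in time in L1: v(.,t) = \<sigma>0 almost everywhere, and the increments
  of \<gamma>(.,t) as integrals of \<eta>(.,t). Since \<alpha> <= \<sigma>0 and v <= \<beta> \<eta>,
  the first one bounds \<eta> from below by \<delta> = \<alpha>/\<beta>, so that \<gamma>(.,t) is
  bi-Lipschitz uniformly in t. Averaging in space alone is enough, because the average of
  G(v/\<eta>) over an interval is already continuous in time. The averaged test functions are C1 but
  not smooth; the entropy inequality admits them, the weak equation does not. The conservation law
  for \<sigma> is therefore obtained separately: for E = id and Q = g the flux Q - G E vanishes, and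
  the remaining term is the time derivative of \<phi> multiplied by the time-independent \<sigma>0,
  whose integral is zero. At t = 0 the values of \<eta> and v are known only almost everywhere,
  which is why continuity of \<sigma> at that time needs \<sigma>0 as a representative.\<close>

lemma Ck_on_mono: "Ck_on (Suc k) S f \<Longrightarrow> Ck_on k S f"
proof (induction k arbitrary: f)
  case 0
  then show ?case
    by (auto simp: continuous_on_eq_continuous_within intro: has_derivative_continuous)
next
  case (Suc k)
  then show ?case by (subst Ck_on.simps) (metis Ck_on.simps(2))
qed

lemma Ck_on_const: "Ck_on k S (\<lambda>x. c)"
proof (induction k arbitrary: c)
  case (Suc k)
  show ?case by (simp, rule exI[of _ "\<lambda>x h. 0"]) (auto simp: Suc)
qed simp

lemma Ck_on_add:
  "Ck_on k S f \<Longrightarrow> Ck_on k S g \<Longrightarrow> Ck_on k S (\<lambda>x. f x + g x)"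
proof (induction k arbitrary: f g)
  case (Suc k)
  then obtain f' g' where
    *: "\<forall>x\<in>S. (f has_derivative f' x) (at x within S)" "\<forall>h. Ck_on k S (\<lambda>x. f' x h)"
       "\<forall>x\<in>S. (g has_derivative g' x) (at x within S)" "\<forall>h. Ck_on k S (\<lambda>x. g' x h)" by auto
  show ?case
    by (simp, rule exI[of _ "\<lambda>x h. f' x h + g' x h"]) (use * Suc.IH in \<open>auto intro!: has_derivative_add\<close>)
qed (simp add: continuous_on_add)

lemma Ck_on_mult:
  fixes f g :: "'a::real_normed_vector \<Rightarrow> real"
  shows "Ck_on k S f \<Longrightarrow> Ck_on k S g \<Longrightarrow> Ck_on k S (\<lambda>x. f x * g x)"
proof (induction k arbitrary: f g)
  case (Suc k)
  then obtain f' g' where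
    *: "\<forall>x\<in>S. (f has_derivative f' x) (at x within S)" "\<forall>h. Ck_on k S (\<lambda>x. f' x h)"
       "\<forall>x\<in>S. (g has_derivative g' x) (at x within S)" "\<forall>h. Ck_on k S (\<lambda>x. g' x h)" by auto
  have "Ck_on k S f" "Ck_on k S g" using Suc.prems Ck_on_mono by blast+
  then show ?case
    by (simp, intro exI[of _ "\<lambda>x h. f x * g' x h + f' x h * g x"])
       (use * Suc.IH in \<open>auto intro!: has_derivative_mult Ck_on_add\<close>)
qed (simp add: continuous_on_mult)

lemma Ck_on_uminus:
  fixes f :: "'a::real_normed_vector \<Rightarrow> real"
  shows "Ck_on k S f \<Longrightarrow> Ck_on k S (\<lambda>x. - f x)"
  using Ck_on_mult[OF Ck_on_const[of k S "-1"], of f] by simp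

lemma Ck_on_diff:
  fixes f g :: "'a::real_normed_vector \<Rightarrow> real"
  shows "Ck_on k S f \<Longrightarrow> Ck_on k S g \<Longrightarrow> Ck_on k S (\<lambda>x. f x - g x)"
  using Ck_on_add[OF _ Ck_on_uminus, of k S f g] by simp

lemma Ck_on_linear: "bounded_linear f \<Longrightarrow> Ck_on k S f"
proof (cases k)
  case (Suc n)
  assume "bounded_linear f"
  then show ?thesis
    by (simp add: Suc, intro exI[of _ "\<lambda>x h. f h"])
       (auto intro: bounded_linear_imp_has_derivative Ck_on_const)
qed (simp add: linear_continuous_on)

text \<open>With a real intermediate variable the inner direction \<open>r' x h\<close> leaves
  \<open>f'\<close> as a scalar factor. The derivative is then a product whose second factor is
  again a real function composed with \<open>r\<close>, and this closes the induction.\<close>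

lemma Ck_on_compose_real:
  fixes f :: "real \<Rightarrow> real"
  shows "Ck_on k J f \<Longrightarrow> Ck_on k S r \<Longrightarrow> r ` S \<subseteq> J \<Longrightarrow> Ck_on k S (\<lambda>x. f (r x))"
proof (induction k arbitrary: f)
  case 0
  then show ?case by (auto intro: continuous_on_compose2)
next
  case (Suc k)
  then obtain f' r' where
    *: "\<forall>x\<in>J. (f has_derivative f' x) (at x within J)" "\<forall>h. Ck_on k J (\<lambda>x. f' x h)"
       "\<forall>x\<in>S. (r has_derivative r' x) (at x within S)" "\<forall>h. Ck_on k S (\<lambda>x. r' x h)" by auto
  have lin: "f' x h = h * f' x 1" if "x \<in> J" for x h
  proof -
    interpret bounded_linear "f' x" using *(1) that by (auto intro: has_derivative_bounded_linear)
    show ?thesis using scaleR[of h 1] by simp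
  qed
  have "((\<lambda>x. f (r x)) has_derivative (\<lambda>h. r' x h * f' (r x) 1)) (at x within S)" if "x \<in> S" for x
  proof -
    have "(f has_derivative f' (r x)) (at (r x) within r ` S)"
      using *(1) that Suc.prems(3) by (blast intro: has_derivative_subset)
    from diff_chain_within[OF *(3)[rule_format, OF that] this]
    have "((\<lambda>x. f (r x)) has_derivative (\<lambda>h. f' (r x) (r' x h))) (at x within S)"
      by (simp add: o_def)
    moreover have "(\<lambda>h. f' (r x) (r' x h)) = (\<lambda>h. r' x h * f' (r x) 1)"
      using Suc.prems(3) that by (intro ext lin) auto
    ultimately show ?thesis by simp
  qed
  moreover have "Ck_on k S r" using Suc.prems(2) by (rule Ck_on_mono)
  then have "Ck_on k S (\<lambda>x. r' x h * f' (r x) 1)" for h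
    using * Suc.prems by (intro Ck_on_mult Suc.IH[of "\<lambda>y. f' y 1"]) auto
  ultimately show ?case
    unfolding Ck_on.simps by (intro exI[of _ "\<lambda>x h. r' x h * f' (r x) 1"] conjI ballI allI)
qed

text \<open>The derivative is a polynomial in \<open>inverse\<close> itself and the direction, so
  the product rule and the induction hypothesis suffice.\<close>

lemma Ck_on_inverse: "J \<subseteq> {0<..} \<Longrightarrow> Ck_on k J (inverse :: real \<Rightarrow> real)"
proof (induction k)
  case 0
  then show ?case by (auto intro!: continuous_on_inverse continuous_on_id simp: less_le)
next
  case (Suc k)
  have "(inverse has_derivative (\<lambda>h. - (inverse x * h * inverse x))) (at x within J)" if "x \<in> J" for x
    using that Suc.prems by (intro has_derivative_inverse') auto
  moreover have "Ck_on k J (\<lambda>x. - (inverse x * h * inverse x))" for h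
    using Suc by (intro Ck_on_uminus Ck_on_mult Ck_on_const) auto
  ultimately show ?case by (auto intro!: exI[of _ "\<lambda>x h. - (inverse x * h * inverse x)"])
qed

lemma smooth_onI: "(\<And>k. Ck_on k S f) \<Longrightarrow> smooth_on S f"
  and smooth_onD: "smooth_on S f \<Longrightarrow> Ck_on k S f"
  by (auto simp: smooth_on_def)

text \<open>In one variable all directional derivatives are multiples of the one in direction 1,
  which uniqueness of the derivative identifies with \<open>f'\<close>.\<close>

lemma Ck_on_has_real_derivative_iff:
  fixes f :: "real \<Rightarrow> real"
  assumes "\<And>x. (f has_real_derivative f' x) (at x)"
  shows "Ck_on (Suc k) UNIV f \<longleftrightarrow> Ck_on k UNIV f'"
proof
  assume "Ck_on (Suc k) UNIV f"
  then obtain D where D: "\<And>x. (f has_derivative D x) (at x)" "\<And>h. Ck_on k UNIV (\<lambda>x. D x h)" by auto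
  have "D x 1 = f' x" for x
    using has_derivative_unique[OF D(1)[of x], of "(*) (f' x)"] assms[of x]
    by (simp add: has_field_derivative_def)
  then show "Ck_on k UNIV f'" using D(2)[of 1] by simp
next
  assume "Ck_on k UNIV f'"
  then show "Ck_on (Suc k) UNIV f"
    using assms unfolding Ck_on.simps has_field_derivative_def
    by (intro exI[of _ "\<lambda>x h. f' x * h"]) (simp add: Ck_on_mult Ck_on_const)
qed

section \<open>Smooth step functions built from exp(-1/x)\<close>

text \<open>The powers of \<open>1/x\<close> make the family closed under differentiation, up to linear combinations.\<close>

definition flat_exp :: "nat \<Rightarrow> real \<Rightarrow> real" where
  "flat_exp m x = (if x > 0 then inverse x ^ m * exp (- inverse x) else 0)"

lemma flat_exp_tendsto_0: "((\<lambda>x. flat_exp m x) \<longlongrightarrow> 0) (at_right 0)"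
proof -
  have "((\<lambda>x::real. x ^ m / exp x) \<longlongrightarrow> 0) at_top" by (rule tendsto_power_div_exp_0)
  then have "((\<lambda>x::real. inverse x ^ m / exp (inverse x)) \<longlongrightarrow> 0) (at_right 0)"
    using filterlim_compose[OF _ filterlim_inverse_at_top_right] by blast
  then show ?thesis
    by (rule Lim_transform_eventually)
       (auto simp: flat_exp_def eventually_at_filter exp_minus field_simps)
qed

lemma flat_exp_has_derivative:
  "(flat_exp m has_real_derivative (flat_exp (m + 2) x - real m * flat_exp (Suc m) x)) (at x)"
proof -
  consider "x < 0" | "x = 0" | "x > 0" by linarith
  then show ?thesis
  proof cases
    case 1
    then have eq: "flat_exp (m + 2) x - real m * flat_exp (Suc m) x = 0" by (simp add: flat_exp_def)
    show ?thesis
      unfolding eq 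
      by (rule has_field_derivative_transform_within_open[where f="\<lambda>x. 0" and S="{..<0}"])
         (use 1 in \<open>auto simp: flat_exp_def\<close>)
  next
    case 3
    have "((\<lambda>x. inverse x ^ m * exp (- inverse x)) has_real_derivative
        flat_exp (m + 2) x - real m * flat_exp (Suc m) x) (at x)"
    \<comment> \<open>Writing the exponent as \<open>Suc n\<close> avoids the truncated exponent m -
      1 in the power rule.\<close>
    proof (cases m)
      case 0
      then show ?thesis
        using 3 by (auto intro!: derivative_eq_intros simp: power2_eq_square flat_exp_def)
    next
      case (Suc n)
      have "(inverse has_real_derivative - (inverse x * inverse x)) (at x)"
        using 3 DERIV_inverse[of x UNIV] by (simp add: power2_eq_square)
      note DERIV_mult[OF DERIV_power[OF this, of "Suc n"]]
      moreover have "((\<lambda>x. exp (- inverse x)) has_real_derivative exp (- inverse x) * (inverse x * inverse x)) (at x)"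
        using 3 by (auto intro!: derivative_eq_intros simp: power2_eq_square)
      ultimately have "((\<lambda>x. inverse x ^ Suc n * exp (- inverse x)) has_real_derivative
         real (Suc n) * (- (inverse x * inverse x) * inverse x ^ n) * exp (- inverse x)
         + exp (- inverse x) * (inverse x * inverse x) * inverse x ^ Suc n) (at x)"
        by fastforce
      then show ?thesis
        using 3 by (simp add: Suc flat_exp_def algebra_simps)
    qed
    then show ?thesis
      by (rule has_field_derivative_transform_within_open[where S="{0<..}"])
         (use 3 in \<open>auto simp: flat_exp_def\<close>)
  next
    case 2
    \<comment> \<open>The difference quotient at 0 is \<open>flat_exp (Suc m)\<close> on the right
      and 0 on the left, so the vanishing limit of the next member of the family gives derivative
      0.\<close>
    have "((\<lambda>h. flat_exp m h / h) \<longlongrightarrow> 0) (at 0)"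
    proof (rule filterlim_split_at)
      show "((\<lambda>h. flat_exp m h / h) \<longlongrightarrow> 0) (at_left 0)"
        by (rule Lim_transform_eventually[of "\<lambda>x. 0"])
           (auto simp: flat_exp_def eventually_at_filter)
      show "((\<lambda>h. flat_exp m h / h) \<longlongrightarrow> 0) (at_right 0)"
        by (rule Lim_transform_eventually[OF flat_exp_tendsto_0[of "Suc m"]])
           (auto simp: flat_exp_def eventually_at_filter field_simps)
    qed
    then show ?thesis by (simp add: 2 has_field_derivative_iff flat_exp_def)
  qed
qed

lemma flat_exp_smooth: "Ck_on k UNIV (flat_exp m)"
proof (induction k arbitrary: m)
  case 0
  then show ?case
    using flat_exp_has_derivative by (auto intro!: continuous_at_imp_continuous_on DERIV_isCont)
next
  case (Suc k)
  then show ?case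
    by (subst Ck_on_has_real_derivative_iff[OF flat_exp_has_derivative])
       (intro Ck_on_diff Ck_on_mult Ck_on_const Suc)
qed

text \<open>The usual transition e(x) / (e(x) + e(1 - x)) with e = \<open>flat_exp 0\<close>; the
  denominator is positive because x and 1 - x are not both nonpositive. The derivative
  \<open>p\<close> is exported as well, since it becomes the profile of a mollifier.\<close>

lemma ex_smooth_step:
  obtains P p :: "real \<Rightarrow> real" where
    "smooth_on UNIV P" "\<And>x. (P has_real_derivative p x) (at x)" "continuous_on UNIV p"
    "\<And>x. 0 \<le> p x" "\<And>x. x \<notin> {0..1} \<Longrightarrow> p x = 0" "\<And>x. x \<le> 0 \<Longrightarrow> P x = 0" "\<And>x. x \<ge> 1 \<Longrightarrow> P x = 1"
    "\<And>x. 0 \<le> P x" "\<And>x. P x \<le> 1"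
proof -
  define d where "d x = flat_exp 0 x + flat_exp 0 (1 - x)" for x :: real
  define P where "P x = flat_exp 0 x * inverse (d x)" for x :: real
  \<comment> \<open>The quotient rule for \<open>P\<close> after the products
    \<open>flat_exp 2 x * flat_exp 0 x\<close> have cancelled; in this form nonnegativity is
    visible.\<close>
  define p where "p x = (flat_exp 2 x * flat_exp 0 (1 - x) + flat_exp 0 x * flat_exp 2 (1 - x)) / (d x)\<^sup>2" for x
  have nn: "0 \<le> flat_exp m x" for m x by (auto simp: flat_exp_def)
  have dpos: "d x > 0" for x by (auto simp: d_def flat_exp_def add_pos_pos)
  have "(P has_real_derivative p x) (at x)" for x
  proof -
    have e: "(flat_exp 0 has_real_derivative flat_exp 2 x) (at x)" for x
      using flat_exp_has_derivative[of 0 x] by (simp add: numeral_2_eq_2)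
    have e1: "((\<lambda>x. flat_exp 0 (1 - x)) has_real_derivative - flat_exp 2 (1 - x)) (at x)"
    proof -
      have "((\<lambda>x. 1 - x) has_real_derivative -1) (at x)" by (auto intro!: derivative_eq_intros)
      from DERIV_chain2[where f="flat_exp 0" and g="\<lambda>x. 1 - x", OF e this] show ?thesis by simp
    qed
    have "(d has_real_derivative flat_exp 2 x - flat_exp 2 (1 - x)) (at x)"
      unfolding d_def using DERIV_add[OF e e1] by simp
    from DERIV_divide[OF e this] dpos[of x]
    have "((\<lambda>x. flat_exp 0 x / d x) has_real_derivative
        (flat_exp 2 x * d x - flat_exp 0 x * (flat_exp 2 x - flat_exp 2 (1 - x))) / (d x * d x)) (at x)"
      by simp
    moreover have "P = (\<lambda>x. flat_exp 0 x / d x)" by (simp add: P_def divide_inverse fun_eq_iff)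
    moreover have "(flat_exp 2 x * d x - flat_exp 0 x * (flat_exp 2 x - flat_exp 2 (1 - x))) / (d x * d x) = p x"
      by (simp add: p_def d_def power2_eq_square algebra_simps)
    ultimately show ?thesis by simp
  qed note der = this
  have refl: "Ck_on k UNIV (\<lambda>x. flat_exp m (1 - x))" for k m
  proof (rule Ck_on_compose_real[of k UNIV "flat_exp m", OF flat_exp_smooth])
    show "Ck_on k UNIV (\<lambda>x. 1 - x :: real)"
      by (rule Ck_on_diff, rule Ck_on_const, rule Ck_on_linear, rule bounded_linear_ident)
  qed simp
  have sm: "Ck_on k UNIV P" for k
    unfolding P_def
  proof (rule Ck_on_mult[OF flat_exp_smooth], rule Ck_on_compose_real[of k "{0<..}" inverse])
    show "Ck_on k UNIV d" unfolding d_def by (rule Ck_on_add[OF flat_exp_smooth refl])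
  qed (use dpos in \<open>auto intro: Ck_on_inverse\<close>)
  have "Ck_on 0 UNIV p" using Ck_on_has_real_derivative_iff[OF der] sm by blast
  then have "continuous_on UNIV p" by simp
  moreover have "0 \<le> p x" for x by (simp add: p_def nn)
  moreover have "p x = 0" if "x \<notin> {0..1}" for x using that by (auto simp: p_def flat_exp_def)
  moreover have "P x = 0" if "x \<le> 0" for x using that by (simp add: P_def flat_exp_def)
  moreover have "P x = 1" if "x \<ge> 1" for x
    using that dpos[of x] by (simp add: P_def d_def flat_exp_def)
  moreover have "0 \<le> P x" "P x \<le> 1" for x
    using nn[of 0 x] nn[of 0 "1 - x"] dpos[of x] by (simp_all add: P_def d_def inverse_eq_divide divide_le_eq)
  ultimately show thesis by (intro that[of P p] smooth_onI sm der)
qed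

section \<open>Test functions of two variables and their partial derivatives\<close>

lemma Ck_on_fst_compose: "Ck_on k UNIV p \<Longrightarrow> Ck_on k UNIV (\<lambda>z::real\<times>real. (p (fst z) :: real))"
  and Ck_on_snd_compose: "Ck_on k UNIV p \<Longrightarrow> Ck_on k UNIV (\<lambda>z::real\<times>real. (p (snd z) :: real))"
  by (auto intro: Ck_on_compose_real[of k UNIV p UNIV fst] Ck_on_compose_real[of k UNIV p UNIV snd]
      Ck_on_linear[OF bounded_linear_fst] Ck_on_linear[OF bounded_linear_snd])

lemma supported_in_upperI:
  assumes "\<And>x t. \<not> (x \<in> {c..d} \<and> t \<in> {p..q}) \<Longrightarrow> \<psi> x t = 0" "0 < p"
  shows "supported_in_upper \<psi>"
proof -
  have "{(x, t). \<psi> x t \<noteq> 0} \<subseteq> {c..d} \<times> {p..q}" using assms(1) by fastforce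
  then have sub: "closure {(x, t). \<psi> x t \<noteq> 0} \<subseteq> {c..d} \<times> {p..q}"
    by (rule closure_minimal) (auto intro: closed_Times)
  then have "compact (closure {(x, t). \<psi> x t \<noteq> 0})"
    using compact_Int_closed[of "{c..d} \<times> {p..q}"] compact_Times[of "{c..d}" "{p..q}"]
    by (metis Int_absorb1 closed_closure compact_Icc)
  then show ?thesis using sub assms(2) by (force simp: supported_in_upper_def)
qed

lemma test_function_product:
  fixes p q :: "real \<Rightarrow> real"
  assumes "smooth_on UNIV p" "smooth_on UNIV q"
    and p: "\<And>x. x \<notin> {a..b} \<Longrightarrow> p x = 0" and q: "\<And>t. t \<notin> {c..d} \<Longrightarrow> q t = 0" and "0 < c"
  shows "test_function (\<lambda>x t. p x * q t)"
proof -
  have "smooth_on UNIV (\<lambda>(x, t). p x * q t)"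
    unfolding split_beta
    using assms by (intro smooth_onI Ck_on_mult Ck_on_fst_compose Ck_on_snd_compose) (auto dest: smooth_onD)
  moreover have "supported_in_upper (\<lambda>x t. p x * q t)"
    by (rule supported_in_upperI[of a b c d]) (use p q \<open>0 < c\<close> in auto)
  ultimately show ?thesis by (simp add: test_function_def)
qed

text \<open>\<open>Ck_on\<close> provides a derivative only existentially, while the weak
  formulations are written with \<open>deriv\<close> in each variable. Restriction to the coordinate
  lines identifies the two partial derivatives and thereby the total one.\<close>

lemma has_derivative_of_C1:
  assumes "Ck_on 1 UNIV (\<lambda>(x, t). \<psi> x t)"
  shows "((\<lambda>(x, t). \<psi> x t) has_derivative
      (\<lambda>(h, k). deriv (\<lambda>y. \<psi> y t) x * h + deriv (\<lambda>s. \<psi> x s) t * k)) (at (x, t :: real))"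
    and "continuous_on UNIV (\<lambda>(x, t). deriv (\<lambda>y. \<psi> y t) x)"
    and "continuous_on UNIV (\<lambda>(x, t). deriv (\<lambda>s. \<psi> x s) t)"
    and "((\<lambda>y. \<psi> y t) has_real_derivative deriv (\<lambda>y. \<psi> y t) x) (at (x :: real))"
    and "((\<lambda>s. \<psi> x s) has_real_derivative deriv (\<lambda>s. \<psi> x s) t) (at t)"
    and "continuous_on UNIV (\<lambda>(x, t). \<psi> x t)"
proof -
  obtain D where D: "\<And>z. ((\<lambda>(x, t). \<psi> x t) has_derivative D z) (at z)"
    "\<And>h. continuous_on UNIV (\<lambda>z. D z h)" using assms by auto
  have x: "((\<lambda>y. \<psi> y t) has_real_derivative D (x, t) (1, 0)) (at x)" for x t
  proof -
    interpret bounded_linear "D (x, t)" using D(1) by (rule has_derivative_bounded_linear)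
    have "((\<lambda>y. (y, t)) has_derivative (\<lambda>h. (h, 0))) (at x)" by (auto intro!: derivative_eq_intros)
    from diff_chain_at[OF this D(1)] have "((\<lambda>y. \<psi> y t) has_derivative (\<lambda>h. D (x, t) (h, 0))) (at x)"
      by (simp add: o_def)
    moreover have "(\<lambda>h. D (x, t) (h, 0)) = (*) (D (x, t) (1, 0))"
    proof
      fix h show "D (x, t) (h, 0) = D (x, t) (1, 0) * h" using scaleR[of h "(1, 0)"] by simp
    qed
    ultimately show ?thesis by (simp add: has_field_derivative_def)
  qed
  have t: "((\<lambda>s. \<psi> x s) has_real_derivative D (x, t) (0, 1)) (at t)" for x t
  proof -
    interpret bounded_linear "D (x, t)" using D(1) by (rule has_derivative_bounded_linear)
    have "((\<lambda>s. (x, s)) has_derivative (\<lambda>h. (0, h))) (at t)" by (auto intro!: derivative_eq_intros)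
    from diff_chain_at[OF this D(1)] have "((\<lambda>s. \<psi> x s) has_derivative (\<lambda>h. D (x, t) (0, h))) (at t)"
      by (simp add: o_def)
    moreover have "(\<lambda>h. D (x, t) (0, h)) = (*) (D (x, t) (0, 1))"
    proof
      fix h show "D (x, t) (0, h) = D (x, t) (0, 1) * h" using scaleR[of h "(0, 1)"] by simp
    qed
    ultimately show ?thesis by (simp add: has_field_derivative_def)
  qed
  have dx: "deriv (\<lambda>y. \<psi> y t) x = D (x, t) (1, 0)" for x t using x by (rule DERIV_imp_deriv)
  have dt: "deriv (\<lambda>s. \<psi> x s) t = D (x, t) (0, 1)" for x t using t by (rule DERIV_imp_deriv)
  have "D (x, t) = (\<lambda>(h, k). deriv (\<lambda>y. \<psi> y t) x * h + deriv (\<lambda>s. \<psi> x s) t * k)" for x t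
  proof -
    interpret bounded_linear "D (x, t)" using D(1) by (rule has_derivative_bounded_linear)
    have *: "D (x, t) (h, k) = D (x, t) (1, 0) * h + D (x, t) (0, 1) * k" for h k
      using add[of "h *\<^sub>R (1, 0)" "k *\<^sub>R (0, 1)"] scaleR[of h "(1, 0)"] scaleR[of k "(0, 1)"] by simp
    show ?thesis
    proof
      fix z show "D (x, t) z = (case z of (h, k) \<Rightarrow> deriv (\<lambda>y. \<psi> y t) x * h + deriv (\<lambda>s. \<psi> x s) t * k)"
        unfolding dx dt by (cases z, simp only: split_conv, rule *)
    qed
  qed
  then show "((\<lambda>(x, t). \<psi> x t) has_derivative
      (\<lambda>(h, k). deriv (\<lambda>y. \<psi> y t) x * h + deriv (\<lambda>s. \<psi> x s) t * k)) (at (x, t))"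
    using D(1)[of "(x, t)"] by simp
  show "continuous_on UNIV (\<lambda>(x, t). deriv (\<lambda>y. \<psi> y t) x)"
    "continuous_on UNIV (\<lambda>(x, t). deriv (\<lambda>s. \<psi> x s) t)"
    using D(2)[of "(1, 0)"] D(2)[of "(0, 1)"] by (simp_all add: dx dt case_prod_unfold)
  show "((\<lambda>y. \<psi> y t) has_real_derivative deriv (\<lambda>y. \<psi> y t) x) (at x)"
    "((\<lambda>s. \<psi> x s) has_real_derivative deriv (\<lambda>s. \<psi> x s) t) (at t)"
    using x t by (simp_all add: dx dt)
  show "continuous_on UNIV (\<lambda>(x, t). \<psi> x t)"
    by (intro continuous_at_imp_continuous_on ballI has_derivative_continuous[OF D(1)])
qed

text \<open>Needed to recognise the pulled-back functions as C1 test functions. Total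
  differentiability follows from one partial derivative together with continuity of the
  other.\<close>

lemma C1_from_partials:
  fixes \<phi> :: "real \<Rightarrow> real \<Rightarrow> real"
  assumes x: "\<And>x t. ((\<lambda>y. \<phi> y t) has_real_derivative X x t) (at x)"
    and t: "\<And>x t. ((\<lambda>s. \<phi> x s) has_real_derivative Y x t) (at t)"
    and X: "continuous_on UNIV (\<lambda>(x, t). X x t)" and Y: "continuous_on UNIV (\<lambda>(x, t). Y x t)"
  shows "Ck_on 1 UNIV (\<lambda>(x, t). \<phi> x t)"
proof -
  have "((\<lambda>(x, t). \<phi> x t) has_derivative (\<lambda>(h, k). X x t * h + Y x t * k)) (at (x, t))" for x t
  proof -
    have "((\<lambda>(x, t). \<phi> x t) has_derivative (\<lambda>(tx, ty). X x t * tx + blinfun_apply (blinfun_mult_right (Y x t)) ty))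
       (at (x, t) within UNIV \<times> UNIV)"
    proof (rule has_derivative_partialsI)
      show "((\<lambda>x. \<phi> x t) has_derivative (*) (X x t)) (at x within UNIV)"
        using x by (simp add: has_field_derivative_def)
      show "(\<phi> x' has_derivative blinfun_apply (blinfun_mult_right (Y x' t'))) (at t' within UNIV)" for x' t'
        using t[of x' t'] by (simp add: has_field_derivative_def mult.commute[of _ "Y x' t'"])
      have "isCont (\<lambda>z. Y (fst z) (snd z)) (x, t)"
        using Y by (simp add: continuous_on_eq_continuous_at split_beta)
      then have "((\<lambda>z. Y (fst z) (snd z)) \<longlongrightarrow> Y x t) (at (x, t))" by (simp add: isCont_def)
      then have "((\<lambda>z. blinfun_mult_right (Y (fst z) (snd z))) \<longlongrightarrow> blinfun_mult_right (Y x t)) (at (x, t))"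
        by (rule bounded_linear.tendsto[OF bounded_linear_blinfun_mult_right])
      then show "continuous (at (x, t) within UNIV \<times> UNIV) (\<lambda>(x, y). blinfun_mult_right (Y x y))"
        by (simp add: continuous_within case_prod_unfold)
    qed auto
    then show ?thesis by (simp add: split_beta mult.commute)
  qed
  moreover have "continuous_on UNIV (\<lambda>z. X (fst z) (snd z) * h + Y (fst z) (snd z) * k)" for h k
    using X Y by (auto intro!: continuous_intros simp: split_beta)
  ultimately have "\<forall>z\<in>UNIV. ((\<lambda>(x, t). \<phi> x t) has_derivative
      (\<lambda>h. X (fst z) (snd z) * fst h + Y (fst z) (snd z) * snd h)) (at z)"
    "\<forall>h. Ck_on 0 UNIV (\<lambda>z. X (fst z) (snd z) * fst h + Y (fst z) (snd z) * snd h)"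
    by (auto simp: case_prod_unfold)
  then show ?thesis
    unfolding One_nat_def Ck_on.simps(2)
    by (intro exI[of _ "\<lambda>z h. X (fst z) (snd z) * fst h + Y (fst z) (snd z) * snd h"] conjI)
qed

section \<open>Lebesgue integration\<close>

text \<open>Lebesgue measure is complete, so preimages that differ by a null set are measurable
  together.\<close>

lemma borel_measurable_lebesgue_AE:
  fixes f g :: "'a::euclidean_space \<Rightarrow> 'b::topological_space"
  assumes f: "f \<in> borel_measurable lebesgue" and ae: "AE x in lebesgue. f x = g x"
  shows "g \<in> borel_measurable lebesgue"
proof (rule measurableI)
  fix A :: "'b set" assume "A \<in> sets borel"
  then have "f -` A \<inter> space lebesgue \<in> sets lebesgue" using f by (rule measurable_sets[rotated])
  then show "g -` A \<inter> space lebesgue \<in> sets lebesgue"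
    by (rule completion.in_sets_AE[rotated]) (use ae in \<open>auto elim: eventually_mono\<close>)
qed simp

text \<open>By completeness, functions that agree almost everywhere are both measurable or both not,
  and in the second case both integrals have the default value 0. Sections can thus be exchanged
  before their measurability is known.\<close>

lemma integral_lebesgue_cong_AE:
  fixes f g :: "'a::euclidean_space \<Rightarrow> 'b::{banach, second_countable_topology}"
  assumes "AE x in lebesgue. f x = g x"
  shows "(LINT x|lebesgue. f x) = (LINT x|lebesgue. g x)"
proof (cases "f \<in> borel_measurable lebesgue")
  case True
  then have "g \<in> borel_measurable lebesgue" using assms by (rule borel_measurable_lebesgue_AE)
  then show ?thesis using True assms by (intro integral_cong_AE)
next
  case False
  have "AE x in lebesgue. g x = f x" using assms by (auto elim: eventually_mono)
  then have "g \<notin> borel_measurable lebesgue" using False borel_measurable_lebesgue_AE by blast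
  then have "\<not> integrable lebesgue f" "\<not> integrable lebesgue g" using False by auto
  then show ?thesis by (simp add: not_integrable_integral_eq)
qed

text \<open>Swapping the coordinates preserves the product measure, so the sections may be taken at
  fixed second coordinate.\<close>

lemma AE_lborel_sections:
  fixes P :: "real \<times> real \<Rightarrow> bool"
  assumes "AE z in lborel. P z"
  shows "AE t in lborel. AE x in lborel. P (x, t)"
proof -
  have "AE z in lborel \<Otimes>\<^sub>M lborel. P z" using assms by (subst lborel_prod)
  then have "AE z in distr (lborel \<Otimes>\<^sub>M lborel) (lborel \<Otimes>\<^sub>M lborel) (\<lambda>(x, y). (y, x)). P z"
    by (subst lborel_pair.distr_pair_swap[symmetric])
  then have "AE z in lborel \<Otimes>\<^sub>M lborel. P (snd z, fst z)"
    using AE_distrD[OF measurable_pair_swap'] by (fastforce simp: case_prod_unfold)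
  from lborel_pair.AE_pair[OF this] show ?thesis by simp
qed

text \<open>The completed measure of the plane is not the product of the completed measures of the
  line. So \<open>F\<close> is replaced by a Borel representative, Fubini is used for Borel measure,
  and the iterated integrals are changed back on almost every section.\<close>

lemma lebesgue_Fubini:
  fixes F :: "real \<times> real \<Rightarrow> real"
  assumes "integrable lebesgue F"
  shows "(LINT z|lebesgue. F z) = (LINT t|lebesgue. LINT x|lebesgue. F (x, t))"
    and "(LINT z|lebesgue. F z) = (LINT x|lebesgue. LINT t|lebesgue. F (x, t))"
proof -
  obtain H where H [measurable]: "H \<in> borel_measurable lborel" and ae: "AE z in lborel. F z = H z"
    using completion_ex_borel_measurable_real[of F lborel] borel_measurable_integrable[OF assms] by blast
  have eq: "(LINT z|lebesgue. F z) = (LINT z|lborel. H z)" and "integrable lebesgue H"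
  proof -
    have mH: "H \<in> borel_measurable lebesgue" by (intro measurable_completion H)
    show "integrable lebesgue H"
      using assms ae mH by (subst integrable_cong_AE[of _ _ F]) (auto intro: AE_completion elim: eventually_mono)
    have "(LINT z|lebesgue. F z) = (LINT z|lebesgue. H z)"
      using assms ae mH by (intro integral_cong_AE) (auto intro: AE_completion)
    then show "(LINT z|lebesgue. F z) = (LINT z|lborel. H z)" by (simp add: integral_completion)
  qed
  then have int: "integrable (lborel \<Otimes>\<^sub>M lborel) (case_prod (curry H))"
    by (simp add: lborel_prod integrable_completion)
  have ae2: "AE z in lborel \<Otimes>\<^sub>M lborel. F z = H z" using ae by (subst lborel_prod)
  have aex: "AE x in lborel. AE t in lborel. F (x, t) = H (x, t)"
    using lborel_pair.AE_pair[OF ae2] by simp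
  have aet: "AE t in lborel. AE x in lborel. F (x, t) = H (x, t)"
    by (rule AE_lborel_sections[OF ae])
  have cong: "(LINT x|lebesgue. f x) = (LINT x|lborel. g x)"
    if "AE x in lborel. f x = g x" "g \<in> borel_measurable lborel" for f g :: "real \<Rightarrow> real"
    using integral_lebesgue_cong_AE[OF AE_completion[OF that(1)]] integral_completion[OF that(2)] by simp
  have "(LINT t|lebesgue. LINT x|lebesgue. F (x, t)) = (LINT t|lborel. LINT x|lborel. H (x, t))"
  proof (rule cong)
    show "AE t in lborel. (LINT x|lebesgue. F (x, t)) = (LINT x|lborel. H (x, t))"
      using aet by eventually_elim (rule cong, auto)
  qed measurable
  also have "\<dots> = (LINT z|lborel. H z)"
    using lborel_pair.integral_snd[OF int] by (simp add: lborel_prod)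
  finally show "(LINT z|lebesgue. F z) = (LINT t|lebesgue. LINT x|lebesgue. F (x, t))"
    by (simp add: eq)
  have "(LINT x|lebesgue. LINT t|lebesgue. F (x, t)) = (LINT x|lborel. LINT t|lborel. H (x, t))"
  proof (rule cong)
    show "AE x in lborel. (LINT t|lebesgue. F (x, t)) = (LINT t|lborel. H (x, t))"
      using aex by eventually_elim (rule cong, auto)
  qed measurable
  also have "\<dots> = (LINT z|lborel. H z)"
    using lborel_pair.integral_fst[OF int] by (simp add: lborel_prod)
  finally show "(LINT z|lebesgue. F z) = (LINT x|lebesgue. LINT t|lebesgue. F (x, t))"
    by (simp add: eq)
qed

text \<open>The variation \<open>V\<close> up to a point is monotone and dominates increments: |f(y)
  - f(x)| <= |V(y) - V(x)|. Hence f is continuous wherever \<open>V\<close> is, and a monotone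
  function has countably many jumps.\<close>

lemma bounded_total_variation_countable_discontinuities:
  fixes f :: "real \<Rightarrow> real"
  assumes "bounded_total_variation f"
  shows "countable {x. \<not> isCont f x}"
proof -
  obtain C where C: "\<And>n p. mono p \<Longrightarrow> (\<Sum>i<n. norm (f (p (Suc i)) - f (p i))) \<le> C"
    using assms unfolding bounded_total_variation_def by blast
  define S where "S x = {(\<Sum>i<n. norm (f (p (Suc i)) - f (p i))) | n p. mono p \<and> p n \<le> x}" for x
  define V where "V x = Sup (S x)" for x
  have bdd: "bdd_above (S x)" for x
    unfolding S_def using C by (intro bdd_aboveI[of _ C]) auto
  have ne: "S x \<noteq> {}" for x
    unfolding S_def by (auto intro!: exI[of _ 0] exI[of _ "\<lambda>_. x"] simp: mono_def)
  have step: "V x + \<bar>f y - f x\<bar> \<le> V y" if "x \<le> y" for x y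
  proof -
    have "s \<le> V y - \<bar>f y - f x\<bar>" if "s \<in> S x" for s
    proof -
      obtain n p where s: "s = (\<Sum>i<n. norm (f (p (Suc i)) - f (p i)))" and p: "mono p" "p n \<le> x"
        using \<open>s \<in> S x\<close> by (auto simp: S_def)
      \<comment> \<open>The partition is prolonged by x and y, whose increment is the gain |f(y) -
        f(x)|. From index n + 2 on the sequence stays at y and so remains monotone.\<close>
      define q where "q i = (if i \<le> n then p i else if i = Suc n then x else y)" for i
      have q: "mono q"
      proof (rule monoI)
        fix i j :: nat assume "i \<le> j"
        have "p i \<le> x" if "i \<le> n" using monoD[OF p(1) that] p(2) by simp
        then show "q i \<le> q j"
          using \<open>i \<le> j\<close> \<open>x \<le> y\<close> monoD[OF p(1) \<open>i \<le> j\<close>] by (force simp: q_def)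
      qed
      have "(\<Sum>i<Suc (Suc n). norm (f (q (Suc i)) - f (q i))) \<in> S y"
        unfolding S_def using q by (auto intro!: exI[of _ "Suc (Suc n)"] exI[of _ q] simp: q_def)
      then have "(\<Sum>i<Suc (Suc n). norm (f (q (Suc i)) - f (q i))) \<le> V y"
        unfolding V_def using bdd by (rule cSup_upper)
      moreover have "(\<Sum>i<n. norm (f (q (Suc i)) - f (q i))) = s"
        unfolding s by (intro sum.cong) (auto simp: q_def)
      ultimately show ?thesis by (auto simp: q_def)
    qed
    then have "V x \<le> V y - \<bar>f y - f x\<bar>" unfolding V_def[of x] using ne by (intro cSup_least) auto
    then show ?thesis by simp
  qed
  have "mono V" using step by (intro monoI) (smt (verit))
  have "isCont f x" if "isCont V x" for x
  proof -
    have "\<bar>f y - f x\<bar> \<le> \<bar>V y - V x\<bar>" for y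
      using step[of x y] step[of y x] by (cases "x \<le> y") auto
    moreover have "((\<lambda>y. \<bar>V y - V x\<bar>) \<longlongrightarrow> 0) (at x)"
      using that by (auto simp: isCont_def intro!: tendsto_rabs_zero LIM_zero)
    ultimately have "((\<lambda>y. f y - f x) \<longlongrightarrow> 0) (at x)"
      by (rule_tac Lim_null_comparison) auto
    then show ?thesis by (simp add: isCont_def LIM_zero_cancel)
  qed
  then have "{x. \<not> isCont f x} \<subseteq> {x. \<not> isCont V x}" by auto
  then show ?thesis using mono_ctble_discont[OF \<open>mono V\<close>] countable_subset by blast
qed

section \<open>Weak derivatives\<close>

text \<open>The kernel has mass 1 and lives on [c, c + s], to the right of c only. Continuity from
  the right is therefore enough, which admits c = a, and \<open>c + s n <= b\<close> keeps the whole
  mass inside the interval.\<close>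

lemma mollified_tendsto:
  fixes A P p :: "real \<Rightarrow> real"
  assumes p: "\<And>x. (P has_real_derivative p x) (at x)" "continuous_on UNIV p" "\<And>x. 0 \<le> p x"
      "\<And>x. x \<notin> {0..1} \<Longrightarrow> p x = 0" "\<And>x. x \<le> 0 \<Longrightarrow> P x = 0" "\<And>x. x \<ge> 1 \<Longrightarrow> P x = 1"
    and A: "continuous_on {a..b} A" and c: "a \<le> c" "c < b"
    and s: "\<And>n. 0 < s n" "s \<longlonglongrightarrow> 0" "\<And>n. c + s n \<le> b"
  shows "(\<lambda>n. LINT x:{a..b}|lebesgue. A x * (p ((x - c) / s n) / s n)) \<longlonglongrightarrow> A c"
proof (rule LIMSEQ_I)
  fix r :: real assume "0 < r"
  have "continuous (at c within {a..b}) A" using A c by (simp add: continuous_on_eq_continuous_within)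
  then obtain d where d: "d > 0" "\<And>x. x \<in> {a..b} \<Longrightarrow> dist x c < d \<Longrightarrow> dist (A x) (A c) < r / 2"
    using \<open>0 < r\<close> unfolding continuous_within_eps_delta by (metis half_gt_zero)
  obtain N where N: "\<And>n. n \<ge> N \<Longrightarrow> s n < d" using LIMSEQ_D[OF s(2) d(1)] s(1) by fastforce
  have "norm ((LINT x:{a..b}|lebesgue. A x * (p ((x - c) / s n) / s n)) - A c) < r" if "n \<ge> N" for n
  proof -
    define k where "k x = p ((x - c) / s n) / s n" for x
    have s_nz: "s n \<noteq> 0" using s(1)[of n] by simp
    have k0: "k x \<ge> 0" for x using p(3) s(1)[of n] by (simp add: k_def)
    have kc: "continuous_on {a..b} k"
      unfolding k_def
      by (intro continuous_intros continuous_on_compose2[OF p(2)]) (auto simp: s_nz)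
    have k1: "(k has_integral 1) {a..b}"
    proof -
      have "(k has_integral (P ((b - c) / s n) - P ((a - c) / s n))) {a..b}"
      proof (rule fundamental_theorem_of_calculus)
        fix x
        have "((\<lambda>x. (x - c) / s n) has_real_derivative 1 / s n) (at x)"
          by (auto intro!: derivative_eq_intros simp: s_nz)
        from DERIV_chain2[where f=P and g="\<lambda>x. (x - c) / s n", OF p(1) this]
        show "((\<lambda>x. P ((x - c) / s n)) has_vector_derivative k x) (at x within {a..b})"
          by (auto simp: k_def has_real_derivative_iff_has_vector_derivative[symmetric]
              intro: has_field_derivative_at_within)
      qed (use c in simp)
      moreover have "(b - c) / s n \<ge> 1" "(a - c) / s n \<le> 0"
        using s(1)[of n] s(3)[of n] c by (auto simp: field_simps)
      ultimately show ?thesis using p(5,6) by simp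
    qed
    have cAk: "continuous_on {a..b} (\<lambda>x. A x * k x)" by (intro continuous_intros A kc)
    have "(LINT x:{a..b}|lebesgue. A x * k x) = integral {a..b} (\<lambda>x. A x * k x)"
      by (intro set_lebesgue_integral_eq_integral absolutely_integrable_continuous_real cAk)
    also have "\<dots> = integral {a..b} (\<lambda>x. A c * k x) + integral {a..b} (\<lambda>x. (A x - A c) * k x)"
      by (subst integral_add[symmetric])
         (auto intro!: integrable_continuous_real continuous_intros A kc integral_cong simp: algebra_simps)
    also have "integral {a..b} (\<lambda>x. A c * k x) = A c" using k1 by (simp add: integral_unique)
    finally have "norm ((LINT x:{a..b}|lebesgue. A x * k x) - A c)
        = norm (integral {a..b} (\<lambda>x. (A x - A c) * k x))" by simp
    also have "\<dots> \<le> integral {a..b} (\<lambda>x. r / 2 * k x)"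
    proof (rule integral_norm_bound_integral)
      fix x assume x: "x \<in> {a..b}"
      show "norm ((A x - A c) * k x) \<le> r / 2 * k x"
      proof (cases "k x = 0")
        case False
        then have "(x - c) / s n \<in> {0..1}" using p(4) by (auto simp: k_def)
        then have "dist x c < d" using s(1)[of n] N[OF that] by (auto simp: field_simps dist_real_def)
        then have "\<bar>A x - A c\<bar> \<le> r / 2" using d(2)[OF x] by (simp add: dist_real_def)
        from mult_right_mono[OF this k0[of x]] show ?thesis using k0[of x] by (simp add: abs_mult)
      qed simp
    qed (auto intro!: integrable_continuous_real continuous_intros A kc)
    also have "\<dots> = r / 2" using k1 by (simp add: integral_unique)
    finally show ?thesis using \<open>0 < r\<close> by (simp add: k_def)
  qed
  then show "\<exists>no. \<forall>n\<ge>no. norm ((LINT x:{a..b}|lebesgue. A x * (p ((x - c) / s n) / s n)) - A c) < r"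
    by blast
qed

text \<open>The functions rise just to the right of a and fall just to the right of b. This explains
  the half-open limit \<open>{a<..b}\<close> and the difference of point values at a and b as limit
  of the derivatives. The transitions have width e / (n + 1), hence the common support.\<close>

lemma smooth_indicator_approximation:
  fixes a b :: real
  assumes "a < b" and "0 < e"
  obtains q q' where "\<And>n. smooth_on UNIV (q n)" "\<And>n x. (q n has_real_derivative q' n x) (at x)"
    "\<And>n. continuous_on UNIV (q' n)"
    "\<And>n x. x \<notin> {a..b + e} \<Longrightarrow> q n x = 0" "\<And>n x. x \<notin> {a..b + e} \<Longrightarrow> q' n x = 0"
    "\<And>n x. \<bar>q n x\<bar> \<le> 1"
    "\<And>x. (\<lambda>n::nat. q n x) \<longlonglongrightarrow> indicator {a<..b} x"
    "\<And>A. continuous_on {a..b + e} A \<Longrightarrow> (\<lambda>n. LINT x:{a..b + e}|lebesgue. A x * q' n x) \<longlonglongrightarrow> A a - A b"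
proof -
  obtain P p :: "real \<Rightarrow> real" where
    P: "smooth_on UNIV P" and p: "\<And>x. (P has_real_derivative p x) (at x)" "continuous_on UNIV p"
    "\<And>x. 0 \<le> p x" "\<And>x. x \<notin> {0..1} \<Longrightarrow> p x = 0" "\<And>x. x \<le> 0 \<Longrightarrow> P x = 0" "\<And>x. x \<ge> 1 \<Longrightarrow> P x = 1"
    and P01: "\<And>x. 0 \<le> P x" "\<And>x. P x \<le> 1"
    by (rule ex_smooth_step, rule that)
  define s where "s n = e / real (Suc n)" for n
  have s: "0 < s n" "s n \<le> e" for n
    using \<open>0 < e\<close> by (simp_all add: s_def divide_le_eq distrib_left)
  have s_nz: "s n \<noteq> 0" for n using s(1)[of n] by simp
  have s0: "s \<longlonglongrightarrow> 0" unfolding s_def using tendsto_mult_right_zero[OF LIMSEQ_inverse_real_of_nat] by (simp add: divide_inverse)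
  define q where "q n x = P ((x - a) / s n) - P ((x - b) / s n)" for n x
  define q' where "q' n x = p ((x - a) / s n) / s n - p ((x - b) / s n) / s n" for n x
  have low: "(x - c) / s n \<le> 0" if "x \<le> c" for x c n
    using that s(1)[of n] by (simp add: divide_le_0_iff)
  have high: "(x - c) / s n \<ge> 1" if "x \<ge> c + s n" for x c n
    using that s(1)[of n] by (simp add: le_divide_eq)
  show thesis
  proof (rule that[of q q'])
    show "smooth_on UNIV (q n)" for n
    proof (rule smooth_onI)
      fix k
      have l: "Ck_on k UNIV (\<lambda>x. (x - c) / s n)" for c
        unfolding divide_inverse
        by (rule Ck_on_mult, rule Ck_on_diff, rule Ck_on_linear, rule bounded_linear_ident, (rule Ck_on_const)+)
      have "Ck_on k UNIV (\<lambda>x. P ((x - c) / s n))" for c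
        by (rule Ck_on_compose_real[OF smooth_onD[OF P] l]) simp
      then show "Ck_on k UNIV (q n)" unfolding q_def by (intro Ck_on_diff)
    qed
    have d: "((\<lambda>x. P ((x - c) / s n)) has_real_derivative p ((x - c) / s n) / s n) (at x)" for c n x
    proof -
      have "((\<lambda>x. (x - c) / s n) has_real_derivative 1 / s n) (at x)"
        by (auto intro!: derivative_eq_intros simp: s_nz)
      from DERIV_chain2[where f=P and g="\<lambda>x. (x - c) / s n", OF p(1) this] show ?thesis by simp
    qed
    show "(q n has_real_derivative q' n x) (at x)" for n x
      unfolding q_def q'_def by (intro DERIV_diff d)
    show "continuous_on UNIV (q' n)" for n
      unfolding q'_def
      by (intro continuous_intros continuous_on_compose2[OF p(2)]) (auto simp: s_nz)
    show "q n x = 0" if "x \<notin> {a..b + e}" for n x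
    proof (cases "x < a")
      case True
      then show ?thesis using low[of x a] low[of x b] \<open>a < b\<close> p(5) by (simp add: q_def)
    next
      case False
      then have "x \<ge> a + s n" "x \<ge> b + s n" using that s(2)[of n] \<open>a < b\<close> by auto
      then show ?thesis using high p(6) by (simp add: q_def)
    qed
    show "q' n x = 0" if "x \<notin> {a..b + e}" for n x
    proof (cases "x < a")
      case True
      then have "(x - a) / s n < 0" "(x - b) / s n < 0"
        using s(1)[of n] \<open>a < b\<close> by (auto simp: divide_less_0_iff)
      then show ?thesis using p(4) by (simp add: q'_def)
    next
      case False
      then have "x > a + s n" "x > b + s n" using that s(2)[of n] \<open>a < b\<close> by auto
      then have "(x - a) / s n > 1" "(x - b) / s n > 1"
        using s(1)[of n] by (auto simp: less_divide_eq)
      then show ?thesis using p(4) by (simp add: q'_def)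
    qed
    show "\<bar>q n x\<bar> \<le> 1" for n x
      using P01[of "(x - a) / s n"] P01[of "(x - b) / s n"] by (simp add: q_def)
    have st: "(\<lambda>n. P ((x - c) / s n)) \<longlonglongrightarrow> (if x > c then 1 else 0)" for x c
    proof (cases "x > c")
      case True
      then have "eventually (\<lambda>n. s n < x - c) sequentially"
        using s0 by (intro order_tendstoD) auto
      then have "eventually (\<lambda>n. P ((x - c) / s n) = 1) sequentially"
        by eventually_elim (rule p(6)[OF high], simp)
      then show ?thesis using True by (simp add: tendsto_eventually)
    next
      case False
      then show ?thesis using p(5)[OF low] by simp
    qed
    show "(\<lambda>n. q n x) \<longlonglongrightarrow> indicator {a<..b} x" for x
      unfolding q_def using tendsto_diff[OF st[of x a] st[of x b]] \<open>a < b\<close>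
      by (cases "x > a"; cases "x > b") (auto simp: indicator_def)
    show "(\<lambda>n. LINT x:{a..b + e}|lebesgue. A x * q' n x) \<longlonglongrightarrow> A a - A b"
      if A: "continuous_on {a..b + e} A" for A
    proof -
      have c: "continuous_on {a..b+e} (\<lambda>x. A x * (p ((x - c) / s n) / s n))" for c n
        by (intro continuous_intros A continuous_on_compose2[OF p(2)]) (auto simp: s_nz)
      have "(LINT x:{a..b + e}|lebesgue. A x * q' n x) =
         (LINT x:{a..b + e}|lebesgue. A x * (p ((x - a) / s n) / s n))
         - (LINT x:{a..b + e}|lebesgue. A x * (p ((x - b) / s n) / s n))" for n
        by (subst set_integral_diff(2)[symmetric])
           (use c in \<open>auto intro!: absolutely_integrable_continuous_real simp: q'_def right_diff_distrib\<close>)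
      moreover have "(\<lambda>n. (LINT x:{a..b + e}|lebesgue. A x * (p ((x - a) / s n) / s n))
         - (LINT x:{a..b + e}|lebesgue. A x * (p ((x - b) / s n) / s n))) \<longlonglongrightarrow> A a - A b"
        using \<open>a < b\<close> \<open>0 < e\<close> s s0 order_trans[OF add_left_mono[OF s(2)]]
        by (intro tendsto_diff mollified_tendsto[OF p A]) auto
      ultimately show ?thesis by simp
    qed
  qed
qed

lemma set_lebesgue_integral_halfopen:
  fixes f :: "real \<Rightarrow> real"
  shows "(LINT x:{a<..b}|lebesgue. f x) = (LINT x:{a..b}|lebesgue. f x)"
  unfolding set_lebesgue_integral_def
proof (rule integral_lebesgue_cong_AE)
  have "AE x in lebesgue. x \<noteq> a" by (intro AE_completion AE_lborel_singleton)
  then show "AE x in lebesgue. indicat_real {a<..b} x *\<^sub>R f x = indicat_real {a..b} x *\<^sub>R f x"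
    by eventually_elim (auto simp: indicator_def)
qed

text \<open>Smooth approximations of the indicator of ]a, b] are inserted as test functions. The
  left side tends to A(a) - A(b), the right side by dominated convergence to minus the integral of
  U.\<close>

lemma weak_derivative_imp_integral:
  fixes A U :: "real \<Rightarrow> real"
  assumes I: "open I" "{a..b} \<subseteq> I" and ab: "a \<le> b"
    and A: "continuous_on I A"
    and U: "\<And>c d. {c..d} \<subseteq> I \<Longrightarrow> set_integrable lebesgue {c..d} U"
    and weak: "\<And>q q' c d. smooth_on UNIV q \<Longrightarrow> (\<And>x. (q has_real_derivative q' x) (at x)) \<Longrightarrow>
      continuous_on UNIV q' \<Longrightarrow> {c..d} \<subseteq> I \<Longrightarrow> c \<le> d \<Longrightarrow>
      (\<And>x. x \<notin> {c..d} \<Longrightarrow> q x = 0) \<Longrightarrow> (\<And>x. x \<notin> {c..d} \<Longrightarrow> q' x = 0) \<Longrightarrow>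
      (LINT x:{c..d}|lebesgue. A x * q' x) = - (LINT x:{c..d}|lebesgue. U x * q x)"
  shows "A b - A a = (LINT x:{a..b}|lebesgue. U x)"
proof (cases "a = b")
  case True
  then show ?thesis using set_lebesgue_integral_halfopen[of b b U] by (simp add: set_lebesgue_integral_def)
next
  case False
  then have "a < b" using ab by simp
  have "b \<in> I" using I(2) ab by auto
  \<comment> \<open>Openness of \<open>I\<close> leaves room to the right of b for the falling
    transition.\<close>
  then obtain e where e: "e > 0" "cball b e \<subseteq> I" using I(1) open_contains_cball by blast
  have sub: "{a..b + e} \<subseteq> I"
  proof
    fix x assume "x \<in> {a..b+e}"
    then show "x \<in> I" using e I(2) by (cases "x \<le> b") (auto simp: subset_iff dist_real_def)
  qed
  obtain q q' where q: "\<And>n. smooth_on UNIV (q n)" "\<And>n x. (q n has_real_derivative q' n x) (at x)"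
    "\<And>n. continuous_on UNIV (q' n)"
    "\<And>n x. x \<notin> {a..b + e} \<Longrightarrow> q n x = 0" "\<And>n x. x \<notin> {a..b + e} \<Longrightarrow> q' n x = 0"
    "\<And>n x. \<bar>q n x\<bar> \<le> 1"
    "\<And>x. (\<lambda>n::nat. q n x) \<longlonglongrightarrow> indicator {a<..b} x"
    "\<And>A. continuous_on {a..b + e} A \<Longrightarrow> (\<lambda>n. LINT x:{a..b + e}|lebesgue. A x * q' n x) \<longlonglongrightarrow> A a - A b"
    using smooth_indicator_approximation[OF \<open>a < b\<close> e(1)] by blast
  have l: "(\<lambda>n. LINT x:{a..b + e}|lebesgue. A x * q' n x) \<longlonglongrightarrow> A a - A b"
    using q(8) continuous_on_subset[OF A sub] by blast
  have Ui: "set_integrable lebesgue {a..b+e} U" using U[OF sub] .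
  have r: "(\<lambda>n. LINT x:{a..b + e}|lebesgue. U x * q n x) \<longlonglongrightarrow> (LINT x:{a..b+e}|lebesgue. U x * indicator {a<..b} x)"
    unfolding set_lebesgue_integral_def
  proof (rule integral_dominated_convergence)
    have qm: "q n \<in> borel_measurable lebesgue" for n
    proof -
      have "continuous_on UNIV (q n)" by (intro continuous_at_imp_continuous_on ballI DERIV_isCont[OF q(2)])
      then show ?thesis by (intro measurable_completion) (simp add: borel_measurable_continuous_onI)
    qed
    have *: "(\<lambda>x. indicat_real {a..b + e} x *\<^sub>R (U x * q n x)) = (\<lambda>x. (indicat_real {a..b + e} x *\<^sub>R U x) * q n x)" for n
      by auto
    have Um: "(\<lambda>x. indicat_real {a..b + e} x *\<^sub>R U x) \<in> borel_measurable lebesgue"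
      using Ui by (simp add: set_integrable_def)
    show "(\<lambda>x. indicat_real {a..b + e} x *\<^sub>R (U x * q n x)) \<in> borel_measurable lebesgue" for n
      unfolding * by (intro borel_measurable_times Um qm)
    have "(\<lambda>x. indicat_real {a..b + e} x *\<^sub>R (U x * indicator {a<..b} x)) =
        (\<lambda>x. (indicat_real {a..b + e} x *\<^sub>R U x) * indicator {a<..b} x)" by auto
    then show "(\<lambda>x. indicat_real {a..b + e} x *\<^sub>R (U x * indicator {a<..b} x)) \<in> borel_measurable lebesgue"
      by (simp only:) (intro borel_measurable_times Um borel_measurable_indicator, simp)
    show "integrable lebesgue (\<lambda>x. norm (indicat_real {a..b + e} x *\<^sub>R U x))"
      using Ui by (intro integrable_norm) (simp add: set_integrable_def)
    show "AE x in lebesgue. (\<lambda>n. indicat_real {a..b + e} x *\<^sub>R (U x * q n x)) \<longlonglongrightarrow>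
        indicat_real {a..b + e} x *\<^sub>R (U x * indicator {a<..b} x)"
      by (intro AE_I2 tendsto_intros q(7))
    show "AE x in lebesgue. norm (indicat_real {a..b + e} x *\<^sub>R (U x * q n x)) \<le> norm (indicat_real {a..b + e} x *\<^sub>R U x)" for n
      using q(6)[of n] by (intro AE_I2) (auto simp: abs_mult indicator_def intro: mult_left_le)
  qed
  have "(LINT x:{a..b+e}|lebesgue. U x * indicator {a<..b} x) = (LINT x:{a<..b}|lebesgue. U x)"
    unfolding set_lebesgue_integral_def using e(1)
    by (intro Bochner_Integration.integral_cong) (auto simp: indicator_def)
  moreover have "(LINT x:{a..b + e}|lebesgue. A x * q' n x) = - (LINT x:{a..b + e}|lebesgue. U x * q n x)" for n
    using sub ab e(1) by (intro weak[OF q(1-3)] q(4,5)) auto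
  ultimately have "A a - A b = - (LINT x:{a<..b}|lebesgue. U x)"
    using LIMSEQ_unique[OF l] tendsto_minus[OF r] by simp
  then show ?thesis by (simp add: set_lebesgue_integral_halfopen)
qed

text \<open>Abstracts x -> \<gamma>(x,t) at one fixed positive time, with \<open>e\<close> in the
  role of \<eta>(.,t). Only the integral relation is recorded, so that substitution rests on image
  measures and not on pointwise derivatives of \<open>T\<close>.\<close>

locale increasing_primitive =
  fixes T e :: "real \<Rightarrow> real"
  assumes strict: "strict_mono T" and surj: "surj T"
    and e_borel [measurable]: "e \<in> borel_measurable borel" and e_nonneg: "\<And>y. 0 \<le> e y"
    and e_int: "\<And>a b. a \<le> b \<Longrightarrow> set_integrable lborel {a..b} e"
    and primitive: "\<And>a b. a \<le> b \<Longrightarrow> T b - T a = (LINT y:{a..b}|lborel. e y)"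
begin

lemma inv_T [simp]: "inv T (T y) = y" and T_inv [simp]: "T (inv T x) = x"
  by (rule inv_f_f[OF strict_mono_imp_inj_on[OF strict]], rule surj_f_inv_f[OF surj])

lemma inv_strict_mono: "strict_mono (inv T)"
proof (rule strict_monoI)
  fix x y :: real assume "x < y"
  then show "inv T x < inv T y"
    using strict_mono_less[OF strict, of "inv T x" "inv T y"] by simp
qed

lemma T_borel [measurable]: "T \<in> borel_measurable borel"
  by (intro borel_measurable_mono strict_mono_mono strict)

lemma inv_T_borel [measurable]: "inv T \<in> borel_measurable borel"
  by (intro borel_measurable_mono strict_mono_mono inv_strict_mono)

text \<open>Both measures agree on open intervals: the preimage of ]l, u[ is ]a, b[ with T(a) = l
  and T(b) = u, and its mass is T(b) - T(a). The substitution rules below are readings of this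
  identity.\<close>

lemma distr_density: "distr (density lborel (\<lambda>y. ennreal (e y))) borel T = lborel"
proof (rule lborel_eqI[symmetric])
  fix l u :: real assume "\<And>b. b \<in> Basis \<Longrightarrow> l \<bullet> b \<le> u \<bullet> b"
  then have "l \<le> u" by simp
  define a b where "a = inv T l" and "b = inv T u"
  have "a \<le> b" using \<open>l \<le> u\<close> inv_strict_mono by (simp add: a_def b_def strict_mono_less_eq)
  have "T -` box l u = box a b"
    using strict_mono_less[OF strict, of a] strict_mono_less[OF strict, of _ b]
    by (auto simp: a_def b_def box_real)
  then have "emeasure (distr (density lborel (\<lambda>y. ennreal (e y))) borel T) (box l u)
      = (\<integral>\<^sup>+y. ennreal (e y) * indicator (box a b) y \<partial>lborel)"
    by (simp add: emeasure_distr emeasure_density)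
  also have "\<dots> = (\<integral>\<^sup>+y. ennreal (indicator {a..b} y *\<^sub>R e y) \<partial>lborel)"
    using AE_lborel_singleton[of a] AE_lborel_singleton[of b]
    by (intro nn_integral_cong_AE) (auto simp: box_real indicator_def elim!: eventually_elim2)
  also have "\<dots> = ennreal (LINT y:{a..b}|lborel. e y)"
    using e_int[OF \<open>a \<le> b\<close>] e_nonneg unfolding set_lebesgue_integral_def set_integrable_def
    by (intro nn_integral_eq_integral) auto
  also have "\<dots> = ennreal (u - l)" using primitive[OF \<open>a \<le> b\<close>] by (simp add: a_def b_def)
  finally show "emeasure (distr (density lborel (\<lambda>y. ennreal (e y))) borel T) (box l u) = (\<Prod>b\<in>Basis. (u - l) \<bullet> b)"
    by simp
qed simp

lemma integral_substitution:
  fixes H :: "real \<Rightarrow> real"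
  assumes [measurable]: "H \<in> borel_measurable borel"
  shows "(LINT x|lborel. H x) = (LINT y|lborel. e y * H (T y))"
  by (subst distr_density[symmetric]) (simp add: integral_distr integral_density e_nonneg)

lemma integrable_substitution:
  fixes H :: "real \<Rightarrow> real"
  assumes [measurable]: "H \<in> borel_measurable borel"
  shows "integrable lborel H \<longleftrightarrow> integrable lborel (\<lambda>y. e y * H (T y))"
  by (subst distr_density[symmetric]) (simp add: integrable_distr_eq integrable_density e_nonneg)

text \<open>\<open>T\<close> maps null sets to null sets: the image of N has as measure the integral
  of \<open>e\<close> over N.\<close>

lemma AE_inv:
  assumes "AE y in lborel. Q y"
  shows "AE x in lborel. Q (inv T x)"
proof -
  obtain N where N: "N \<in> null_sets lborel" "{y. \<not> Q y} \<subseteq> N" using assms by (auto simp: eventually_ae_filter)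
  then have [measurable]: "N \<in> sets borel" by auto
  have "AE y in lborel. y \<notin> N" using N by (auto intro: AE_not_in)
  then have "AE y in density lborel (\<lambda>y. ennreal (e y)). inv T (T y) \<notin> N"
    by (simp add: AE_density) (auto elim: eventually_mono)
  then have "AE x in distr (density lborel (\<lambda>y. ennreal (e y))) borel T. inv T x \<notin> N"
    by (subst AE_distr_iff) auto
  then have "AE x in lborel. inv T x \<notin> N" by (simp only: distr_density)
  then show ?thesis by eventually_elim (use N(2) in blast)
qed

end

section \<open>Integration over the half-plane\<close>

text \<open>Fubini for the indicator of the exceptional set. Cutting with balls makes the indicator
  integrable, and countably many balls exhaust the plane.\<close>

lemma AE_lebesgue_sections:
  fixes P :: "real \<times> real \<Rightarrow> bool"
  assumes meas: "{z. \<not> P z} \<in> sets lebesgue"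
    and ae: "AE t in lebesgue. AE x in lebesgue. P (x, t)"
  shows "AE z in lebesgue. P z"
proof -
  define N where "N n = {z. \<not> P z} \<inter> cball 0 (real n)" for n
  have "N n \<in> null_sets lebesgue" for n
  proof -
    have fm: "N n \<in> lmeasurable"
      unfolding N_def using meas by (intro bounded_set_imp_lmeasurable) (auto intro: bounded_Int)
    then have int: "integrable lebesgue (indicat_real (N n))" by (simp add: lmeasurable_iff_integrable)
    have "measure lebesgue (N n) = (LINT z|lebesgue. indicat_real (N n) z)"
      by simp
    also have "\<dots> = (LINT t|lebesgue. LINT x|lebesgue. indicat_real (N n) (x, t))"
      by (rule lebesgue_Fubini(1)[OF int])
    also have "\<dots> = (LINT t|(lebesgue :: real measure). 0)"
    proof (rule integral_lebesgue_cong_AE)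
      show "AE t in lebesgue. (LINT x|lebesgue. indicat_real (N n) (x, t)) = 0"
        using ae
      proof eventually_elim
        fix t assume "AE x in lebesgue. P (x, t)"
        then have "AE x in lebesgue. indicat_real (N n) (x, t) = 0"
          by eventually_elim (auto simp: N_def)
        then show "(LINT x|lebesgue. indicat_real (N n) (x, t)) = 0"
          using integral_lebesgue_cong_AE[of "\<lambda>x. indicat_real (N n) (x, t)" "\<lambda>x. 0"] by simp
      qed
    qed
    finally show ?thesis using fm by (auto simp: null_sets_def emeasure_eq_measure2 fmeasurableD)
  qed
  then have "(\<Union>n. N n) \<in> null_sets lebesgue" by (intro null_sets_UN') auto
  moreover have "(\<Union>n. N n) = {z. \<not> P z}"
    unfolding N_def by (auto simp: real_arch_simple)
  ultimately show ?thesis by (simp add: completion.AE_iff_null_sets)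
qed

abbreviation half_plane :: "(real \<times> real) set" where
  "half_plane \<equiv> UNIV \<times> {0<..}"

abbreviation half_plane_measurable :: "(real \<Rightarrow> real \<Rightarrow> real) \<Rightarrow> bool" where
  "half_plane_measurable F \<equiv> (\<lambda>(x, t). F x t) \<in> borel_measurable (lebesgue_on (UNIV \<times> {0..}))"

text \<open>The solution is measurable on the closed half-plane, whereas the integrals run over the
  open one.\<close>

lemma half_plane_measurable_indicator:
  assumes "half_plane_measurable F"
  shows "(\<lambda>z. indicat_real half_plane z *\<^sub>R (\<lambda>(x, t). F x t) z) \<in> borel_measurable lebesgue"
proof -
  have cl: "UNIV \<times> {0..} \<in> sets (lebesgue :: (real \<times> real) measure)"
    by (simp add: closed_Times) 
  have op: "half_plane \<in> sets lebesgue" by (simp add: open_Times)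
  have "(\<lambda>z. if z \<in> UNIV \<times> {0..} then (\<lambda>(x, t). F x t) z else 0) \<in> borel_measurable lebesgue"
    by (rule borel_measurable_if_I[OF assms cl])
  then have "(\<lambda>z. indicat_real half_plane z *\<^sub>R (if z \<in> UNIV \<times> {0..} then (\<lambda>(x, t). F x t) z else 0))
      \<in> borel_measurable lebesgue"
    using op by (intro borel_measurable_scaleR borel_measurable_indicator)
  moreover have "(\<lambda>z. indicat_real half_plane z *\<^sub>R (if z \<in> UNIV \<times> {0..} then (\<lambda>(x, t). F x t) z else 0))
     = (\<lambda>z. indicat_real half_plane z *\<^sub>R (\<lambda>(x, t). F x t) z)"
    by (auto simp: indicator_def)
  ultimately show ?thesis by simp
qed

text \<open>Both orders are kept: the substitution wants the inner integral in x, the argument for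
  the component v wants it in t.\<close>

lemma half_plane_Fubini:
  assumes meas: "half_plane_measurable F"
    and bnd: "\<And>x t. x \<in> {c..d} \<Longrightarrow> t \<in> {p..q} \<Longrightarrow> \<bar>F x t\<bar> \<le> B"
    and supp: "\<And>x t. 0 < t \<Longrightarrow> \<not> (x \<in> {c..d} \<and> t \<in> {p..q}) \<Longrightarrow> F x t = 0" and p: "0 < p"
  shows "set_integrable lebesgue half_plane (\<lambda>(x, t). F x t)"
    and "(LINT (x, t):half_plane|lebesgue. F x t) = (LINT t:{p..q}|lebesgue. LINT x:{c..d}|lebesgue. F x t)"
    and "(LINT (x, t):half_plane|lebesgue. F x t) = (LINT x:{c..d}|lebesgue. LINT t:{p..q}|lebesgue. F x t)"
proof -
  define F' where "F' z = indicat_real half_plane z *\<^sub>R (\<lambda>(x, t). F x t) z" for z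
  have m: "F' \<in> borel_measurable lebesgue"
    unfolding F'_def by (rule half_plane_measurable_indicator[OF meas])
  have eq: "F' (x, t) = indicat_real {p..q} t *\<^sub>R (indicat_real {c..d} x *\<^sub>R F x t)" for x t
    using supp[of t x] p by (auto simp: F'_def indicator_def)
  have int: "integrable lebesgue F'"
  proof (rule Bochner_Integration.integrable_bound)
    have "({c..d} \<times> {p..q}) \<in> lmeasurable" using lmeasurable_cbox[of "(c, p)" "(d, q)"] by (simp add: cbox_Pair_eq)
    then show "integrable lebesgue (\<lambda>z. \<bar>B\<bar> * indicat_real ({c..d} \<times> {p..q}) z)"
      by (intro integrable_mult_right) (simp add: lmeasurable_iff_integrable)
    show "AE z in lebesgue. norm (F' z) \<le> norm (\<bar>B\<bar> * indicat_real ({c..d} \<times> {p..q}) z)"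
    proof (rule AE_I2)
      fix z :: "real \<times> real"
      obtain x t where z: "z = (x, t)" by force
      show "norm (F' z) \<le> norm (\<bar>B\<bar> * indicat_real ({c..d} \<times> {p..q}) z)"
        unfolding z eq using bnd[of x t] by (force simp: indicator_def)
    qed
  qed fact
  then show "set_integrable lebesgue half_plane (\<lambda>(x, t). F x t)"
    by (simp only: set_integrable_def F'_def[symmetric])
  have "(LINT (x, t):half_plane|lebesgue. F x t) = (LINT z|lebesgue. F' z)"
    by (simp only: set_lebesgue_integral_def F'_def[symmetric])
  moreover have "(LINT x|lebesgue. F' (x, t)) = indicat_real {p..q} t *\<^sub>R (LINT x:{c..d}|lebesgue. F x t)" for t
    by (simp add: eq set_lebesgue_integral_def)
  moreover have "(LINT t|lebesgue. F' (x, t)) = indicat_real {c..d} x *\<^sub>R (LINT t:{p..q}|lebesgue. F x t)" for x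
    by (simp add: eq set_lebesgue_integral_def mult.left_commute)
  ultimately show "(LINT (x, t):half_plane|lebesgue. F x t) = (LINT t:{p..q}|lebesgue. LINT x:{c..d}|lebesgue. F x t)"
    "(LINT (x, t):half_plane|lebesgue. F x t) = (LINT x:{c..d}|lebesgue. LINT t:{p..q}|lebesgue. F x t)"
    using lebesgue_Fubini[OF int] unfolding set_lebesgue_integral_def by simp_all
qed

text \<open>Convergence is assumed almost everywhere on each time slice, as the space averages
  deliver it. The set of convergence is measurable, so the slices combine to almost every point of
  the half-plane.\<close>

lemma half_plane_dominated_convergence:
  assumes meas: "\<And>n. half_plane_measurable (F n)" "half_plane_measurable F'"
    and bnd: "\<And>n x t. x \<in> {c..d} \<Longrightarrow> t \<in> {p..q} \<Longrightarrow> \<bar>F n x t\<bar> \<le> B"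
    and supp: "\<And>n x t. 0 < t \<Longrightarrow> \<not> (x \<in> {c..d} \<and> t \<in> {p..q}) \<Longrightarrow> F n x t = 0" and p: "0 < p"
    and lim: "\<And>t. 0 < t \<Longrightarrow> AE x in lebesgue. (\<lambda>n. F n x t) \<longlonglongrightarrow> F' x t"
  shows "(\<lambda>n. LINT (x, t):half_plane|lebesgue. F n x t) \<longlonglongrightarrow> (LINT (x, t):half_plane|lebesgue. F' x t)"
  unfolding set_lebesgue_integral_def
proof (rule integral_dominated_convergence)
  let ?F = "\<lambda>n z. indicat_real half_plane z *\<^sub>R (\<lambda>(x, t). F n x t) z"
  let ?F' = "\<lambda>z. indicat_real half_plane z *\<^sub>R (\<lambda>(x, t). F' x t) z"
  show m': "?F' \<in> borel_measurable lebesgue" by (rule half_plane_measurable_indicator[OF meas(2)])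
  show m: "?F n \<in> borel_measurable lebesgue" for n by (rule half_plane_measurable_indicator[OF meas(1)])
  have "({c..d} \<times> {p..q}) \<in> lmeasurable" using lmeasurable_cbox[of "(c, p)" "(d, q)"] by (simp add: cbox_Pair_eq)
  then show "integrable lebesgue (\<lambda>z. \<bar>B\<bar> * indicat_real ({c..d} \<times> {p..q}) z)"
    by (intro integrable_mult_right) (simp add: lmeasurable_iff_integrable)
  show "AE z in lebesgue. norm (?F n z) \<le> \<bar>B\<bar> * indicat_real ({c..d} \<times> {p..q}) z" for n
  proof (rule AE_I2)
    fix z :: "real \<times> real"
    obtain x t where z: "z = (x, t)" by force
    show "norm (?F n z) \<le> \<bar>B\<bar> * indicat_real ({c..d} \<times> {p..q}) z"
      unfolding z using bnd[of x t n] supp[of t x n] by (force simp: indicator_def)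
  qed
  show "AE z in lebesgue. (\<lambda>n. ?F n z) \<longlonglongrightarrow> ?F' z"
  proof (rule AE_lebesgue_sections)
    have "Measurable.pred lebesgue (\<lambda>z. \<not> (\<lambda>n. ?F n z) \<longlonglongrightarrow> ?F' z)"
      by (intro pred_intros_logic measurable_limit2 m m')
    then show "{z. \<not> (\<lambda>n. ?F n z) \<longlonglongrightarrow> ?F' z} \<in> sets lebesgue" by (simp add: pred_def)
    have "AE x in lebesgue. (\<lambda>n. ?F n (x, t)) \<longlonglongrightarrow> ?F' (x, t)" for t
    proof (cases "0 < t")
      case True
      from lim[OF True] show ?thesis by eventually_elim (simp add: True)
    qed simp
    then show "AE t in lebesgue. AE x in lebesgue. (\<lambda>n. ?F n (x, t)) \<longlonglongrightarrow> ?F' (x, t)"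
      by (rule AE_I2)
  qed
qed

text \<open>The averages are right-hand difference quotients of the indefinite integral, whose
  derivative from the right at a continuity point x is f(x).\<close>

lemma average_tendsto:
  fixes f :: "real \<Rightarrow> real"
  assumes int: "set_integrable lebesgue {x..x + 1} f" and cont: "isCont f x"
    and h: "\<And>n. 0 < h n" "h \<longlonglongrightarrow> 0"
  shows "(\<lambda>n. (LINT y:{x..x + h n}|lebesgue. f y) / h n) \<longlonglongrightarrow> f x"
proof -
  define F where "F s = integral {x..s} f" for s
  have "(F has_vector_derivative f x) (at x within {x..x + 1})"
    unfolding F_def
    using integral_has_vector_derivative_continuous_at[OF set_lebesgue_integral_eq_integral(1)[OF int],
        of x "{}"] continuous_at_imp_continuous_at_within[OF cont] by simp
  then have "((\<lambda>y. (F y - F x) / (y - x)) \<longlongrightarrow> f x) (at x within {x..x + 1})"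
    by (simp add: has_real_derivative_iff_has_vector_derivative[symmetric] has_field_derivative_iff)
  moreover have ev: "eventually (\<lambda>n. h n < 1) sequentially" using h(2) by (rule order_tendstoD) simp
  have "filterlim (\<lambda>n. x + h n) (at x within {x..x + 1}) sequentially"
    unfolding filterlim_at
  proof
    show "(\<lambda>n. x + h n) \<longlonglongrightarrow> x" using tendsto_add[OF tendsto_const h(2)] by simp
    show "\<forall>\<^sub>F n in sequentially. x + h n \<in> {x..x + 1} \<and> x + h n \<noteq> x"
      using ev by eventually_elim (use h(1) in \<open>auto simp: less_imp_le less_imp_neq[symmetric]\<close>)
  qed
  ultimately have "(\<lambda>n. (F (x + h n) - F x) / (x + h n - x)) \<longlonglongrightarrow> f x" by (rule filterlim_compose)
  moreover have "eventually (\<lambda>n. (F (x + h n) - F x) / (x + h n - x) = (LINT y:{x..x + h n}|lebesgue. f y) / h n) sequentially"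
    using ev
  proof eventually_elim
    fix n assume "h n < 1"
    then have "set_integrable lebesgue {x..x + h n} f"
      by (intro set_integrable_subset[OF int]) auto
    then show "(F (x + h n) - F x) / (x + h n - x) = (LINT y:{x..x + h n}|lebesgue. f y) / h n"
      by (simp add: F_def set_lebesgue_integral_eq_integral(2))
  qed
  ultimately show ?thesis by (rule Lim_transform_eventually)
qed

lemma continuous_zero_integrals_imp_zero:
  fixes k :: "real \<Rightarrow> real"
  assumes k: "continuous_on {0<..} k" and t: "0 < t"
    and zero: "\<And>a b. 0 < a \<Longrightarrow> a \<le> b \<Longrightarrow> (LINT s:{a..b}|lebesgue. k s) = 0"
  shows "k t = 0"
proof -
  have "set_integrable lebesgue {t..t + 1} k"
    using t by (intro absolutely_integrable_continuous_real continuous_on_subset[OF k]) auto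
  moreover have "isCont k t"
    using t k by (simp add: continuous_on_eq_continuous_at)
  ultimately have "(\<lambda>n. (LINT y:{t..t + inverse (real (Suc n))}|lebesgue. k y) / inverse (real (Suc n))) \<longlonglongrightarrow> k t"
    by (rule average_tendsto) (auto intro!: LIMSEQ_inverse_real_of_nat simp del: of_nat_Suc)
  then show ?thesis using zero t by (simp add: LIMSEQ_const_iff)
qed

lemma set_integrable_mult_continuous:
  fixes f p :: "real \<Rightarrow> real"
  assumes f: "set_integrable lebesgue {c..d} f" and p: "continuous_on UNIV p"
  shows "set_integrable lebesgue {c..d} (\<lambda>x. f x * p x)"
proof -
  have "bounded (p ` {c..d})"
    by (intro compact_imp_bounded compact_continuous_image continuous_on_subset[OF p]) auto
  then obtain B where B: "B > 0" "\<And>x. x \<in> {c..d} \<Longrightarrow> \<bar>p x\<bar> \<le> B" by (auto simp: bounded_pos)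
  have pm: "p \<in> borel_measurable lebesgue"
    using p by (intro measurable_completion) (simp add: borel_measurable_continuous_onI)
  show ?thesis
  proof (rule set_integrable_bound[where f="\<lambda>x. f x * B"])
    show "set_integrable lebesgue {c..d} (\<lambda>x. f x * B)" using f by (intro set_integrable_mult_left)
    show "set_borel_measurable lebesgue {c..d} (\<lambda>x. f x * p x)"
      using f pm unfolding set_borel_measurable_def set_integrable_def
      by (simp add: mult.assoc[symmetric])
    show "AE x in lebesgue. x \<in> {c..d} \<longrightarrow> norm (f x * p x) \<le> norm (f x * B)"
      using B by (intro AE_I2) (auto simp: abs_mult intro!: mult_left_mono)
  qed
qed

text \<open>Pairing with \<open>p\<close> is Lipschitz in the L1 norm, as \<open>p\<close> is
  bounded on the interval. This supplies the continuity in time by which integrated identities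
  become valid at every time.\<close>

lemma L1loc_integral_continuous:
  fixes w :: "real \<Rightarrow> real \<Rightarrow> real"
  assumes w: "L1loc_continuous_on T w" and p: "continuous_on UNIV p"
  shows "continuous_on T (\<lambda>t. LINT x:{c..d}|lebesgue. w x t * p x)"
proof -
  have "bounded (p ` {c..d})"
    by (intro compact_imp_bounded compact_continuous_image continuous_on_subset[OF p]) auto
  then obtain B where B: "B > 0" "\<And>x. x \<in> {c..d} \<Longrightarrow> \<bar>p x\<bar> \<le> B" by (auto simp: bounded_pos)
  have int: "set_integrable lebesgue {c..d} (\<lambda>x. w x t)" if "t \<in> T" for t
    using w that by (auto simp: L1loc_continuous_on_def)
  note intp = set_integrable_mult_continuous[OF _ p]
  show ?thesis
    unfolding continuous_on_def
  proof
    fix s assume s: "s \<in> T"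
    have "((\<lambda>t. (LINT x:{c..d}|lebesgue. norm (w x t - w x s)) * B) \<longlongrightarrow> 0 * B) (at s within T)"
      using w s by (intro tendsto_mult tendsto_const) (auto simp: L1loc_continuous_on_def)
    then have "((\<lambda>t. (LINT x:{c..d}|lebesgue. \<bar>w x t - w x s\<bar>) * B) \<longlongrightarrow> 0) (at s within T)" by simp
    then have "((\<lambda>t. (LINT x:{c..d}|lebesgue. w x t * p x) - (LINT x:{c..d}|lebesgue. w x s * p x)) \<longlongrightarrow> 0) (at s within T)"
    proof (rule Lim_null_comparison[rotated])
      have "\<bar>(LINT x:{c..d}|lebesgue. w x t * p x) - (LINT x:{c..d}|lebesgue. w x s * p x)\<bar>
         \<le> (LINT x:{c..d}|lebesgue. \<bar>w x t - w x s\<bar>) * B" if t: "t \<in> T" for t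
      proof -
        have d: "set_integrable lebesgue {c..d} (\<lambda>x. w x t - w x s)" using int s t by (intro set_integral_diff) auto
        have "(LINT x:{c..d}|lebesgue. w x t * p x) - (LINT x:{c..d}|lebesgue. w x s * p x)
            = (LINT x:{c..d}|lebesgue. (w x t - w x s) * p x)"
          using intp[OF int[OF t]] intp[OF int[OF s]] by (simp add: left_diff_distrib set_integral_diff)
        also have "\<bar>\<dots>\<bar> \<le> (LINT x:{c..d}|lebesgue. \<bar>(w x t - w x s) * p x\<bar>)"
          using set_integral_norm_bound[OF intp[OF d]] by simp
        also have "\<dots> \<le> (LINT x:{c..d}|lebesgue. \<bar>w x t - w x s\<bar> * B)"
          using set_integrable_norm[OF intp[OF d]] set_integrable_norm[OF d] B
          by (intro set_integral_mono set_integrable_mult_left) (auto simp: abs_mult intro!: mult_left_mono)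
        finally show ?thesis by simp
      qed
      then show "\<forall>\<^sub>F t in at s within T. norm ((LINT x:{c..d}|lebesgue. w x t * p x) - (LINT x:{c..d}|lebesgue. w x s * p x))
         \<le> (LINT x:{c..d}|lebesgue. \<bar>w x t - w x s\<bar>) * B"
        by (auto simp: eventually_at_filter)
    qed
    then show "((\<lambda>t. LINT x:{c..d}|lebesgue. w x t * p x) \<longlongrightarrow> (LINT x:{c..d}|lebesgue. w x s * p x)) (at s within T)"
      by (rule LIM_zero_cancel)
  qed
qed

section \<open>Measurability rules on the half-plane, and weak derivatives at every time\<close>

lemma half_plane_measurable_add:
  "half_plane_measurable F \<Longrightarrow> half_plane_measurable G \<Longrightarrow> half_plane_measurable (\<lambda>x t. F x t + G x t)"
  and half_plane_measurable_diff:
  "half_plane_measurable F \<Longrightarrow> half_plane_measurable G \<Longrightarrow> half_plane_measurable (\<lambda>x t. F x t - G x t)"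
  and half_plane_measurable_mult:
  "half_plane_measurable F \<Longrightarrow> half_plane_measurable G \<Longrightarrow> half_plane_measurable (\<lambda>x t. F x t * G x t)"
  and half_plane_measurable_divide:
  "half_plane_measurable F \<Longrightarrow> half_plane_measurable G \<Longrightarrow> half_plane_measurable (\<lambda>x t. F x t / G x t)"
  unfolding case_prod_unfold
  by (rule borel_measurable_add, assumption, assumption, rule borel_measurable_diff, assumption, assumption,
      rule borel_measurable_times, assumption, assumption, rule borel_measurable_divide, assumption, assumption)

lemma half_plane_measurable_compose:
  "half_plane_measurable F \<Longrightarrow> f \<in> borel_measurable borel \<Longrightarrow> half_plane_measurable (\<lambda>x t. f (F x t))"
  unfolding case_prod_unfold by (rule measurable_compose)

lemma half_plane_in_lebesgue:
  "UNIV \<times> {0::real..} \<in> sets (lebesgue :: (real \<times> real) measure)"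
  "half_plane \<in> sets lebesgue"
  by (simp_all add: closed_Times open_Times)

lemma half_plane_measurable_continuous:
  "continuous_on (UNIV \<times> {0..}) (\<lambda>(x, t). F x t) \<Longrightarrow> half_plane_measurable F"
  by (intro continuous_imp_measurable_on_sets_lebesgue half_plane_in_lebesgue)

lemma half_plane_measurable_fst:
  "p \<in> borel_measurable borel \<Longrightarrow> half_plane_measurable (\<lambda>x t. p x)"
  and half_plane_measurable_snd:
  "p \<in> borel_measurable borel \<Longrightarrow> half_plane_measurable (\<lambda>x t. p t)"
  using half_plane_measurable_compose[OF half_plane_measurable_continuous[of "\<lambda>x t. x"], of p]
    half_plane_measurable_compose[OF half_plane_measurable_continuous[of "\<lambda>x t. t"], of p]
  by (auto simp: case_prod_unfold continuous_on_fst[OF continuous_on_id] continuous_on_snd[OF continuous_on_id])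

lemmas half_plane_measurable_intros = half_plane_measurable_add half_plane_measurable_diff
  half_plane_measurable_mult half_plane_measurable_divide half_plane_measurable_fst half_plane_measurable_snd

lemma deriv_product_test:
  assumes "\<And>x. (p has_real_derivative p' x) (at x)"
  shows "deriv (\<lambda>s. c * p s) t = c * p' t" "deriv (\<lambda>s. p s * c) t = p' t * c"
  using DERIV_cmult[OF assms[of t], of c] DERIV_cmult_right[OF assms[of t], of c]
  by (auto intro: DERIV_imp_deriv)

lemma continuous_bounded_Icc:
  fixes q :: "real \<Rightarrow> real"
  assumes "continuous_on {c..d} q"
  obtains B where "0 \<le> B" "\<And>t. t \<in> {c..d} \<Longrightarrow> \<bar>q t\<bar> \<le> B"
proof -
  have "bounded (q ` {c..d})" using assms by (intro compact_imp_bounded compact_continuous_image) auto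
  then obtain B where "0 < B" "\<forall>t\<in>{c..d}. \<bar>q t\<bar> \<le> B" by (auto simp: bounded_pos)
  then show ?thesis by (intro that[of B]) auto
qed

text \<open>Test functions p(x) q(t), with p tending to the indicator of ]a, b], reduce the planar
  identity to a one-dimensional weak derivative of the integral over [a, b]. That integral is
  continuous in t, so the one-dimensional result holds between any two positive times.\<close>

lemma weak_time_derivative:
  fixes w u :: "real \<Rightarrow> real \<Rightarrow> real"
  assumes wm: "half_plane_measurable w" and um: "half_plane_measurable u"
    and wb: "\<And>c d p q. \<exists>B. \<forall>x\<in>{c..d}. \<forall>t\<in>{p..q}. 0 < t \<longrightarrow> \<bar>w x t\<bar> \<le> B"
    and ub: "\<And>c d p q. \<exists>B. \<forall>x\<in>{c..d}. \<forall>t\<in>{p..q}. 0 < t \<longrightarrow> \<bar>u x t\<bar> \<le> B"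
    and wc: "\<And>c d. continuous_on {0<..} (\<lambda>t. LINT x:{c..d}|lebesgue. w x t)"
    and uc: "\<And>c d. continuous_on {0<..} (\<lambda>t. LINT x:{c..d}|lebesgue. u x t)"
    and weak: "\<And>\<psi>. test_function \<psi> \<Longrightarrow> (LINT (x, t):half_plane|lebesgue. w x t * deriv (\<lambda>s. \<psi> x s) t) =
      - (LINT (x, t):half_plane|lebesgue. u x t * \<psi> x t)"
    and t: "0 < t1" "t1 \<le> t2" and ab: "a \<le> b"
  shows "(LINT x:{a..b}|lebesgue. w x t2) - (LINT x:{a..b}|lebesgue. w x t1) =
    (LINT t:{t1..t2}|lebesgue. LINT x:{a..b}|lebesgue. u x t)"
proof (cases "a = b")
  case True
  have "(LINT x:{b..b}|lebesgue. h x) = 0" for h :: "real \<Rightarrow> real"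
    using set_lebesgue_integral_halfopen[of b b h] by (simp add: set_lebesgue_integral_def)
  then show ?thesis unfolding True by (simp only:) (simp add: set_lebesgue_integral_def)
next
  case False
  then have "a < b" using ab by simp
  obtain p p' where p: "\<And>n. smooth_on UNIV (p n)" "\<And>n x. (p n has_real_derivative p' n x) (at x)"
    "\<And>n. continuous_on UNIV (p' n)"
    "\<And>n x. x \<notin> {a..b + 1} \<Longrightarrow> p n x = 0" "\<And>n x. x \<notin> {a..b + 1} \<Longrightarrow> p' n x = 0"
    "\<And>n x. \<bar>p n x\<bar> \<le> 1"
    "\<And>x. (\<lambda>n::nat. p n x) \<longlonglongrightarrow> indicator {a<..b} x"
    by (rule smooth_indicator_approximation[OF \<open>a < b\<close> zero_less_one], rule that)
  have pm: "p n \<in> borel_measurable borel" for n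
    by (intro borel_measurable_continuous_onI continuous_at_imp_continuous_on ballI DERIV_isCont[OF p(2)])
  show ?thesis
  proof (rule weak_derivative_imp_integral[of "{0<..}"])
    show "set_integrable lebesgue {c..d} (\<lambda>t. LINT x:{a..b}|lebesgue. u x t)" if "{c..d} \<subseteq> {0<..}" for c d
      by (intro absolutely_integrable_continuous_real continuous_on_subset[OF uc that])
    fix q q' :: "real \<Rightarrow> real" and c d
    assume q: "smooth_on UNIV q" "\<And>x. (q has_real_derivative q' x) (at x)" "continuous_on UNIV q'"
      "{c..d} \<subseteq> {0<..}" "c \<le> d" "\<And>x. x \<notin> {c..d} \<Longrightarrow> q x = 0" "\<And>x. x \<notin> {c..d} \<Longrightarrow> q' x = 0"
    have "0 < c" using q(4,5) by auto
    have qc: "continuous_on UNIV q" by (intro continuous_at_imp_continuous_on ballI DERIV_isCont[OF q(2)])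
    \<comment> \<open>Stated for general \<open>h\<close> and \<open>r\<close> because it is used
      twice: for w with the derivative of q, and for u with q itself.\<close>
    have key: "(\<lambda>n. LINT (x, t):half_plane|lebesgue. h x t * (p n x * r t)) \<longlonglongrightarrow>
        (LINT t:{c..d}|lebesgue. (LINT x:{a..b}|lebesgue. h x t) * r t)"
      if h: "half_plane_measurable h" "\<And>c d p q. \<exists>B. \<forall>x\<in>{c..d}. \<forall>t\<in>{p..q}. 0 < t \<longrightarrow> \<bar>h x t\<bar> \<le> B"
        and r: "continuous_on UNIV r" "\<And>x. x \<notin> {c..d} \<Longrightarrow> r x = 0" for h r
    proof -
      have rm: "r \<in> borel_measurable borel" using r by (intro borel_measurable_continuous_onI)
      obtain B where B: "\<And>x t. x \<in> {a..b + 1} \<Longrightarrow> t \<in> {c..d} \<Longrightarrow> \<bar>h x t\<bar> \<le> B"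
        using h(2)[of a "b + 1" c d] \<open>0 < c\<close> by force
      obtain R where R: "0 \<le> R" "\<And>t. t \<in> {c..d} \<Longrightarrow> \<bar>r t\<bar> \<le> R"
        using continuous_bounded_Icc[OF continuous_on_subset[OF r(1)]] by blast
      have bnd: "\<bar>h x t * (y * r t)\<bar> \<le> B * (1 * R)"
        if "x \<in> {a..b + 1}" "t \<in> {c..d}" "\<bar>y\<bar> \<le> 1" for x t y
        unfolding abs_mult using B[OF that(1,2)] R that by (intro mult_mono) auto
      have "(\<lambda>n. LINT (x, t):half_plane|lebesgue. h x t * (p n x * r t)) \<longlonglongrightarrow>
        (LINT (x, t):half_plane|lebesgue. h x t * (indicator {a<..b} x * r t))"
      proof (rule half_plane_dominated_convergence)
        show "half_plane_measurable (\<lambda>x t. h x t * (p n x * r t))" for n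
          by (intro half_plane_measurable_intros h pm rm)
        show "half_plane_measurable (\<lambda>x t. h x t * (indicator {a<..b} x * r t))"
          by (intro half_plane_measurable_intros h rm) simp
        show "AE x in lebesgue. (\<lambda>n. h x t * (p n x * r t)) \<longlonglongrightarrow> h x t * (indicat_real {a<..b} x * r t)" for t
          by (rule AE_I2) (intro tendsto_intros p(7))
        show "\<bar>h x t * (p n x * r t)\<bar> \<le> B * (1 * R)" if "x \<in> {a..b + 1}" "t \<in> {c..d}" for n x t
          using bnd[OF that p(6)] .
        show "h x t * (p n x * r t) = 0" if "\<not> (x \<in> {a..b + 1} \<and> t \<in> {c..d})" for n x t
          using that p(4) r(2) by force
      qed fact
      also have "(LINT (x, t):half_plane|lebesgue. h x t * (indicator {a<..b} x * r t))
          = (LINT t:{c..d}|lebesgue. LINT x:{a..b+1}|lebesgue. h x t * (indicator {a<..b} x * r t))"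
      proof (rule half_plane_Fubini(2))
        show "half_plane_measurable (\<lambda>x t. h x t * (indicator {a<..b} x * r t))"
          by (intro half_plane_measurable_intros h rm) simp
        show "\<bar>h x t * (indicator {a<..b} x * r t)\<bar> \<le> B * (1 * R)" if "x \<in> {a..b + 1}" "t \<in> {c..d}" for x t
          using bnd[OF that] by (simp add: indicator_def)
        show "h x t * (indicator {a<..b} x * r t) = 0" if "\<not> (x \<in> {a..b + 1} \<and> t \<in> {c..d})" for x t
          using that r(2) by (auto simp: indicator_def)
      qed fact
      also have "(\<lambda>t. LINT x:{a..b+1}|lebesgue. h x t * (indicator {a<..b} x * r t)) = (\<lambda>t. (LINT x:{a..b}|lebesgue. h x t) * r t)"
      proof
        fix t
        have "(LINT x:{a..b+1}|lebesgue. h x t * (indicator {a<..b} x * r t)) = (LINT x:{a<..b}|lebesgue. h x t * r t)"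
          unfolding set_lebesgue_integral_def
          by (intro Bochner_Integration.integral_cong) (auto simp: indicator_def)
        then show "(LINT x:{a..b+1}|lebesgue. h x t * (indicator {a<..b} x * r t)) = (LINT x:{a..b}|lebesgue. h x t) * r t"
          by (simp add: set_lebesgue_integral_halfopen)
      qed
      finally show ?thesis .
    qed
    have "(LINT (x, t):half_plane|lebesgue. w x t * (p n x * q' t)) = - (LINT (x, t):half_plane|lebesgue. u x t * (p n x * q t))" for n
      using weak[OF test_function_product[OF p(1)[of n] q(1) p(4) q(6) \<open>0 < c\<close>]]
      by (simp add: deriv_product_test[OF q(2)])
    then show "(LINT t:{c..d}|lebesgue. (LINT x:{a..b}|lebesgue. w x t) * q' t)
       = - (LINT t:{c..d}|lebesgue. (LINT x:{a..b}|lebesgue. u x t) * q t)"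
      using LIMSEQ_unique[OF key[OF wm wb q(3,7)]] tendsto_minus[OF key[OF um ub qc q(6)]] by simp
  qed (use t wc in auto)
qed

text \<open>Here the time factor is removed first. For a fixed space test function p the pairing
  \<open>k\<close> is continuous and annihilated by all time test functions, hence zero at each
  positive time. What remains is a weak derivative in x at the given time.\<close>

lemma weak_space_derivative:
  fixes w u :: "real \<Rightarrow> real \<Rightarrow> real"
  assumes wm: "half_plane_measurable w" and um: "half_plane_measurable u"
    and wb: "\<And>c d p q. \<exists>B. \<forall>x\<in>{c..d}. \<forall>t\<in>{p..q}. 0 < t \<longrightarrow> \<bar>w x t\<bar> \<le> B"
    and ub: "\<And>c d p q. \<exists>B. \<forall>x\<in>{c..d}. \<forall>t\<in>{p..q}. 0 < t \<longrightarrow> \<bar>u x t\<bar> \<le> B"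
    and wc: "\<And>c d p. continuous_on UNIV p \<Longrightarrow> continuous_on {0<..} (\<lambda>t. LINT x:{c..d}|lebesgue. w x t * p x)"
    and uc: "\<And>c d p. continuous_on UNIV p \<Longrightarrow> continuous_on {0<..} (\<lambda>t. LINT x:{c..d}|lebesgue. u x t * p x)"
    and wx: "\<And>t. 0 < t \<Longrightarrow> continuous_on UNIV (\<lambda>x. w x t)"
    and ux: "\<And>t c d. 0 < t \<Longrightarrow> set_integrable lebesgue {c..d} (\<lambda>x. u x t)"
    and weak: "\<And>\<psi>. test_function \<psi> \<Longrightarrow> (LINT (x, t):half_plane|lebesgue. w x t * deriv (\<lambda>y. \<psi> y t) x) =
      - (LINT (x, t):half_plane|lebesgue. u x t * \<psi> x t)"
    and t: "0 < t" and ab: "a \<le> b"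
  shows "w b t - w a t = (LINT x:{a..b}|lebesgue. u x t)"
proof (rule weak_derivative_imp_integral[of UNIV])
  fix p p' :: "real \<Rightarrow> real" and c d
  assume p: "smooth_on UNIV p" "\<And>x. (p has_real_derivative p' x) (at x)" "continuous_on UNIV p'"
      "c \<le> d" "\<And>x. x \<notin> {c..d} \<Longrightarrow> p x = 0" "\<And>x. x \<notin> {c..d} \<Longrightarrow> p' x = 0"
  have pc: "continuous_on UNIV p" by (intro continuous_at_imp_continuous_on ballI DERIV_isCont[OF p(2)])
  note pm = borel_measurable_continuous_onI[OF pc] borel_measurable_continuous_onI[OF p(3)]
  define k where "k s = (LINT x:{c..d}|lebesgue. w x s * p' x) + (LINT x:{c..d}|lebesgue. u x s * p x)" for s
  have kc: "continuous_on {0<..} k" unfolding k_def by (intro continuous_intros wc uc p(3) pc)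
  \<comment> \<open>The constant 0 has weak derivative \<open>k\<close>, so \<open>k\<close>
    integrates to 0 over every interval.\<close>
  have "0 - 0 = (LINT s:{l..m}|lebesgue. k s)" if lm: "0 < l" "l \<le> m" for l m
  proof (rule weak_derivative_imp_integral[of "{0<..}"])
    show "set_integrable lebesgue {c..d} k" if "{c..d} \<subseteq> {0<..}" for c d
      by (intro absolutely_integrable_continuous_real continuous_on_subset[OF kc that])
    fix q q' :: "real \<Rightarrow> real" and \<alpha> \<beta>
    assume q: "smooth_on UNIV q" "\<And>x. (q has_real_derivative q' x) (at x)" "continuous_on UNIV q'"
      "{\<alpha>..\<beta>} \<subseteq> {0<..}" "\<alpha> \<le> \<beta>" "\<And>x. x \<notin> {\<alpha>..\<beta>} \<Longrightarrow> q x = 0" "\<And>x. x \<notin> {\<alpha>..\<beta>} \<Longrightarrow> q' x = 0"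
    have "0 < \<alpha>" using q(4,5) by auto
    have qc: "continuous_on UNIV q" by (intro continuous_at_imp_continuous_on ballI DERIV_isCont[OF q(2)])
    note qm = borel_measurable_continuous_onI[OF qc]
    have key: "(LINT (x, t):half_plane|lebesgue. h x t * (r x * q t)) =
        (LINT t:{\<alpha>..\<beta>}|lebesgue. (LINT x:{c..d}|lebesgue. h x t * r x) * q t)"
      if h: "half_plane_measurable h" "\<And>c d p q. \<exists>B. \<forall>x\<in>{c..d}. \<forall>t\<in>{p..q}. 0 < t \<longrightarrow> \<bar>h x t\<bar> \<le> B"
        and r: "continuous_on UNIV r" "\<And>x. x \<notin> {c..d} \<Longrightarrow> r x = 0" for h r
    proof -
      obtain B where B: "\<And>x t. x \<in> {c..d} \<Longrightarrow> t \<in> {\<alpha>..\<beta>} \<Longrightarrow> \<bar>h x t\<bar> \<le> B"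
        using h(2)[of c d \<alpha> \<beta>] \<open>0 < \<alpha>\<close> by force
      obtain R where R: "0 \<le> R" "\<And>x. x \<in> {c..d} \<Longrightarrow> \<bar>r x\<bar> \<le> R"
        using continuous_bounded_Icc[OF continuous_on_subset[OF r(1)]] by blast
      obtain Q where Q: "0 \<le> Q" "\<And>x. x \<in> {\<alpha>..\<beta>} \<Longrightarrow> \<bar>q x\<bar> \<le> Q"
        using continuous_bounded_Icc[OF continuous_on_subset[OF qc]] by blast
      have "(LINT (x, t):half_plane|lebesgue. h x t * (r x * q t)) =
         (LINT t:{\<alpha>..\<beta>}|lebesgue. LINT x:{c..d}|lebesgue. h x t * (r x * q t))"
      proof (rule half_plane_Fubini(2))
        show "half_plane_measurable (\<lambda>x t. h x t * (r x * q t))"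
          by (intro half_plane_measurable_intros h qm borel_measurable_continuous_onI[OF r(1)])
        show "\<bar>h x t * (r x * q t)\<bar> \<le> B * (R * Q)" if "x \<in> {c..d}" "t \<in> {\<alpha>..\<beta>}" for x t
          unfolding abs_mult using B[OF that] R Q that by (intro mult_mono) auto
        show "h x t * (r x * q t) = 0" if "\<not> (x \<in> {c..d} \<and> t \<in> {\<alpha>..\<beta>})" for x t
          using that r(2) q(6) by force
      qed fact
      then show ?thesis by (simp add: mult.assoc[symmetric])
    qed
    have "(LINT (x, t):half_plane|lebesgue. w x t * (p' x * q t)) = - (LINT (x, t):half_plane|lebesgue. u x t * (p x * q t))"
      using weak[OF test_function_product[OF p(1) q(1) p(5) q(6) \<open>0 < \<alpha>\<close>]]
      by (simp add: deriv_product_test[OF p(2)])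
    with key[OF wm wb p(3,6)] key[OF um ub pc p(5)]
    have "(LINT t:{\<alpha>..\<beta>}|lebesgue. (LINT x:{c..d}|lebesgue. w x t * p' x) * q t)
       + (LINT t:{\<alpha>..\<beta>}|lebesgue. (LINT x:{c..d}|lebesgue. u x t * p x) * q t) = 0"
      by linarith
    moreover have "set_integrable lebesgue {\<alpha>..\<beta>} (\<lambda>t. (LINT x:{c..d}|lebesgue. w x t * p' x) * q t)"
      "set_integrable lebesgue {\<alpha>..\<beta>} (\<lambda>t. (LINT x:{c..d}|lebesgue. u x t * p x) * q t)"
      using q(4) by (intro absolutely_integrable_continuous_real continuous_on_mult continuous_on_subset[OF qc]
          continuous_on_subset[OF wc] continuous_on_subset[OF uc] p(3) pc; simp)+
    ultimately have "(LINT t:{\<alpha>..\<beta>}|lebesgue. k t * q t) = 0"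
      by (simp add: k_def distrib_right set_integral_add)
    then show "(LINT t:{\<alpha>..\<beta>}|lebesgue. 0 * q' t) = - (LINT t:{\<alpha>..\<beta>}|lebesgue. k t * q t)"
      by (simp add: set_lebesgue_integral_def)
  qed (use lm in auto)
  then have "k t = 0" using continuous_zero_integrals_imp_zero[OF kc t] by simp
  then show "(LINT x:{c..d}|lebesgue. w x t * p' x) = - (LINT x:{c..d}|lebesgue. u x t * p x)"
    by (simp add: k_def)
qed (use wx[OF t] ux[OF t] ab in auto)

lemma Ck_on_subset: "Ck_on k S f \<Longrightarrow> T \<subseteq> S \<Longrightarrow> Ck_on k T f"
proof (induction k arbitrary: f)
  case (Suc k)
  then obtain f' where "\<forall>x\<in>S. (f has_derivative f' x) (at x within S)" "\<forall>h. Ck_on k S (\<lambda>x. f' x h)"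
    by auto
  then have "\<forall>x\<in>T. (f has_derivative f' x) (at x within T)" "\<forall>h. Ck_on k T (\<lambda>x. f' x h)"
    using Suc has_derivative_subset by blast+
  then show ?case unfolding Ck_on.simps by blast
qed (auto intro: continuous_on_subset)

lemma Ck_on_imp_has_deriv:
  fixes f :: "real \<Rightarrow> real"
  assumes "Ck_on (Suc k) UNIV f"
  shows "(f has_real_derivative deriv f x) (at x)"
proof -
  obtain D where "\<And>x. (f has_derivative D x) (at x)" using assms by auto
  then have "f differentiable (at x)" unfolding differentiable_def by blast
  then show ?thesis by (simp add: DERIV_deriv_iff_real_differentiable)
qed

section \<open>The Lagrangian map\<close>

text \<open>Passes continuity in time along Lipschitz estimates: from the pair to its components and
  to v/\<eta>, and from there to G(v/\<eta>).\<close>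

lemma L1loc_continuous_on_dominated:
  fixes w :: "real \<Rightarrow> real \<Rightarrow> 'a::euclidean_space" and w' :: "real \<Rightarrow> real \<Rightarrow> real"
  assumes w: "L1loc_continuous_on T w"
    and int: "\<And>t C. t \<in> T \<Longrightarrow> compact C \<Longrightarrow> set_integrable lebesgue C (\<lambda>x. w' x t)"
    and le: "\<And>s t. s \<in> T \<Longrightarrow> t \<in> T \<Longrightarrow> AE x in lebesgue. \<bar>w' x t - w' x s\<bar> \<le> K * norm (w x t - w x s)"
  shows "L1loc_continuous_on T w'"
  unfolding L1loc_continuous_on_def
proof (intro allI impI conjI ballI)
  fix C :: "real set" assume C: "compact C"
  show "set_integrable lebesgue C (\<lambda>x. w' x t)" if "t \<in> T" for t using int that C .
  fix s assume s: "s \<in> T"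
  have "((\<lambda>t. K * (LINT x:C|lebesgue. norm (w x t - w x s))) \<longlongrightarrow> K * 0) (at s within T)"
    using w s C by (intro tendsto_mult tendsto_const) (auto simp: L1loc_continuous_on_def)
  then have "((\<lambda>t. K * (LINT x:C|lebesgue. norm (w x t - w x s))) \<longlongrightarrow> 0) (at s within T)" by simp
  then show "((\<lambda>t. LINT x:C|lebesgue. norm (w' x t - w' x s)) \<longlongrightarrow> 0) (at s within T)"
  proof (rule Lim_null_comparison[rotated])
    have "norm (LINT x:C|lebesgue. norm (w' x t - w' x s)) \<le> K * (LINT x:C|lebesgue. norm (w x t - w x s))"
      if t: "t \<in> T" for t
    proof -
      have i': "set_integrable lebesgue C (\<lambda>x. norm (w' x t - w' x s))"
        by (intro set_integrable_norm set_integral_diff(1) int s t C)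
      have i: "set_integrable lebesgue C (\<lambda>x. K * norm (w x t - w x s))"
        using w s t C unfolding L1loc_continuous_on_def
        by (intro set_integrable_mult_right set_integrable_norm set_integral_diff(1)) auto
      have "(LINT x:C|lebesgue. norm (w' x t - w' x s)) \<le> (LINT x:C|lebesgue. K * norm (w x t - w x s))"
        using le[OF s t] by (intro set_integral_mono_AE i i') (auto elim: eventually_mono)
      moreover have "0 \<le> (LINT x:C|lebesgue. norm (w' x t - w' x s))"
        unfolding set_lebesgue_integral_def by (intro Bochner_Integration.integral_nonneg) simp
      ultimately show ?thesis by simp
    qed
    then show "\<forall>\<^sub>F t in at s within T. norm (LINT x:C|lebesgue. norm (w' x t - w' x s))
        \<le> K * (LINT x:C|lebesgue. norm (w x t - w x s))"
      by (auto simp: eventually_at_filter)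
  qed
qed

text \<open>A rectangle in place of the compact support lets Fubini and dominated convergence work
  with products of intervals. Bounds are recorded for the derivatives, since only these enter the
  integrals.\<close>

definition test_box ::
  "(real \<Rightarrow> real \<Rightarrow> real) \<Rightarrow> real \<Rightarrow> real \<Rightarrow> real \<Rightarrow> real \<Rightarrow> real \<Rightarrow> bool" where
  "test_box \<psi> c d p q B \<longleftrightarrow> 0 < p \<and> 0 \<le> B \<and>
     (\<forall>x t. \<not> (x \<in> {c..d} \<and> t \<in> {p..q}) \<longrightarrow>
        \<psi> x t = 0 \<and> deriv (\<lambda>y. \<psi> y t) x = 0 \<and> deriv (\<lambda>s. \<psi> x s) t = 0) \<and>
     (\<forall>x t. \<bar>deriv (\<lambda>y. \<psi> y t) x\<bar> \<le> B \<and> \<bar>deriv (\<lambda>s. \<psi> x s) t\<bar> \<le> B)"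

lemma test_boxD:
  assumes "test_box \<psi> c d p q B"
  shows "0 < p" "0 \<le> B"
    "\<And>x t. \<not> (x \<in> {c..d} \<and> t \<in> {p..q}) \<Longrightarrow> \<psi> x t = 0"
    "\<And>x t. \<not> (x \<in> {c..d} \<and> t \<in> {p..q}) \<Longrightarrow> deriv (\<lambda>y. \<psi> y t) x = 0"
    "\<And>x t. \<not> (x \<in> {c..d} \<and> t \<in> {p..q}) \<Longrightarrow> deriv (\<lambda>s. \<psi> x s) t = 0"
    "\<And>x t. \<bar>deriv (\<lambda>y. \<psi> y t) x\<bar> \<le> B" "\<And>x t. \<bar>deriv (\<lambda>s. \<psi> x s) t\<bar> \<le> B"
  using assms unfolding test_box_def by blast+

lemma C1_test_function_bounds:
  assumes "C1_test_function \<psi>"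
  obtains c d p q B where "test_box \<psi> c d p q B"
proof -
  define Z where "Z = closure {(x, t). \<psi> x t \<noteq> 0}"
  have Z: "compact Z" "Z \<subseteq> UNIV \<times> {0<..}" and C1: "Ck_on 1 UNIV (\<lambda>(x, t). \<psi> x t)"
    using assms by (auto simp: C1_test_function_def supported_in_upper_def Z_def)
  have z0: "\<psi> x t = 0" if "(x, t) \<notin> Z" for x t
    using that closure_subset[of "{(x, t). \<psi> x t \<noteq> 0}"] by (auto simp: Z_def)
  have op: "open (- Z)" using Z(1) by (simp add: compact_imp_closed open_Compl)
  \<comment> \<open>Off the closed support the function vanishes on a whole neighbourhood, hence so
    does its derivative; \<open>e\<close> will be one of the two coordinate lines.\<close>
  have d0: "deriv k r = 0" if "continuous_on UNIV e" "e r \<notin> Z" "\<And>y. e y \<notin> Z \<Longrightarrow> k y = 0"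
    for k :: "real \<Rightarrow> real" and e r
  proof -
    have "((\<lambda>y. 0) has_real_derivative 0) (at r)" by simp
    then have "(k has_real_derivative 0) (at r)"
      by (rule has_field_derivative_transform_within_open[OF _ open_vimage[OF op that(1)]]) (use that in auto)
    then show ?thesis by (rule DERIV_imp_deriv)
  qed
  have zx: "deriv (\<lambda>y. \<psi> y t) x = 0" and zt: "deriv (\<lambda>s. \<psi> x s) t = 0" if "(x, t) \<notin> Z" for x t
    by (rule d0[where e="\<lambda>y. (y, t)"], use that z0 in \<open>auto intro!: continuous_intros\<close>)
      (rule d0[where e="\<lambda>s. (x, s)"], use that z0 in \<open>auto intro!: continuous_intros\<close>)
  have "compact (fst ` Z)" "compact (snd ` Z)"
    using Z(1) by (auto intro!: compact_continuous_image continuous_on_fst continuous_on_snd continuous_on_id)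
  then have "bounded (fst ` Z)" "bounded (snd ` Z)" by (auto intro: compact_imp_bounded)
  then obtain R Q where R: "0 < R" "\<And>z. z \<in> Z \<Longrightarrow> \<bar>fst z\<bar> \<le> R" and Q: "0 < Q" "\<And>z. z \<in> Z \<Longrightarrow> \<bar>snd z\<bar> \<le> Q"
    unfolding bounded_pos by (metis imageI real_norm_def)
  \<comment> \<open>The projection of the support to the time axis is compact and has a positive
    minimum; for an empty support the value 1 is taken.\<close>
  obtain p where p: "0 < p" "\<And>z. z \<in> Z \<Longrightarrow> p \<le> snd z"
  proof (cases "Z = {}")
    case False
    then obtain m where "m \<in> snd ` Z" "\<And>y. y \<in> snd ` Z \<Longrightarrow> m \<le> y"
      using compact_attains_inf[OF \<open>compact (snd ` Z)\<close>] by auto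
    then show thesis using Z(2) by (intro that[of m]) auto
  qed (use that[of 1] in auto)
  have bd: "\<exists>B\<ge>0. \<forall>x t. \<bar>h x t\<bar> \<le> B"
    if h: "continuous_on UNIV (\<lambda>(x, t). h x t)" "\<And>x t. (x, t) \<notin> Z \<Longrightarrow> h x t = 0" for h :: "real \<Rightarrow> real \<Rightarrow> real"
  proof -
    have "bounded ((\<lambda>(x, t). h x t) ` Z)"
      by (intro compact_imp_bounded compact_continuous_image continuous_on_subset[OF h(1)] Z) auto
    then obtain B where B: "0 < B" "\<forall>z\<in>Z. \<bar>case z of (x, t) \<Rightarrow> h x t\<bar> \<le> B" by (auto simp: bounded_pos)
    have "\<bar>h x t\<bar> \<le> B" for x t
    proof (cases "(x, t) \<in> Z")
      case True
      then show ?thesis using B(2) by auto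
    qed (use h(2) B(1) in auto)
    then show ?thesis using B(1) by (intro exI[of _ B]) auto
  qed
  note der = has_derivative_of_C1[OF C1]
  obtain B2 where B2: "0 \<le> B2" "\<And>x t. \<bar>deriv (\<lambda>y. \<psi> y t) x\<bar> \<le> B2" using bd[OF der(2) zx] by blast
  obtain B3 where B3: "0 \<le> B3" "\<And>x t. \<bar>deriv (\<lambda>s. \<psi> x s) t\<bar> \<le> B3" using bd[OF der(3) zt] by blast
  have out: "(x, t) \<notin> Z" if "\<not> (x \<in> {-R..R} \<and> t \<in> {p..max p Q})" for x t
    using that R(2)[of "(x, t)"] Q(2)[of "(x, t)"] p(2)[of "(x, t)"] by (auto simp: abs_le_iff)
  have "\<bar>deriv (\<lambda>y. \<psi> y t) x\<bar> \<le> B2 + B3" "\<bar>deriv (\<lambda>s. \<psi> x s) t\<bar> \<le> B2 + B3" for x t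
    using B2(1) B2(2)[of t x] B3(1) B3(2)[of x t] by linarith+
  then have "test_box \<psi> (- R) R p (max p Q) (B2 + B3)"
    unfolding test_box_def using out z0 zx zt p(1) B2(1) B3(1) by auto
  then show thesis by (rule that)
qed

lemma test_function_imp_C1: "test_function \<psi> \<Longrightarrow> C1_test_function \<psi>"
  by (simp add: test_function_def C1_test_function_def smooth_on_def)

lemma half_plane_measurable_cong:
  assumes "\<And>x t. 0 \<le> t \<Longrightarrow> F x t = F' x t"
  shows "half_plane_measurable F \<longleftrightarrow> half_plane_measurable F'"
  using assms by (intro measurable_cong) (auto simp: space_restrict_space)

locale lagrangian =
  fixes f g G \<sigma>0 :: "real \<Rightarrow> real"
    and a b L K :: real
    and J :: "real set"
    and \<eta> v \<gamma> \<sigma> :: "real \<Rightarrow> real \<Rightarrow> real"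
  assumes f_smooth: "smooth_on UNIV f"
    and ab: "a \<le> b"
    and J_def: "J = {a + L..b + L}"
    and J_pos: "J \<subseteq> {0<..}"
    and g_def: "g = (\<lambda>\<sigma>. f (\<sigma> - L) + K)"
    and G_def: "G = (\<lambda>\<sigma>. g \<sigma> / \<sigma>)"
    and \<sigma>0_range: "\<forall>x. \<sigma>0 x \<in> J"
    and \<sigma>0_BV: "bounded_total_variation \<sigma>0"
    and solution: "admissible_weak_solution (state_space J) (system_flux G) (system_convex_extension J G)
                     (\<lambda>x. (1, \<sigma>0 x)) (\<lambda>x t. (\<eta> x t, v x t))"
    and solution_BV: "in_C_BV2 \<eta> v"
    and \<gamma>: "lagrangian_map \<eta> (\<lambda>x t. G (v x t / \<eta> x t)) \<gamma>"
    and \<sigma>_def: "\<sigma> = (\<lambda>x t. v (inv (\<lambda>y. \<gamma> y t) x) t / \<eta> (inv (\<lambda>y. \<gamma> y t) x) t)"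
begin

section \<open>Constants, regularity of the flux, and bounds for the solution\<close>

definition "\<alpha> = a + L"
definition "\<beta> = b + L"
text \<open>The future lower bound for \<eta>: almost everywhere \<alpha> <= \<sigma>0 = v, and v <=
  \<beta> \<eta>.\<close>

definition "\<delta> = \<alpha> / \<beta>"

lemma J_eq: "J = {\<alpha>..\<beta>}" by (simp add: J_def \<alpha>_def \<beta>_def)

lemma \<alpha>_pos: "0 < \<alpha>" and \<alpha>_le_\<beta>: "\<alpha> \<le> \<beta>"
  using subsetD[OF J_pos, of "a + L"] ab by (simp_all add: J_def \<alpha>_def \<beta>_def)

lemma \<delta>_pos: "0 < \<delta>"
  using \<alpha>_pos \<alpha>_le_\<beta> by (simp add: \<delta>_def)

lemma g_Ck: "Ck_on k UNIV g"
proof -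
  have "Ck_on k UNIV (\<lambda>\<sigma>. \<sigma> - L)"
    by (rule Ck_on_diff, rule Ck_on_linear, rule bounded_linear_ident, rule Ck_on_const)
  then have "Ck_on k UNIV (\<lambda>\<sigma>. f (\<sigma> - L))"
    by (rule Ck_on_compose_real[OF smooth_onD[OF f_smooth]]) simp
  then show ?thesis unfolding g_def by (intro Ck_on_add Ck_on_const)
qed

lemma g_deriv: "(g has_real_derivative deriv g s) (at s)"
  by (rule Ck_on_imp_has_deriv[OF g_Ck])

lemma G_Ck: "Ck_on k J G"
  unfolding G_def divide_inverse
  by (intro Ck_on_mult Ck_on_subset[OF g_Ck] Ck_on_inverse J_pos) simp

lemma G_deriv:
  assumes "s \<in> J"
  shows "(G has_real_derivative deriv G s) (at s)" "deriv G s = (deriv g s * s - g s) / s\<^sup>2"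
proof -
  have "s \<noteq> 0" using assms J_pos by auto
  then have "(G has_real_derivative (deriv g s * s - g s) / s\<^sup>2) (at s)"
    unfolding G_def using DERIV_divide[OF g_deriv DERIV_ident, of s] by (simp add: power2_eq_square)
  then show "(G has_real_derivative deriv G s) (at s)" "deriv G s = (deriv g s * s - g s) / s\<^sup>2"
    using DERIV_imp_deriv by metis+
qed

lemma G_cont: "continuous_on J G" using G_Ck[of 0] by simp

lemma G_Lipschitz: obtains C where "\<And>s r. s \<in> J \<Longrightarrow> r \<in> J \<Longrightarrow> \<bar>G s - G r\<bar> \<le> C * \<bar>s - r\<bar>"
proof -
  have "continuous_on UNIV (deriv g)"
    using g_Ck[of 1] Ck_on_has_real_derivative_iff[OF g_deriv, of 0] by simp
  moreover have "continuous_on UNIV g" using g_Ck[of 0] by simp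
  ultimately have "continuous_on J (\<lambda>s. (deriv g s * s - g s) / s\<^sup>2)"
    using J_pos by (intro continuous_intros) (auto intro: continuous_on_subset)
  then have cG: "continuous_on {\<alpha>..\<beta>} (deriv G)"
    using G_deriv(2) J_eq by (metis (no_types, lifting) continuous_on_cong)
  obtain C where C: "\<And>s. s \<in> {\<alpha>..\<beta>} \<Longrightarrow> \<bar>deriv G s\<bar> \<le> C"
    by (rule continuous_bounded_Icc[OF cG], rule that)
  have "\<bar>G s - G r\<bar> \<le> C * \<bar>s - r\<bar>" if "s \<in> J" "r \<in> J" for s r
    using field_differentiable_bound[of J G "deriv G" C s r] C G_deriv(1) that
    by (auto simp: J_eq intro: has_field_derivative_at_within)
  then show thesis by (rule that)
qed

lemma weak: "weak_solution (state_space J) (system_flux G) (\<lambda>x. (1, \<sigma>0 x)) (\<lambda>x t. (\<eta> x t, v x t))"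
  using solution by (simp add: admissible_weak_solution_def)

abbreviation S :: "real \<Rightarrow> real \<Rightarrow> real" where "S x t \<equiv> v x t / \<eta> x t"

lemma \<eta>_pos: "0 \<le> t \<Longrightarrow> 0 < \<eta> x t" and S_in_J: "0 \<le> t \<Longrightarrow> S x t \<in> J"
  using weak by (auto simp: weak_solution_def state_space_def)

text \<open>Fixed once by choice so that all estimates share one constant; the normalisation 1 <= M
  provides positivity.\<close>

definition "M = (SOME M. 1 \<le> M \<and> (\<forall>x t. 0 \<le> t \<longrightarrow> \<eta> x t \<le> M \<and> \<bar>v x t\<bar> \<le> M))"

lemma M: "1 \<le> M" and \<eta>_le: "0 \<le> t \<Longrightarrow> \<eta> x t \<le> M" and v_le: "0 \<le> t \<Longrightarrow> \<bar>v x t\<bar> \<le> M"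
proof -
  have "bounded ((\<lambda>(x, t). (\<eta> x t, v x t)) ` (UNIV \<times> {0..}))" using weak by (simp add: weak_solution_def)
  then obtain R where R: "\<And>x t. 0 \<le> t \<Longrightarrow> norm (\<eta> x t, v x t) \<le> R" by (force simp: bounded_iff)
  have "\<exists>M. 1 \<le> M \<and> (\<forall>x t. 0 \<le> t \<longrightarrow> \<eta> x t \<le> M \<and> \<bar>v x t\<bar> \<le> M)"
  proof (intro exI[of _ "max 1 R"] conjI allI impI)
    fix x t :: real assume "0 \<le> t"
    then have "\<bar>\<eta> x t\<bar> \<le> R" "\<bar>v x t\<bar> \<le> R"
      using norm_fst_le[of "\<eta> x t" "v x t"] norm_snd_le[of "v x t" "\<eta> x t"] R[of t x] by auto
    then show "\<eta> x t \<le> max 1 R" "\<bar>v x t\<bar> \<le> max 1 R" by auto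
  qed simp
  from someI_ex[OF this] show "1 \<le> M" "0 \<le> t \<Longrightarrow> \<eta> x t \<le> M" "0 \<le> t \<Longrightarrow> \<bar>v x t\<bar> \<le> M"
    unfolding M_def by auto
qed

lemma J_bounded:
  assumes "continuous_on J (E :: real \<Rightarrow> real)"
  obtains B where "0 \<le> B" "\<And>s. s \<in> J \<Longrightarrow> \<bar>E s\<bar> \<le> B"
  using continuous_bounded_Icc[of \<alpha> \<beta> E] assms unfolding J_eq by blast

lemma \<eta>_meas: "half_plane_measurable \<eta>" and v_meas: "half_plane_measurable v"
proof -
  have m: "(\<lambda>(x, t). (\<eta> x t, v x t)) \<in> borel_measurable (lebesgue_on (UNIV \<times> {0..}))"
    using weak by (simp add: weak_solution_def)
  show "half_plane_measurable \<eta>" "half_plane_measurable v"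
    using measurable_compose[OF m borel_measurable_continuous_onI[OF continuous_on_fst[OF continuous_on_id]]]
      measurable_compose[OF m borel_measurable_continuous_onI[OF continuous_on_snd[OF continuous_on_id]]]
    by (simp_all add: case_prod_unfold)
qed

lemma S_meas: "half_plane_measurable S"
  by (intro half_plane_measurable_divide \<eta>_meas v_meas)

text \<open>Entropies are continuous only on J. After composition with the projection onto J they
  are continuous on the whole line, hence Borel, with unchanged values at arguments in J.\<close>

lemma clamp_continuous:
  assumes "continuous_on J E"
  shows "continuous_on UNIV (\<lambda>s. E (max \<alpha> (min \<beta> s)) :: real)"
  by (rule continuous_on_compose2[OF assms]) (use \<alpha>_le_\<beta> in \<open>auto intro!: continuous_intros simp: J_eq\<close>)

lemma clamp_eq: "s \<in> J \<Longrightarrow> max \<alpha> (min \<beta> s) = s" by (auto simp: J_eq)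

lemma ES_meas:
  assumes "continuous_on J E" and "half_plane_measurable w" and "\<And>x t. 0 \<le> t \<Longrightarrow> w x t \<in> J"
  shows "half_plane_measurable (\<lambda>x t. E (w x t))"
proof -
  have "half_plane_measurable (\<lambda>x t. E (max \<alpha> (min \<beta> (w x t))))"
    by (rule half_plane_measurable_compose[OF assms(2) borel_measurable_continuous_onI[OF clamp_continuous[OF assms(1)]]])
  then show ?thesis using assms(3) clamp_eq by (subst half_plane_measurable_cong) auto
qed

lemma system_L1loc: "L1loc_continuous_on {0..} (\<lambda>x t. (\<eta> x t, v x t))"
  using weak by (simp add: weak_solution_def)

lemma \<eta>_L1loc: "L1loc_continuous_on {0..} \<eta>" and v_L1loc: "L1loc_continuous_on {0..} v"
proof -
  have int: "set_integrable lebesgue C (\<lambda>x. (\<eta> x t, v x t))" if "0 \<le> t" "compact C" for t C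
    using system_L1loc that by (auto simp: L1loc_continuous_on_def)
  have "set_integrable lebesgue C (\<lambda>x. \<eta> x t)" "set_integrable lebesgue C (\<lambda>x. v x t)" if "0 \<le> t" "compact C" for t C
    using absolutely_integrable_linear[OF int[OF that] bounded_linear_fst]
      absolutely_integrable_linear[OF int[OF that] bounded_linear_snd] by (simp_all add: o_def)
  moreover have "\<bar>\<eta> x t - \<eta> x s\<bar> \<le> 1 * norm ((\<eta> x t, v x t) - (\<eta> x s, v x s))"
    "\<bar>v x t - v x s\<bar> \<le> 1 * norm ((\<eta> x t, v x t) - (\<eta> x s, v x s))" for x s t
    using norm_fst_le[of "\<eta> x t - \<eta> x s" "v x t - v x s"] norm_snd_le[of "v x t - v x s" "\<eta> x t - \<eta> x s"]
    by simp_all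
  ultimately show "L1loc_continuous_on {0..} \<eta>" "L1loc_continuous_on {0..} v"
    by (intro L1loc_continuous_on_dominated[OF system_L1loc, where K=1]; auto)+
qed

lemma L1loc_integrable:
  fixes w :: "real \<Rightarrow> real \<Rightarrow> real"
  shows "L1loc_continuous_on T w \<Longrightarrow> t \<in> T \<Longrightarrow> set_integrable lebesgue {c..d} (\<lambda>x. w x t)"
  by (auto simp: L1loc_continuous_on_def)

lemma initial: "AE x in lebesgue. \<eta> x 0 = 1 \<and> v x 0 = \<sigma>0 x"
  using weak by (auto simp: weak_solution_def)

end

lemma bounded_borel_set_integrable:
  fixes h :: "real \<Rightarrow> real"
  assumes "h \<in> borel_measurable lebesgue" "\<And>x. \<bar>h x\<bar> \<le> B"
  shows "set_integrable lebesgue {c..d} h"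
proof (rule set_integrable_bound[where f="\<lambda>x. B"])
  show "set_integrable lebesgue {c..d} (\<lambda>x. B)"
    by (intro absolutely_integrable_continuous_real continuous_on_const)
  show "set_borel_measurable lebesgue {c..d} h"
    unfolding set_borel_measurable_def by (intro borel_measurable_scaleR borel_measurable_indicator assms(1)) simp
  show "AE x in lebesgue. x \<in> {c..d} \<longrightarrow> norm (h x) \<le> norm B"
    using assms(2) by (intro AE_I2) (smt (verit) real_norm_def)
qed

lemma countable_discontinuities_borel:
  fixes h :: "real \<Rightarrow> real"
  assumes "countable {x. \<not> isCont h x}"
  shows "h \<in> borel_measurable borel"
  using assms
  by (rule borel_measurable_continuous_countable_exceptions)
     (auto intro: continuous_at_imp_continuous_on)

lemma AE_lebesgue_countable: "countable X \<Longrightarrow> AE x in lebesgue. x \<notin> (X :: real set)"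
  by (intro AE_completion AE_not_in countable_imp_null_set_lborel)

context lagrangian
begin

section \<open>Constancy of v in time and the lower bound for \<eta>\<close>

abbreviation U :: "real \<Rightarrow> real \<Rightarrow> real" where "U x t \<equiv> G (S x t)"

lemma U_meas: "half_plane_measurable U"
  by (rule ES_meas[OF G_cont S_meas S_in_J])

lemma \<sigma>0_borel: "\<sigma>0 \<in> borel_measurable borel"
  by (intro countable_discontinuities_borel bounded_total_variation_countable_discontinuities \<sigma>0_BV)

lemma \<sigma>0_bounds: "\<alpha> \<le> \<sigma>0 x" "\<sigma>0 x \<le> \<beta>" "\<bar>\<sigma>0 x\<bar> \<le> \<beta>"
  using spec[OF \<sigma>0_range, of x] \<alpha>_pos by (auto simp: J_eq)

lemma \<sigma>0_integrable: "set_integrable lebesgue {c..d} \<sigma>0"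
  by (rule bounded_borel_set_integrable[OF measurable_completion \<sigma>0_bounds(3)]) (simp add: \<sigma>0_borel)

text \<open>The weak formulation is a single vector-valued integral. Its second component, where the
  flux is 0, can be read off once both components are known to be integrable.\<close>

lemma v_weak:
  assumes "test_function \<psi>"
  shows "(LINT (x, t):half_plane|lebesgue. v x t * deriv (\<lambda>s. \<psi> x s) t) = 0"
proof -
  note C1 = test_function_imp_C1[OF assms]
  obtain c d p q B where box: "test_box \<psi> c d p q B" by (rule C1_test_function_bounds[OF C1])
  note B = test_boxD[OF box]
  obtain BG where BG: "0 \<le> BG" "\<And>s. s \<in> J \<Longrightarrow> \<bar>G s\<bar> \<le> BG" by (rule J_bounded[OF G_cont], rule that)
  have "Ck_on 1 UNIV (\<lambda>(x, t). \<psi> x t)" using C1 by (simp add: C1_test_function_def)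
  note der = has_derivative_of_C1[OF this]
  have tm: "half_plane_measurable (\<lambda>x t. deriv (\<lambda>s. \<psi> x s) t)" and xm: "half_plane_measurable (\<lambda>x t. deriv (\<lambda>y. \<psi> y t) x)"
    by (intro half_plane_measurable_continuous continuous_on_subset[OF der(3)] continuous_on_subset[OF der(2)]; simp)+
  define F1 where "F1 x t = deriv (\<lambda>s. \<psi> x s) t * \<eta> x t - deriv (\<lambda>y. \<psi> y t) x * U x t" for x t
  define F2 where "F2 x t = v x t * deriv (\<lambda>s. \<psi> x s) t" for x t
  have i1: "set_integrable lebesgue half_plane (\<lambda>(x, t). F1 x t)"
  proof (rule half_plane_Fubini(1))
    show "half_plane_measurable F1"
      unfolding F1_def[abs_def] by (intro half_plane_measurable_diff half_plane_measurable_mult tm xm \<eta>_meas U_meas)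
    show "\<bar>F1 x t\<bar> \<le> B * M + B * BG" if "x \<in> {c..d}" "t \<in> {p..q}" for x t
    proof -
      have t: "0 \<le> t" using that B(1) by simp
      have "\<bar>deriv (\<lambda>s. \<psi> x s) t * \<eta> x t\<bar> \<le> B * M"
        unfolding abs_mult using \<eta>_pos[OF t, of x] \<eta>_le[OF t, of x] B by (intro mult_mono) auto
      moreover have "\<bar>deriv (\<lambda>y. \<psi> y t) x * U x t\<bar> \<le> B * BG"
        unfolding abs_mult using BG(2)[OF S_in_J[OF t]] B by (intro mult_mono) auto
      ultimately show ?thesis by (simp add: F1_def)
    qed
  qed (use B in \<open>auto simp: F1_def\<close>)
  have i2: "set_integrable lebesgue half_plane (\<lambda>(x, t). F2 x t)"
  proof (rule half_plane_Fubini(1))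
    show "half_plane_measurable F2"
      unfolding F2_def[abs_def] by (intro half_plane_measurable_mult tm v_meas)
    show "\<bar>F2 x t\<bar> \<le> M * B" if "x \<in> {c..d}" "t \<in> {p..q}" for x t
      unfolding F2_def abs_mult using that v_le[of t x] B by (intro mult_mono) auto
  qed (use B in \<open>auto simp: F2_def\<close>)
  let ?F1 = "\<lambda>z. indicat_real half_plane z *\<^sub>R (\<lambda>(x, t). F1 x t) z"
  let ?F2 = "\<lambda>z. indicat_real half_plane z *\<^sub>R (\<lambda>(x, t). F2 x t) z"
  have "(LINT z|lebesgue. ?F1 z *\<^sub>R (1::real, 0::real) + ?F2 z *\<^sub>R (0, 1)) = 0"
  proof -
    have "(LINT (x, t):UNIV \<times> {0<..}|lebesgue.
         deriv (\<lambda>s. \<psi> x s) t *\<^sub>R (\<eta> x t, v x t) + deriv (\<lambda>y. \<psi> y t) x *\<^sub>R system_flux G (\<eta> x t, v x t)) = 0"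
      using weak assms by (simp add: weak_solution_def)
    then show ?thesis
      unfolding set_lebesgue_integral_def
      by (rule back_subst[of "\<lambda>I. I = 0"], intro Bochner_Integration.integral_cong)
         (auto simp: F1_def F2_def system_flux_def indicator_def zero_prod_def)
  qed
  moreover have "(LINT z|lebesgue. ?F1 z *\<^sub>R (1::real, 0::real) + ?F2 z *\<^sub>R (0, 1)) =
      (LINT z|lebesgue. ?F1 z) *\<^sub>R (1, 0) + (LINT z|lebesgue. ?F2 z) *\<^sub>R (0, 1)"
    using i1 i2 unfolding set_integrable_def
    by (subst Bochner_Integration.integral_add) (auto simp del: real_scaleR_def scaleR_Pair)
  ultimately have "(LINT z|lebesgue. ?F2 z) = 0" by (simp add: zero_prod_def)
  then show ?thesis by (simp add: set_lebesgue_integral_def F2_def)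
qed

lemma half_plane_bounded_simple:
  fixes h :: "real \<Rightarrow> real \<Rightarrow> real"
  assumes "\<And>x t. 0 \<le> t \<Longrightarrow> \<bar>h x t\<bar> \<le> B"
  shows "\<exists>B. \<forall>x\<in>{c..d}. \<forall>t\<in>{p..q}. 0 < t \<longrightarrow> \<bar>h x t\<bar> \<le> B"
  by (intro exI[of _ B] ballI impI assms less_imp_le)

lemma L1loc_integral_continuous_Ici:
  assumes "L1loc_continuous_on {0..} w" "continuous_on UNIV p"
  shows "continuous_on {0<..} (\<lambda>t. LINT x:{c..d}|lebesgue. w x t * p x :: real)"
  by (rule continuous_on_subset[OF L1loc_integral_continuous[OF assms]]) auto

text \<open>The weak time derivative of v is 0, so the integral of v over a fixed interval is the
  same for all t > 0; continuity in L1 down to t = 0 identifies it with that of \<sigma>0.\<close>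

lemma v_integral_eq:
  assumes "0 < t" "c \<le> d"
  shows "(LINT x:{c..d}|lebesgue. v x t - \<sigma>0 x) = 0"
proof -
  let ?I = "\<lambda>t. LINT x:{c..d}|lebesgue. v x t"
  have ct: "continuous_on {0<..} (\<lambda>t. LINT x:{c..d}|lebesgue. v x t)" for c d
    using L1loc_integral_continuous_Ici[OF v_L1loc continuous_on_const[of _ 1]] by simp
  have "?I t2 - ?I t1 = 0" if "0 < t1" "t1 \<le> t2" for t1 t2
  proof -
    have "?I t2 - ?I t1 = (LINT t:{t1..t2}|lebesgue. LINT x:{c..d}|lebesgue. 0)"
    proof (rule weak_time_derivative)
      show "half_plane_measurable (\<lambda>x t. 0)" by (intro half_plane_measurable_fst) simp
      show "\<exists>B. \<forall>x\<in>{c..d}. \<forall>t\<in>{p..q}. 0 < t \<longrightarrow> \<bar>v x t\<bar> \<le> B" for c d p q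
        by (rule half_plane_bounded_simple[OF v_le])
      show "(LINT (x, t):half_plane|lebesgue. v x t * deriv (\<lambda>s. \<psi> x s) t) =
          - (LINT (x, t):half_plane|lebesgue. 0 * \<psi> x t)" if "test_function \<psi>" for \<psi>
        using v_weak[OF that] by (simp add: set_lebesgue_integral_def case_prod_unfold)
    qed (use v_meas ct that assms(2) in \<open>auto simp: set_lebesgue_integral_def\<close>)
    then show ?thesis by (simp add: set_lebesgue_integral_def)
  qed
  then have const: "?I s = ?I t" if "0 < s" for s
    using that assms(1) by (metis eq_iff_diff_eq_0 linorder_le_cases)
  have "continuous_on {0..} ?I" using L1loc_integral_continuous[OF v_L1loc continuous_on_const[of _ 1]] by simp
  then have "(?I \<longlongrightarrow> ?I 0) (at 0 within {0..})" by (simp add: continuous_on_def)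
  then have "(?I \<longlongrightarrow> ?I 0) (at_right 0)" by (rule tendsto_within_subset) auto
  moreover have "(?I \<longlongrightarrow> ?I t) (at_right 0)"
    by (rule tendsto_eventually) (use const in \<open>auto simp: eventually_at_filter\<close>)
  ultimately have "?I t = ?I 0" using tendsto_unique[OF trivial_limit_at_right_real] by blast
  also have "?I 0 = (LINT x:{c..d}|lebesgue. \<sigma>0 x)"
    unfolding set_lebesgue_integral_def
    by (rule integral_lebesgue_cong_AE) (use initial in \<open>auto elim: eventually_mono\<close>)
  finally show ?thesis
    using L1loc_integrable[OF v_L1loc] \<sigma>0_integrable assms by (simp add: set_integral_diff)
qed

text \<open>Off this set the space averages of \<eta>, v and \<sigma>0 converge to the point values.
  For t > 0 bounded variation makes it countable, hence null.\<close>

definition D :: "real \<Rightarrow> real set" where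
  "D t = {x. \<not> isCont (\<lambda>x. \<eta> x t) x} \<union> {x. \<not> isCont (\<lambda>x. v x t) x} \<union> {x. \<not> isCont \<sigma>0 x}"

lemma D_countable: "0 < t \<Longrightarrow> countable (D t)"
  using solution_BV \<sigma>0_BV unfolding D_def in_C_BV2_def
  by (auto intro!: bounded_total_variation_countable_discontinuities)

lemma AE_D: "0 < t \<Longrightarrow> AE x in lebesgue. x \<notin> D t"
  by (intro AE_lebesgue_countable D_countable)

text \<open>The averages of v - \<sigma>0 over intervals to the right of x are all 0, and they
  converge to the value at x.\<close>

lemma v_eq_off_D:
  assumes "0 < t" "x \<notin> D t"
  shows "v x t = \<sigma>0 x"
proof -
  have "(\<lambda>n. (LINT y:{x..x + inverse (real (Suc n))}|lebesgue. v y t - \<sigma>0 y) / inverse (real (Suc n))) \<longlonglongrightarrow> v x t - \<sigma>0 x"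
    using assms L1loc_integrable[OF v_L1loc] \<sigma>0_integrable
    by (intro average_tendsto set_integral_diff(1))
       (auto intro!: LIMSEQ_inverse_real_of_nat isCont_diff simp: D_def simp del: of_nat_Suc)
  then show ?thesis using v_integral_eq[OF assms(1)] by (simp add: LIMSEQ_const_iff)
qed

lemma v_eq: "0 \<le> t \<Longrightarrow> AE x in lebesgue. v x t = \<sigma>0 x"
proof (cases "t = 0")
  case False
  assume "0 \<le> t"
  then have "0 < t" using False by simp
  from AE_D[OF this] show ?thesis by eventually_elim (rule v_eq_off_D[OF \<open>0 < t\<close>])
qed (use initial in \<open>auto elim: eventually_mono\<close>)

lemma \<eta>_ge: "0 \<le> t \<Longrightarrow> AE x in lebesgue. \<delta> \<le> \<eta> x t"
proof -
  assume t: "0 \<le> t"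
  from v_eq[OF t] show ?thesis
  proof eventually_elim
    fix x assume "v x t = \<sigma>0 x"
    then have "\<alpha> \<le> v x t" using \<sigma>0_bounds(1)[of x] by simp
    also have "v x t \<le> \<beta> * \<eta> x t"
      using S_in_J[OF t, of x] \<eta>_pos[OF t, of x] by (simp add: J_eq pos_divide_le_eq)
    finally show "\<delta> \<le> \<eta> x t" using \<alpha>_pos \<alpha>_le_\<beta> by (simp add: \<delta>_def pos_divide_le_eq mult.commute)
  qed
qed

lemma ES_integrable:
  assumes t: "0 \<le> t" and E: "continuous_on J E" and C: "compact C"
  shows "set_integrable lebesgue C (\<lambda>x. E (S x t) :: real)"
proof -
  obtain B where B: "0 \<le> B" "\<And>s. s \<in> J \<Longrightarrow> \<bar>E s\<bar> \<le> B" by (rule J_bounded[OF E], rule that)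
  let ?i = "indicat_real C"
  have [measurable]: "?i \<in> borel_measurable lebesgue"
    using compact_imp_closed[OF C] by (intro borel_measurable_indicator) simp
  have [measurable]: "(\<lambda>x. ?i x * v x t) \<in> borel_measurable lebesgue" "(\<lambda>x. ?i x * \<eta> x t) \<in> borel_measurable lebesgue"
    using \<eta>_L1loc v_L1loc C t by (auto simp: L1loc_continuous_on_def set_integrable_def dest!: spec[of _ C] bspec[of _ _ t])
  have [measurable]: "(\<lambda>s. E (max \<alpha> (min \<beta> s))) \<in> borel_measurable borel"
    by (intro borel_measurable_continuous_onI clamp_continuous E)
  \<comment> \<open>Measurability of the sections is available after multiplication by the indicator
    of C. Outside C the quotient is 0 / 0 = 0, and the outer indicator removes the value of E
    there.\<close>
  have "(\<lambda>x. ?i x * E (max \<alpha> (min \<beta> ((?i x * v x t) / (?i x * \<eta> x t))))) \<in> borel_measurable lebesgue"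
    by measurable
  also have "(\<lambda>x. ?i x * E (max \<alpha> (min \<beta> ((?i x * v x t) / (?i x * \<eta> x t))))) = (\<lambda>x. ?i x * E (S x t))"
    using clamp_eq[OF S_in_J[OF t]] by (auto simp: indicator_def)
  finally have m: "(\<lambda>x. ?i x * E (S x t)) \<in> borel_measurable lebesgue" .
  show ?thesis
  proof (rule set_integrable_bound[where f="\<lambda>x. B"])
    show "set_integrable lebesgue C (\<lambda>x. B)" by (simp add: absolutely_integrable_on_const lmeasurable_compact C)
    show "set_borel_measurable lebesgue C (\<lambda>x. E (S x t))" using m by (simp add: set_borel_measurable_def)
    show "AE x in lebesgue. x \<in> C \<longrightarrow> norm (E (S x t)) \<le> norm B"
      using B S_in_J[OF t] by (intro AE_I2) auto
  qed
qed

text \<open>The difference of the quotients at times t and s is ((v_t - v_s) - S_s (\<eta>_t -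
  \<eta>_s)) / \<eta>_t. In this form the lower bound \<delta> enters at one time only, and S_s <=
  \<beta> yields the factor (1 + \<beta>) / \<delta>.\<close>

lemma S_L1loc: "L1loc_continuous_on {0..} S"
proof (rule L1loc_continuous_on_dominated[OF system_L1loc])
  show "set_integrable lebesgue C (\<lambda>x. S x t)" if "t \<in> {0..}" "compact C" for t C
    using ES_integrable[of t "\<lambda>s. s" C] that by simp
  fix s t :: real assume st: "s \<in> {0..}" "t \<in> {0..}"
  then have "AE x in lebesgue. \<delta> \<le> \<eta> x t" by (intro \<eta>_ge) simp
  then show "AE x in lebesgue. \<bar>S x t - S x s\<bar> \<le> (1 + \<beta>) / \<delta> * norm ((\<eta> x t, v x t) - (\<eta> x s, v x s))"
  proof eventually_elim
    fix x assume \<delta>: "\<delta> \<le> \<eta> x t"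
    let ?N = "norm ((\<eta> x t, v x t) - (\<eta> x s, v x s))"
    have n: "\<bar>\<eta> x t - \<eta> x s\<bar> \<le> ?N" "\<bar>v x t - v x s\<bar> \<le> ?N"
      using norm_fst_le[of "\<eta> x t - \<eta> x s" "v x t - v x s"] norm_snd_le[of "v x t - v x s" "\<eta> x t - \<eta> x s"] by simp_all
    have "\<eta> x s > 0" "\<eta> x t > 0" and S: "0 \<le> S x s" "S x s \<le> \<beta>"
      using st \<eta>_pos[of s x] \<eta>_pos[of t x] S_in_J[of s x] \<alpha>_pos by (auto simp: J_eq)
    then have "S x t - S x s = ((v x t - v x s) - S x s * (\<eta> x t - \<eta> x s)) / \<eta> x t"
      by (simp add: field_simps)
    also have "\<bar>\<dots>\<bar> \<le> (?N + \<beta> * ?N) / \<delta>"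
      unfolding abs_divide
    proof (rule frac_le)
      have "\<bar>S x s * (\<eta> x t - \<eta> x s)\<bar> \<le> \<beta> * ?N" unfolding abs_mult using S n by (intro mult_mono) auto
      then show "\<bar>(v x t - v x s) - S x s * (\<eta> x t - \<eta> x s)\<bar> \<le> ?N + \<beta> * ?N" using n(2) by linarith
      show "0 \<le> ?N + \<beta> * ?N" using \<alpha>_pos \<alpha>_le_\<beta> by simp
    qed (use \<delta> \<delta>_pos in auto)
    finally show "\<bar>S x t - S x s\<bar> \<le> (1 + \<beta>) / \<delta> * ?N" by (simp add: algebra_simps)
  qed
qed

lemma U_L1loc: "L1loc_continuous_on {0..} U"
proof -
  obtain C where "\<And>s r. s \<in> J \<Longrightarrow> r \<in> J \<Longrightarrow> \<bar>G s - G r\<bar> \<le> C * \<bar>s - r\<bar>" by (rule G_Lipschitz, rule that)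
  then show ?thesis
    using S_in_J ES_integrable[OF _ G_cont]
    by (intro L1loc_continuous_on_dominated[OF S_L1loc, of _ C]) auto
qed

section \<open>Increments of \<gamma> in space and in time\<close>

lemma \<gamma>_cont: "continuous_on (UNIV \<times> {0..}) (\<lambda>(x, t). \<gamma> x t)" and \<gamma>_0: "\<gamma> x 0 = x"
  and \<gamma>_weak: "test_function \<psi> \<Longrightarrow> (LINT (x, t):half_plane|lebesgue. \<gamma> x t * deriv (\<lambda>y. \<psi> y t) x) =
          - (LINT (x, t):half_plane|lebesgue. \<eta> x t * \<psi> x t)"
    "test_function \<psi> \<Longrightarrow> (LINT (x, t):half_plane|lebesgue. \<gamma> x t * deriv (\<lambda>s. \<psi> x s) t) =
          - (LINT (x, t):half_plane|lebesgue. U x t * \<psi> x t)"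
  using \<gamma> by (auto simp: lagrangian_map_def)

lemma \<gamma>_x_cont: "0 \<le> t \<Longrightarrow> continuous_on A (\<lambda>x. \<gamma> x t)"
proof -
  assume "0 \<le> t"
  then have "continuous_on A (\<lambda>x. case (x, t) of (x, t) \<Rightarrow> \<gamma> x t)"
    by (intro continuous_on_compose2[OF \<gamma>_cont]) (auto intro!: continuous_intros)
  then show ?thesis by simp
qed

lemma \<gamma>_integral_cont:
  assumes "continuous_on UNIV p"
  shows "continuous_on {0<..} (\<lambda>t. LINT x:{c..d}|lebesgue. \<gamma> x t * p x)"
proof -
  have "continuous_on {0<..} (\<lambda>t. integral (cbox c d) (\<lambda>x. \<gamma> x t * p x))"
  proof (rule integral_continuous_on_param)
    show "continuous_on ({0<..} \<times> cbox c d) (\<lambda>(t, x). \<gamma> x t * p x)"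
      unfolding case_prod_unfold
      by (intro continuous_on_mult continuous_on_compose2[OF \<gamma>_cont, of _ "\<lambda>z. (snd z, fst z)", simplified]
          continuous_on_compose2[OF assms, of _ snd]) (auto intro!: continuous_intros)
  qed
  moreover have "integral (cbox c d) (\<lambda>x. \<gamma> x t * p x) = (LINT x:{c..d}|lebesgue. \<gamma> x t * p x)" if "t \<in> {0<..}" for t
    using that assms
    by (subst set_lebesgue_integral_eq_integral(2))
       (auto intro!: absolutely_integrable_continuous_real continuous_on_mult \<gamma>_x_cont continuous_on_subset[OF assms])
  ultimately show ?thesis by (rule continuous_on_eq)
qed

lemma \<gamma>_bounded: "\<exists>B. \<forall>x\<in>{c..d}. \<forall>t\<in>{p..q}. 0 < t \<longrightarrow> \<bar>\<gamma> x t\<bar> \<le> B"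
proof -
  have "compact ({c..d} \<times> {max 0 p..q})" by (intro compact_Times) auto
  then have "bounded ((\<lambda>(x, t). \<gamma> x t) ` ({c..d} \<times> {max 0 p..q}))"
    by (intro compact_imp_bounded compact_continuous_image continuous_on_subset[OF \<gamma>_cont]) auto
  then obtain B where B: "\<forall>z\<in>{c..d} \<times> {max 0 p..q}. \<bar>case z of (x, t) \<Rightarrow> \<gamma> x t\<bar> \<le> B"
    by (auto simp: bounded_iff)
  show ?thesis using B by (intro exI[of _ B]) force
qed

lemma \<gamma>_meas: "half_plane_measurable \<gamma>"
  by (rule half_plane_measurable_continuous[OF \<gamma>_cont])

text \<open>For t > 0 this is the weak space derivative. At t = 0 both sides are explicit, as
  \<gamma>(x,0) = x and \<eta>(.,0) = 1 almost everywhere.\<close>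

lemma \<gamma>_diff:
  assumes "0 \<le> t" "c \<le> d"
  shows "\<gamma> d t - \<gamma> c t = (LINT x:{c..d}|lebesgue. \<eta> x t)"
proof (cases "t = 0")
  case True
  have "(LINT x:{c..d}|lebesgue. \<eta> x 0) = (LINT x:{c..d}|lebesgue. 1)"
    unfolding set_lebesgue_integral_def
    by (rule integral_lebesgue_cong_AE) (use initial in \<open>auto elim: eventually_mono\<close>)
  also have "\<dots> = d - c" using assms(2) by (simp add: set_lebesgue_integral_def)
  finally show ?thesis by (simp add: True \<gamma>_0)
next
  case False
  show ?thesis
  proof (rule weak_space_derivative[of \<gamma> \<eta>])
    show "\<exists>B. \<forall>x\<in>{c..d}. \<forall>t\<in>{p..q}. 0 < t \<longrightarrow> \<bar>\<eta> x t\<bar> \<le> B" for c d p q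
      using \<eta>_pos \<eta>_le by (intro half_plane_bounded_simple[of _ M]) (auto simp: abs_of_pos)
    show "continuous_on {0<..} (\<lambda>t. LINT x:{c..d}|lebesgue. \<eta> x t * p x)" if "continuous_on UNIV p" for c d p
      by (rule L1loc_integral_continuous_Ici[OF \<eta>_L1loc that])
    show "set_integrable lebesgue {c..d} (\<lambda>x. \<eta> x t)" if "0 < t" for c d t
      using that by (intro L1loc_integrable[OF \<eta>_L1loc]) simp
  qed (use assms False \<gamma>_meas \<eta>_meas \<gamma>_bounded \<gamma>_integral_cont \<gamma>_x_cont \<gamma>_weak in auto)
qed

lemma \<gamma>_time_integral:
  assumes "0 < t1" "t1 \<le> t2" "c \<le> d"
  shows "(LINT x:{c..d}|lebesgue. \<gamma> x t2) - (LINT x:{c..d}|lebesgue. \<gamma> x t1) =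
    (LINT t:{t1..t2}|lebesgue. LINT x:{c..d}|lebesgue. U x t)"
proof (rule weak_time_derivative[of \<gamma> U])
  obtain BG where BG: "0 \<le> BG" "\<And>s. s \<in> J \<Longrightarrow> \<bar>G s\<bar> \<le> BG" by (rule J_bounded[OF G_cont], rule that)
  show "\<exists>B. \<forall>x\<in>{c..d}. \<forall>t\<in>{p..q}. 0 < t \<longrightarrow> \<bar>U x t\<bar> \<le> B" for c d p q
    using BG(2) S_in_J by (intro half_plane_bounded_simple[of _ BG]) auto
  show "continuous_on {0<..} (\<lambda>t. LINT x:{c..d}|lebesgue. U x t)" for c d
    using L1loc_integral_continuous_Ici[OF U_L1loc continuous_on_const[of _ 1]] by simp
  show "continuous_on {0<..} (\<lambda>t. LINT x:{c..d}|lebesgue. \<gamma> x t)" for c d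
    using \<gamma>_integral_cont[OF continuous_on_const[of _ 1]] by simp
qed (use assms \<gamma>_meas U_meas \<gamma>_bounded \<gamma>_weak in auto)

end

lemma set_integrable_lebesgue_lborel:
  fixes h :: "real \<Rightarrow> real"
  assumes "h \<in> borel_measurable borel"
  shows "set_integrable lebesgue {c..d} h \<longleftrightarrow> set_integrable lborel {c..d} h"
    "(LINT x:{c..d}|lebesgue. h x) = (LINT x:{c..d}|lborel. h x)"
  using assms unfolding set_integrable_def set_lebesgue_integral_def
  by (auto intro!: integrable_completion integral_completion)

context lagrangian
begin

section \<open>Bi-Lipschitz bounds and the inverse of \<gamma>(.,t)\<close>

lemma \<eta>_integrable: "0 \<le> t \<Longrightarrow> set_integrable lebesgue {c..d} (\<lambda>x. \<eta> x t)"
  by (intro L1loc_integrable[OF \<eta>_L1loc]) simp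

text \<open>Integration of \<delta> <= \<eta> <= M. The constants do not depend on t; strict
  monotonicity, surjectivity and all estimates for the inverse come from here.\<close>

lemma \<gamma>_bounds:
  assumes t: "0 \<le> t" and cd: "c \<le> d"
  shows "\<delta> * (d - c) \<le> \<gamma> d t - \<gamma> c t" "\<gamma> d t - \<gamma> c t \<le> M * (d - c)"
proof -
  have const: "(LINT x:{c..d}|lebesgue. k) = k * (d - c)" "set_integrable lebesgue {c..d} (\<lambda>x. k)" for k :: real
    using cd by (simp_all add: set_lebesgue_integral_def set_integrable_def)
  have "(LINT x:{c..d}|lebesgue. \<delta>) \<le> (LINT x:{c..d}|lebesgue. \<eta> x t)"
    using \<eta>_ge[OF t] by (intro set_integral_mono_AE const \<eta>_integrable t) (auto elim: eventually_mono)
  then show "\<delta> * (d - c) \<le> \<gamma> d t - \<gamma> c t" by (simp add: \<gamma>_diff[OF t cd] const)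
  have "(LINT x:{c..d}|lebesgue. \<eta> x t) \<le> (LINT x:{c..d}|lebesgue. M)"
    using \<eta>_le[OF t] by (intro set_integral_mono const \<eta>_integrable t)
  then show "\<gamma> d t - \<gamma> c t \<le> M * (d - c)" by (simp add: \<gamma>_diff[OF t cd] const)
qed

lemma \<gamma>_dist:
  assumes "0 \<le> t"
  shows "\<delta> * \<bar>x - y\<bar> \<le> \<bar>\<gamma> x t - \<gamma> y t\<bar>"
  using \<gamma>_bounds(1)[OF assms, of x y] \<gamma>_bounds(1)[OF assms, of y x] by (cases "x \<le> y") auto

lemma \<gamma>_strict: "0 \<le> t \<Longrightarrow> strict_mono (\<lambda>x. \<gamma> x t)"
proof (rule strict_monoI)
  fix x y :: real assume "0 \<le> t" "x < y"
  then have "0 < \<delta> * (y - x)" using \<delta>_pos by simp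
  then show "\<gamma> x t < \<gamma> y t" using \<gamma>_bounds(1)[OF \<open>0 \<le> t\<close>, of x y] \<open>x < y\<close> by simp
qed

lemma \<gamma>_surj:
  assumes t: "0 \<le> t"
  shows "surj (\<lambda>x. \<gamma> x t)"
proof -
  have "\<exists>x. \<gamma> x t = y" for y
  proof -
  \<comment> \<open>By the lower slope bound, moving a distance r to either side of 0 changes
    \<gamma>(.,t) by at least |y - \<gamma>(0,t)|, so y lies between the two values.\<close>
  define r where "r = \<bar>y - \<gamma> 0 t\<bar> / \<delta>"
  have r: "0 \<le> r" "\<delta> * r = \<bar>y - \<gamma> 0 t\<bar>" using \<delta>_pos by (simp_all add: r_def)
  have "\<gamma> (- r) t \<le> y" "y \<le> \<gamma> r t"
    using \<gamma>_bounds(1)[OF t, of 0 r] \<gamma>_bounds(1)[OF t, of "-r" 0] r by auto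
  then show ?thesis
    using IVT'[of "\<lambda>x. \<gamma> x t" "-r" y r] \<gamma>_x_cont[OF t] r(1) by auto
  qed
  then show ?thesis unfolding surj_def by metis
qed

abbreviation \<Gamma> :: "real \<Rightarrow> real \<Rightarrow> real" where "\<Gamma> x t \<equiv> inv (\<lambda>y. \<gamma> y t) x"

lemma \<gamma>_\<Gamma>: "0 \<le> t \<Longrightarrow> \<gamma> (\<Gamma> x t) t = x"
  using surj_f_inv_f[OF \<gamma>_surj, of t x] by simp

lemma \<Gamma>_\<gamma>: "0 \<le> t \<Longrightarrow> \<Gamma> (\<gamma> x t) t = x"
  using inv_f_f[OF strict_mono_imp_inj_on[OF \<gamma>_strict], of t x] by simp

lemma \<Gamma>_0: "\<Gamma> x 0 = x"
  using \<Gamma>_\<gamma>[of 0 x] \<gamma>_0 by simp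

text \<open>Comparison with an arbitrary point y instead of a second value of the inverse: y can be
  held fixed while x and t vary, which gives joint continuity at once.\<close>

lemma \<Gamma>_dist: "0 \<le> t \<Longrightarrow> \<bar>\<Gamma> x t - y\<bar> \<le> \<bar>x - \<gamma> y t\<bar> / \<delta>"
  using \<gamma>_dist[of t "\<Gamma> x t" y] \<delta>_pos by (simp add: \<gamma>_\<Gamma> pos_le_divide_eq mult.commute)

lemma \<Gamma>_cont: "continuous_on (UNIV \<times> {0..}) (\<lambda>(x, t). \<Gamma> x t)"
  unfolding continuous_on_def
proof
  fix z :: "real \<times> real" assume z: "z \<in> UNIV \<times> {0..}"
  obtain x0 t0 where z_eq: "z = (x0, t0)" by force
  have t0: "0 \<le> t0" using z z_eq by simp
  define y0 where "y0 = \<Gamma> x0 t0"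
  have "continuous_on (UNIV \<times> {0..}) (\<lambda>w. \<bar>fst w - \<gamma> y0 (snd w)\<bar> / \<delta>)"
    using \<delta>_pos
    by (intro continuous_intros continuous_on_compose2[OF \<gamma>_cont, of _ "\<lambda>w. (y0, snd w)", simplified]) auto
  then have "((\<lambda>w. \<bar>fst w - \<gamma> y0 (snd w)\<bar> / \<delta>) \<longlongrightarrow> \<bar>x0 - \<gamma> y0 t0\<bar> / \<delta>) (at z within UNIV \<times> {0..})"
    using z by (auto simp: continuous_on_def z_eq)
  then have "((\<lambda>w. \<bar>fst w - \<gamma> y0 (snd w)\<bar> / \<delta>) \<longlongrightarrow> 0) (at z within UNIV \<times> {0..})"
    using \<gamma>_\<Gamma>[OF t0] by (simp add: y0_def)
  then have "((\<lambda>w. (case w of (x, t) \<Rightarrow> \<Gamma> x t) - y0) \<longlongrightarrow> 0) (at z within UNIV \<times> {0..})"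
    by (rule Lim_null_comparison[rotated]) (use \<Gamma>_dist in \<open>auto simp: eventually_at_filter intro!: always_eventually\<close>)
  then show "((\<lambda>(x, t). \<Gamma> x t) \<longlongrightarrow> (case z of (x, t) \<Rightarrow> \<Gamma> x t)) (at z within UNIV \<times> {0..})"
    using LIM_zero_cancel by (fastforce simp: z_eq y0_def)
qed

section \<open>Measurability of \<sigma> and its continuity in time\<close>

lemma \<sigma>_eq: "\<sigma> x t = S (\<Gamma> x t) t" by (simp add: \<sigma>_def)

lemma \<sigma>_in_J: "0 \<le> t \<Longrightarrow> \<sigma> x t \<in> J" unfolding \<sigma>_eq by (rule S_in_J)

lemma \<sigma>_bound: "0 \<le> t \<Longrightarrow> \<bar>\<sigma> x t\<bar> \<le> \<beta>" and S_bound: "0 \<le> t \<Longrightarrow> \<bar>S x t\<bar> \<le> \<beta>"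
  using \<sigma>_in_J[of t x] S_in_J[of t x] \<alpha>_pos by (auto simp: J_eq)

lemma borel_sections:
  assumes "0 < t"
  shows "(\<lambda>x. \<eta> x t) \<in> borel_measurable borel" "(\<lambda>x. v x t) \<in> borel_measurable borel"
    "(\<lambda>x. S x t) \<in> borel_measurable borel"
proof -
  show *: "(\<lambda>x. \<eta> x t) \<in> borel_measurable borel" "(\<lambda>x. v x t) \<in> borel_measurable borel"
    using solution_BV assms unfolding in_C_BV2_def
    by (auto intro!: countable_discontinuities_borel bounded_total_variation_countable_discontinuities)
  show "(\<lambda>x. S x t) \<in> borel_measurable borel" by (intro borel_measurable_divide *)
qed

text \<open>For t > 0 the sections are Borel by bounded variation, so the integrals can be moved
  from the completed measure to the Borel measure of the locale.\<close>

lemma increasing_primitive: "0 < t \<Longrightarrow> increasing_primitive (\<lambda>x. \<gamma> x t) (\<lambda>x. \<eta> x t)"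
proof
  assume t: "0 < t"
  show "strict_mono (\<lambda>x. \<gamma> x t)" "surj (\<lambda>x. \<gamma> x t)" "(\<lambda>x. \<eta> x t) \<in> borel_measurable borel"
    using t by (simp_all add: \<gamma>_strict \<gamma>_surj borel_sections)
  show "0 \<le> \<eta> x t" for x using \<eta>_pos[of t x] t by simp
  show "set_integrable lborel {c..d} (\<lambda>x. \<eta> x t)" for c d
    using \<eta>_integrable[of t c d] set_integrable_lebesgue_lborel(1)[OF borel_sections(1)[OF t]] t by simp
  show "\<gamma> d t - \<gamma> c t = (LINT x:{c..d}|lborel. \<eta> x t)" if "c \<le> d" for c d
    using \<gamma>_diff[of t c d] set_integrable_lebesgue_lborel(2)[OF borel_sections(1)[OF t]] t that by simp
qed

lemma \<Gamma>_borel: "0 < t \<Longrightarrow> (\<lambda>x. \<Gamma> x t) \<in> borel_measurable borel"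
  using increasing_primitive.inv_T_borel[OF increasing_primitive] .

lemma \<sigma>_borel: "0 < t \<Longrightarrow> (\<lambda>x. \<sigma> x t) \<in> borel_measurable borel"
  unfolding \<sigma>_eq by (rule measurable_compose[OF \<Gamma>_borel borel_sections(3)])

lemma \<sigma>_initial: "AE x in lebesgue. \<sigma> x 0 = \<sigma>0 x"
  using initial by eventually_elim (simp add: \<sigma>_eq \<Gamma>_0)

lemma \<sigma>_section_measurable: "0 \<le> t \<Longrightarrow> (\<lambda>x. \<sigma> x t) \<in> borel_measurable lebesgue"
proof (cases "t = 0")
  case True
  have "\<sigma>0 \<in> borel_measurable lebesgue" by (rule measurable_completion) (simp add: \<sigma>0_borel)
  then show ?thesis unfolding True
    by (rule borel_measurable_lebesgue_AE) (use \<sigma>_initial in \<open>auto elim: eventually_mono\<close>)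
next
  case False
  assume "0 \<le> t"
  then show ?thesis using False by (intro measurable_completion) (simp add: \<sigma>_borel)
qed

lemma \<sigma>_meas: "half_plane_measurable \<sigma>"
  \<comment> \<open>A Lebesgue measurable function composed with a homeomorphism need not be measurable. Here the
    inverse of \<open>(y,t) \<mapsto> (\<gamma>(y,t),t)\<close> pulls null sets back to null sets, so a Borel
    representative of \<open>v/\<eta>\<close> can be used.\<close>
proof -
  let ?C = "UNIV \<times> {0..} :: (real \<times> real) set"
  have C: "?C \<in> sets borel" by (intro borel_closed closed_Times) auto
  have "(\<lambda>z. if z \<in> ?C then (\<lambda>(x, t). S x t) z else 0) \<in> borel_measurable lebesgue"
    by (rule borel_measurable_if_I[OF S_meas half_plane_in_lebesgue(1)])
  then obtain H where H: "H \<in> borel_measurable lborel"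
    "AE z in lborel. (if z \<in> ?C then (\<lambda>(x, t). S x t) z else 0) = H z"
    using completion_ex_borel_measurable_real by blast
  from H(2) obtain N where N: "N \<in> null_sets lborel"
    "{z. (if z \<in> ?C then (\<lambda>(x, t). S x t) z else 0) \<noteq> H z} \<subseteq> N"
    by (auto simp: eventually_ae_filter)
  define \<Psi> where "\<Psi> z = (if z \<in> ?C then ((\<lambda>(x, t). \<Gamma> x t) z, snd z) else z)" for z
  have \<Psi>: "\<Psi> \<in> borel_measurable borel"
    unfolding \<Psi>_def
    by (rule borel_measurable_continuous_on_if[OF C])
       (auto intro!: continuous_on_Pair \<Gamma>_cont continuous_on_snd continuous_on_id)
  have "AE z in lborel. z \<notin> N" using N(1) by (rule AE_not_in)
  then have sec: "AE t in lborel. AE x in lborel. (x, t) \<notin> N" by (rule AE_lborel_sections)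
  have aeN: "AE z in lebesgue. \<Psi> z \<notin> N"
  proof (rule AE_lebesgue_sections)
    have "\<Psi> -` N \<inter> space borel \<in> sets borel" using N(1) by (intro measurable_sets[OF \<Psi>]) auto
    then show "{z. \<not> \<Psi> z \<notin> N} \<in> sets lebesgue" by (auto simp: vimage_def)
    have "AE t in lborel. AE x in lebesgue. \<Psi> (x, t) \<notin> N"
      using sec AE_lborel_singleton[of 0]
    proof eventually_elim
      \<comment> \<open>The single time 0 is discarded. For t < 0 the map \<Psi> is the identity,
        for t > 0 it acts on x by the inverse of \<gamma>(.,t).\<close>
      fix t :: real assume t: "AE x in lborel. (x, t) \<notin> N" "t \<noteq> 0"
      have "AE x in lborel. \<Psi> (x, t) \<notin> N"
      proof (cases "0 < t")
        case True
        from increasing_primitive.AE_inv[OF increasing_primitive[OF True] t(1)]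
        show ?thesis using True by (simp add: \<Psi>_def)
      qed (use t in \<open>simp add: \<Psi>_def\<close>)
      then show "AE x in lebesgue. \<Psi> (x, t) \<notin> N" by (rule AE_completion)
    qed
    then show "AE t in lebesgue. AE x in lebesgue. \<Psi> (x, t) \<notin> N" by (rule AE_completion)
  qed
  have "(\<lambda>z. H (\<Psi> z)) \<in> borel_measurable borel"
    using H(1) by (intro measurable_compose[OF \<Psi>]) simp
  then have "(\<lambda>z. H (\<Psi> z)) \<in> borel_measurable lebesgue" by (intro measurable_completion) simp
  then have m: "(\<lambda>z. if z \<in> ?C then H (\<Psi> z) else 0) \<in> borel_measurable lebesgue"
    using half_plane_in_lebesgue(1) by (intro measurable_If_set) auto
  have "(\<lambda>z. if z \<in> ?C then (\<lambda>(x, t). \<sigma> x t) z else 0) \<in> borel_measurable lebesgue"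
  proof (rule borel_measurable_lebesgue_AE[OF m])
    show "AE z in lebesgue. (if z \<in> ?C then H (\<Psi> z) else 0) = (if z \<in> ?C then (\<lambda>(x, t). \<sigma> x t) z else 0)"
      using aeN
    proof eventually_elim
      fix z assume "\<Psi> z \<notin> N"
      then have "(if \<Psi> z \<in> ?C then (\<lambda>(x, t). S x t) (\<Psi> z) else 0) = H (\<Psi> z)" using N(2) by blast
      then show "(if z \<in> ?C then H (\<Psi> z) else 0) = (if z \<in> ?C then (\<lambda>(x, t). \<sigma> x t) z else 0)"
        by (cases z) (auto simp: \<Psi>_def \<sigma>_eq)
    qed
  qed
  then show ?thesis by (rule borel_measurable_if_D)
qed

text \<open>Substitution inserts the density \<eta>, which is at most M. L1 distances of functions
  composed with the inverse are thus controlled by the original distances.\<close>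

lemma substitution_le:
  assumes t: "0 < t" and h: "h \<in> borel_measurable borel" "\<And>y. 0 \<le> h y" "integrable lborel h"
  shows "integrable lborel (\<lambda>x. h (\<Gamma> x t))" "(LINT x|lborel. h (\<Gamma> x t)) \<le> M * (LINT y|lborel. h y)"
proof -
  interpret increasing_primitive "\<lambda>x. \<gamma> x t" "\<lambda>x. \<eta> x t" by (rule increasing_primitive[OF t])
  have m: "(\<lambda>x. h (\<Gamma> x t)) \<in> borel_measurable borel" by (rule measurable_compose[OF inv_T_borel h(1)])
  have b: "0 \<le> \<eta> y t" "\<eta> y t \<le> M" for y using \<eta>_pos[of t y] \<eta>_le[of t y] t by auto
  have int: "integrable lborel (\<lambda>y. \<eta> y t * h y)"
  proof (rule Bochner_Integration.integrable_bound)
    show "integrable lborel (\<lambda>y. M * h y)" using h(3) by simp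
    show "(\<lambda>y. \<eta> y t * h y) \<in> borel_measurable lborel" using h(1) e_borel by simp
    show "AE y in lborel. norm (\<eta> y t * h y) \<le> norm (M * h y)"
      using b h(2) M(1) by (intro AE_I2) (auto simp: abs_mult intro!: mult_mono)
  qed
  then show "integrable lborel (\<lambda>x. h (\<Gamma> x t))" by (subst integrable_substitution[OF m]) (simp add: \<Gamma>_\<gamma>)
  have "(LINT x|lborel. h (\<Gamma> x t)) = (LINT y|lborel. \<eta> y t * h y)"
    using integral_substitution[OF m] by simp
  also have "\<dots> \<le> (LINT y|lborel. M * h y)"
    using h b by (intro integral_mono int) (auto intro!: mult_right_mono)
  finally show "(LINT x|lborel. h (\<Gamma> x t)) \<le> M * (LINT y|lborel. h y)" by simp
qed

lemma \<sigma>_integrable: "0 \<le> t \<Longrightarrow> compact C \<Longrightarrow> set_integrable lebesgue C (\<lambda>x. \<sigma> x t)"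
proof (rule set_integrable_bound[where f="\<lambda>x. \<beta>"])
  assume t: "0 \<le> t" and C: "compact C"
  show "set_integrable lebesgue C (\<lambda>x. \<beta>)" by (simp add: absolutely_integrable_on_const lmeasurable_compact C)
  show "set_borel_measurable lebesgue C (\<lambda>x. \<sigma> x t)"
    using compact_imp_closed[OF C] unfolding set_borel_measurable_def
    by (intro borel_measurable_scaleR borel_measurable_indicator \<sigma>_section_measurable t) simp
  show "AE x in lebesgue. x \<in> C \<longrightarrow> norm (\<sigma> x t) \<le> norm \<beta>"
    using \<sigma>_bound[OF t] by (intro AE_I2) (simp add: order_trans[OF _ abs_ge_self])
qed


lemma \<Gamma>_x_cont: "0 \<le> t \<Longrightarrow> continuous_on UNIV (\<lambda>x. \<Gamma> x t)"
proof -
  assume "0 \<le> t"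
  then have "continuous_on UNIV (\<lambda>x. case (x, t) of (x, t) \<Rightarrow> \<Gamma> x t)"
    by (intro continuous_on_compose2[OF \<Gamma>_cont]) (auto intro!: continuous_intros)
  then show ?thesis by simp
qed

text \<open>Let w stand for v/\<eta> at time s. Then |\<sigma>(x,t) - \<sigma>(x,s)| is at most
  |S(.,t) - w| at the point \<Gamma>(x,t) plus |w(\<Gamma>(x,t)) - w(\<Gamma>(x,s))|. The first part
  is small in L1 by substitution, the second by dominated convergence, since w has countably many
  discontinuities and \<Gamma> is continuous in time.\<close>

lemma \<sigma>_L1loc: "L1loc_continuous_on {0..} \<sigma>"
  unfolding L1loc_continuous_on_def
proof (intro allI impI conjI ballI)
  fix C :: "real set" assume C: "compact C"
  show "set_integrable lebesgue C (\<lambda>x. \<sigma> x t)" if "t \<in> {0..}" for t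
    using \<sigma>_integrable[OF _ C] that by simp
  fix s :: real assume "s \<in> {0..}"
  then have s: "0 \<le> s" by simp
  \<comment> \<open>Restriction to positive times gives access to bounded variation and to Borel
    sections, which are available for t > 0.\<close>
  have at_eq: "(at s within {0..}) = (at s within {0<..})"
  proof (cases "s = 0")
    case True
    have "(x \<noteq> 0 \<longrightarrow> x \<in> {0..} \<longrightarrow> P x) \<longleftrightarrow> (x \<noteq> 0 \<longrightarrow> x \<in> {0<..} \<longrightarrow> P x)" for x :: real and P
      by auto
    then show ?thesis unfolding filter_eq_iff eventually_at_filter True by simp
  next
    case False
    then show ?thesis
      using s at_within_open[of s "{0<..}"] at_within_interior[of s "{0..}"] by (simp add: interior_real_atLeast)
  qed
  \<comment> \<open>At s = 0 the section of v/\<eta> is known only up to a null set, so \<sigma>0,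
    which has bounded variation, represents it.\<close>
  define w where "w = (if s = 0 then \<sigma>0 else (\<lambda>y. S y s))"
  have wb: "\<bar>w y\<bar> \<le> \<beta>" for y using \<sigma>0_bounds(3) S_bound[OF s] by (simp add: w_def)
  have wS: "AE y in lebesgue. w y = S y s"
    using initial by eventually_elim (auto simp: w_def)
  have wdisc: "countable {y. \<not> isCont w y}"
  proof (cases "s = 0")
    case True
    then show ?thesis
      by (simp add: w_def bounded_total_variation_countable_discontinuities[OF \<sigma>0_BV])
  next
    case False
    then have "0 < s" using s by simp
    have "isCont (\<lambda>y. S y s) y" if "y \<notin> D s" for y
      using that \<eta>_pos[OF s, of y] by (intro isCont_divide) (auto simp: D_def)
    then have "{y. \<not> isCont w y} \<subseteq> D s" using False by (auto simp: w_def)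
    then show ?thesis using D_countable[OF \<open>0 < s\<close>] countable_subset by blast
  qed
  have [measurable]: "w \<in> borel_measurable borel" by (rule countable_discontinuities_borel[OF wdisc])
  have "bounded C" using C by (rule compact_imp_bounded)
  then obtain R where R: "0 < R" "\<And>x. x \<in> C \<Longrightarrow> \<bar>x\<bar> \<le> R" by (auto simp: bounded_pos)
  show "((\<lambda>t. LINT x:C|lebesgue. norm (\<sigma> x t - \<sigma> x s)) \<longlongrightarrow> 0) (at s within {0..})"
    unfolding at_eq tendsto_at_iff_sequentially o_def
  proof (intro allI impI)
    fix X :: "nat \<Rightarrow> real" assume X: "\<forall>i. X i \<in> {0<..} - {s}" "X \<longlonglongrightarrow> s"
    have Xp: "0 < X n" for n using X(1) by auto
    then have Xn: "0 \<le> X n" for n by (rule less_imp_le)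
    have "continuous_on {0..} (\<lambda>t. case (0, t) of (x, t) \<Rightarrow> \<gamma> x t)"
      by (intro continuous_on_compose2[OF \<gamma>_cont]) (auto intro!: continuous_intros)
    then have "(\<lambda>n. \<gamma> 0 (X n)) \<longlonglongrightarrow> \<gamma> 0 s"
      using continuous_on_tendsto_compose[of "{0..}" "\<lambda>t. \<gamma> 0 t" X s] X(2) s Xn by simp
    then have "Bseq (\<lambda>n. \<gamma> 0 (X n))" by (intro convergent_imp_Bseq) (auto simp: convergent_def)
    then obtain B0 where B0: "\<And>n. \<bar>\<gamma> 0 (X n)\<bar> \<le> B0" by (auto simp: Bseq_def)
    \<comment> \<open>A radius containing all \<Gamma>(x, X n) with |x| <= R: take y = 0 in
      \<open>\<Gamma>_dist\<close>, where B0 bounds |\<gamma>(0, X n)|.\<close>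
    define R' where "R' = (R + B0) / \<delta>"
    have R': "\<bar>\<Gamma> x (X n)\<bar> \<le> R'" if "\<bar>x\<bar> \<le> R" for x n
    proof -
      have "\<bar>\<Gamma> x (X n) - 0\<bar> \<le> \<bar>x - \<gamma> 0 (X n)\<bar> / \<delta>" by (rule \<Gamma>_dist[OF less_imp_le[OF Xp]])
      also have "\<dots> \<le> R'" unfolding R'_def using that B0[of n] \<delta>_pos by (intro divide_right_mono) auto
      finally show ?thesis by simp
    qed
    define h where "h n y = indicat_real {-R'..R'} y * \<bar>S y (X n) - w y\<bar>" for n y
    have [measurable]: "(\<lambda>y. S y (X n)) \<in> borel_measurable borel" for n by (rule borel_sections(3)[OF Xp])
    have hm: "h n \<in> borel_measurable borel" for n unfolding h_def[abs_def] by measurable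
    have h0: "0 \<le> h n y" for n y by (simp add: h_def)
    have hS: "(LINT y|lborel. h n y) = (LINT y:{-R'..R'}|lebesgue. norm (S y (X n) - S y s))" for n
    proof -
      have "(LINT y|lborel. h n y) = (LINT y|lebesgue. h n y)" using hm by (simp add: integral_completion)
      also have "\<dots> = (LINT y:{-R'..R'}|lebesgue. norm (S y (X n) - S y s))"
        unfolding set_lebesgue_integral_def
        by (rule integral_lebesgue_cong_AE) (use wS in \<open>auto simp: h_def elim: eventually_mono\<close>)
      finally show ?thesis .
    qed
    have bi: "set_integrable lborel {c..d} k" if "k \<in> borel_measurable borel" "\<And>x. \<bar>k x\<bar> \<le> B"
      for k :: "real \<Rightarrow> real" and B c d
      using bounded_borel_set_integrable[of k B c d] set_integrable_lebesgue_lborel(1)[OF that(1)] that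
      by (simp add: measurable_completion)
    have hi: "integrable lborel (h n)" for n
    proof -
      have "set_integrable lborel {-R'..R'} (\<lambda>y. \<bar>S y (X n) - w y\<bar>)"
      proof (rule bi)
        show "\<bar>\<bar>S y (X n) - w y\<bar>\<bar> \<le> 2 * \<beta>" for y
          using S_bound[OF less_imp_le[OF Xp], of y n] wb[of y] by linarith
      qed measurable
      then show ?thesis by (simp add: set_integrable_def h_def[abs_def])
    qed
    define A where "A n = M * (LINT y|lborel. h n y)" for n
    have A0: "A \<longlonglongrightarrow> 0"
    proof -
      have "((\<lambda>t. LINT y:{-R'..R'}|lebesgue. norm (S y t - S y s)) \<longlongrightarrow> 0) (at s within {0..})"
        using S_L1loc s by (auto simp: L1loc_continuous_on_def)
      then have "(\<lambda>n. LINT y:{-R'..R'}|lebesgue. norm (S y (X n) - S y s)) \<longlonglongrightarrow> 0"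
        using X unfolding at_eq tendsto_at_iff_sequentially o_def by blast
      then show ?thesis unfolding A_def hS by (rule tendsto_mult_right_zero)
    qed
    define F where "F n x = indicat_real {-R..R} x * \<bar>w (\<Gamma> x (X n)) - w (\<Gamma> x s)\<bar>" for n x
    have [measurable]: "(\<lambda>x. \<Gamma> x (X n)) \<in> borel_measurable borel" "(\<lambda>x. \<Gamma> x s) \<in> borel_measurable borel" for n
      using \<Gamma>_x_cont[OF s] \<Gamma>_x_cont[OF less_imp_le[OF Xp]] by (auto intro: borel_measurable_continuous_onI)
    have Fm: "F n \<in> borel_measurable borel" for n unfolding F_def[abs_def] by measurable
    have Fb: "\<bar>F n x\<bar> \<le> 2 * \<beta> * indicat_real {-R..R} x" for n x
      using wb[of "\<Gamma> x (X n)"] wb[of "\<Gamma> x s"] by (auto simp: F_def indicator_def)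
    have Bi: "integrable lborel (\<lambda>x. 2 * \<beta> * indicat_real {-R..R} x)" using R(1) by simp
    have Fi: "integrable lborel (F n)" for n
    proof (rule Bochner_Integration.integrable_bound[OF Bi])
      show "AE x in lborel. norm (F n x) \<le> norm (2 * \<beta> * indicat_real {-R..R} x)"
        by (rule AE_I2) (use Fb[of n] in \<open>auto intro: order_trans[OF _ abs_ge_self]\<close>)
    qed (use Fm in simp)
    have F0: "(\<lambda>n. LINT x|lborel. F n x) \<longlonglongrightarrow> (LINT x|(lborel :: real measure). 0)"
    proof (rule integral_dominated_convergence[OF _ _ Bi])
      \<comment> \<open>The exceptional x are those whose preimage under \<gamma>(.,s) is a
        discontinuity of w, hence the image of a countable set.\<close>
      have "countable ((\<lambda>y. \<gamma> y s) ` {y. \<not> isCont w y})" using wdisc by (rule countable_image)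
      then have "AE x in lborel. x \<notin> (\<lambda>y. \<gamma> y s) ` {y. \<not> isCont w y}"
        by (intro AE_not_in countable_imp_null_set_lborel)
      then show "AE x in lborel. (\<lambda>n. F n x) \<longlonglongrightarrow> 0"
      proof eventually_elim
        fix x assume x: "x \<notin> (\<lambda>y. \<gamma> y s) ` {y. \<not> isCont w y}"
        have "isCont w (\<Gamma> x s)"
        proof (rule ccontr)
          assume "\<not> isCont w (\<Gamma> x s)"
          then have "\<gamma> (\<Gamma> x s) s \<in> (\<lambda>y. \<gamma> y s) ` {y. \<not> isCont w y}" by blast
          then show False using x \<gamma>_\<Gamma>[OF s] by simp
        qed
        moreover have "(\<lambda>n. \<Gamma> x (X n)) \<longlonglongrightarrow> \<Gamma> x s"
        proof -
          have "continuous_on {0..} (\<lambda>t. case (x, t) of (x, t) \<Rightarrow> \<Gamma> x t)"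
            by (intro continuous_on_compose2[OF \<Gamma>_cont]) (auto intro!: continuous_intros)
          then show ?thesis
            using continuous_on_tendsto_compose[of "{0..}" "\<lambda>t. \<Gamma> x t" X s] X(2) s Xn by simp
        qed
        ultimately have "(\<lambda>n. w (\<Gamma> x (X n))) \<longlonglongrightarrow> w (\<Gamma> x s)" by (rule isCont_tendsto_compose)
        then have "(\<lambda>n. \<bar>w (\<Gamma> x (X n)) - w (\<Gamma> x s)\<bar>) \<longlonglongrightarrow> 0"
          by (intro tendsto_rabs_zero LIM_zero)
        then show "(\<lambda>n. F n x) \<longlonglongrightarrow> 0" unfolding F_def by (rule tendsto_mult_right_zero)
      qed
    qed (use Fm Fb in auto)
    have "norm (LINT x:C|lebesgue. norm (\<sigma> x (X n) - \<sigma> x s)) \<le> A n + (LINT x|lborel. F n x)" for n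
    proof -
      note sub = substitution_le[OF Xp[of n] hm h0 hi]
      have hGm: "(\<lambda>x. h n (\<Gamma> x (X n))) \<in> borel_measurable borel"
        by (rule measurable_compose[OF _ hm]) measurable
      have si: "set_integrable lebesgue C (\<lambda>x. norm (\<sigma> x (X n) - \<sigma> x s))"
        by (intro set_integrable_norm set_integral_diff(1) \<sigma>_integrable C s less_imp_le[OF Xp])
      have "(LINT x:C|lebesgue. norm (\<sigma> x (X n) - \<sigma> x s)) \<le> (LINT x|lebesgue. h n (\<Gamma> x (X n)) + F n x)"
        unfolding set_lebesgue_integral_def
      proof (rule integral_mono_AE)
        show "integrable lebesgue (\<lambda>x. h n (\<Gamma> x (X n)) + F n x)"
          using sub(1) Fi[of n] hGm Fm[of n] by (simp add: integrable_completion)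
        have "AE x in lebesgue. \<sigma> x s = w (\<Gamma> x s)"
          using \<sigma>_initial by eventually_elim (auto simp: w_def \<sigma>_eq \<Gamma>_0)
        then show "AE x in lebesgue. indicat_real C x *\<^sub>R norm (\<sigma> x (X n) - \<sigma> x s) \<le> h n (\<Gamma> x (X n)) + F n x"
        proof eventually_elim
          fix x assume eq: "\<sigma> x s = w (\<Gamma> x s)"
          show "indicat_real C x *\<^sub>R norm (\<sigma> x (X n) - \<sigma> x s) \<le> h n (\<Gamma> x (X n)) + F n x"
          proof (cases "x \<in> C")
            case True
            then have x: "\<bar>x\<bar> \<le> R" by (rule R(2))
            then have "\<Gamma> x (X n) \<in> {-R'..R'}" "x \<in> {-R..R}" using R'[OF x, of n] by auto
            then show ?thesis using True unfolding h_def F_def eq \<sigma>_eq[of x "X n"] by simp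
          next
            case False
            have "0 \<le> F n x" by (simp add: F_def)
            then show ?thesis using False h0 by simp
          qed
        qed
      qed (use si in \<open>simp add: set_integrable_def\<close>)
      also have "\<dots> = (LINT x|lborel. h n (\<Gamma> x (X n)) + F n x)"
        using hGm Fm[of n] by (intro integral_completion) simp
      also have "\<dots> = (LINT x|lborel. h n (\<Gamma> x (X n))) + (LINT x|lborel. F n x)"
        by (intro Bochner_Integration.integral_add sub(1) Fi)
      finally have "(LINT x:C|lebesgue. norm (\<sigma> x (X n) - \<sigma> x s)) \<le> A n + (LINT x|lborel. F n x)"
        using sub(2)[of n] by (simp add: A_def)
      moreover have "0 \<le> (LINT x:C|lebesgue. norm (\<sigma> x (X n) - \<sigma> x s))"
        unfolding set_lebesgue_integral_def by (intro Bochner_Integration.integral_nonneg) simp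
      ultimately show ?thesis by simp
    qed
    moreover have "(\<lambda>n. A n + (LINT x|lborel. F n x)) \<longlonglongrightarrow> 0" using tendsto_add[OF A0 F0] by simp
    ultimately show "(\<lambda>n. LINT x:C|lebesgue. norm (\<sigma> x (X n) - \<sigma> x s)) \<longlonglongrightarrow> 0"
      by (rule Lim_null_comparison[OF always_eventually[OF allI]])
  qed
qed

end

section \<open>Space averages of the Lagrangian map\<close>

lemma sliding_integral_has_derivative:
  fixes k :: "real \<Rightarrow> real"
  assumes k: "continuous_on UNIV k" and h: "0 < h"
  shows "((\<lambda>x. LINT y:{x..x + h}|lebesgue. k y) has_real_derivative k (x + h) - k x) (at x)"
proof -
  have kc: "continuous_on A k" for A using k by (rule continuous_on_subset) simp
  \<comment> \<open>The antiderivative is taken on a larger interval so that both x and x + h are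
    interior points.\<close>
  obtain P where P: "\<And>y. y \<in> {x - 1..x + h + 1} \<Longrightarrow> (P has_vector_derivative k y) (at y within {x - 1..x + h + 1})"
    by (rule antiderivative_continuous[OF kc], rule that)
  have Pd: "(P has_real_derivative k y) (at y)" if "y \<in> {x - 1<..<x + h + 1}" for y
  proof -
    have "(P has_vector_derivative k y) (at y within {x - 1<..<x + h + 1})"
      by (rule has_vector_derivative_within_subset[OF P]) (use that in auto)
    then show ?thesis
      using that by (simp add: at_within_open[OF that] has_real_derivative_iff_has_vector_derivative)
  qed
  have "((\<lambda>y. P (y + h) - P y) has_real_derivative k (x + h) - k x) (at x)"
  proof (rule DERIV_diff)
    have "((\<lambda>y. y + h) has_real_derivative 1) (at x)" by (auto intro!: derivative_eq_intros)
    from DERIV_chain2[where f=P and g="\<lambda>y. y + h", OF Pd this] show "((\<lambda>y. P (y + h)) has_real_derivative k (x + h)) (at x)"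
      using h by simp
    show "(P has_real_derivative k x) (at x)" using h by (intro Pd) auto
  qed
  then show ?thesis
  proof (rule has_field_derivative_transform_within_open[where S="{x - 1<..<x + 1}"])
    fix y assume y: "y \<in> {x - 1<..<x + 1}"
    have "(k has_integral P (y + h) - P y) {y..y + h}"
      by (rule fundamental_theorem_of_calculus)
         (use h y in \<open>auto intro!: has_vector_derivative_within_subset[OF P]\<close>)
    then show "P (y + h) - P y = (LINT y:{y..y + h}|lebesgue. k y)"
      by (subst set_lebesgue_integral_eq_integral(2))
         (auto intro!: absolutely_integrable_continuous_real kc simp: integral_unique)
  qed auto
qed

text \<open>Shifting the window changes the integral by two end pieces of length |x - z|, whence 2
  B. This replaces differentiability for U, which may jump in x.\<close>

lemma sliding_integral_Lipschitz:
  fixes k :: "real \<Rightarrow> real"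
  assumes k: "\<And>c d. set_integrable lebesgue {c..d} k" and B: "\<And>x. \<bar>k x\<bar> \<le> B" and h: "0 < h"
  shows "\<bar>(LINT y:{x..x + h}|lebesgue. k y) - (LINT y:{z..z + h}|lebesgue. k y)\<bar> \<le> 2 * B * \<bar>x - z\<bar>"
proof -
  have eq: "(LINT y:{c..d}|lebesgue. k y) = integral {c..d} k" and int: "k integrable_on {c..d}" for c d
    using set_lebesgue_integral_eq_integral[OF k] by auto
  have bd: "\<bar>integral {c..d} k\<bar> \<le> B * (d - c)" if "c \<le> d" for c d
    using has_integral_bound_real[of B "{}" k "integral {c..d} k" c d] int[of c d]
      order_trans[OF abs_ge_zero B[of 0]] B that
    by (auto simp: has_integral_integral)
  have *: "\<bar>integral {x..x + h} k - integral {z..z + h} k\<bar> \<le> 2 * B * (z - x)" if "x \<le> z" for x z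
  proof -
    have "integral {x..z} k + integral {z..z + h} k = integral {x..z + h} k"
      "integral {x..x + h} k + integral {x + h..z + h} k = integral {x..z + h} k"
      using that h int by (auto intro!: Henstock_Kurzweil_Integration.integral_combine)
    then have "integral {x..x + h} k - integral {z..z + h} k = integral {x..z} k - integral {x + h..z + h} k"
      by linarith
    also have "\<bar>\<dots>\<bar> \<le> B * (z - x) + B * (z - x)"
    proof -
      have "\<bar>integral {x + h..z + h} k\<bar> \<le> B * (z - x)" using bd[of "x + h" "z + h"] that by simp
      then show ?thesis using bd[OF that] by linarith
    qed
    finally show ?thesis by simp
  qed
  show ?thesis unfolding eq using *[of x z] *[of z x] by (cases "x \<le> z") (auto simp: abs_minus_commute)
qed

context lagrangian
begin

definition \<gamma>h :: "real \<Rightarrow> real \<Rightarrow> real \<Rightarrow> real" where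
  "\<gamma>h h x t = (LINT y:{x..x + h}|lebesgue. \<gamma> y t) / h"

text \<open>The average of \<eta> over [x, x + h], written as a difference quotient of \<gamma> so
  that its joint continuity is evident.\<close>

definition \<eta>h :: "real \<Rightarrow> real \<Rightarrow> real \<Rightarrow> real" where
  "\<eta>h h x t = (\<gamma> (x + h) t - \<gamma> x t) / h"

definition Uh :: "real \<Rightarrow> real \<Rightarrow> real \<Rightarrow> real" where
  "Uh h x t = (LINT y:{x..x + h}|lebesgue. U y t) / h"

lemma \<gamma>h_x_derivative:
  assumes "0 < t" "0 < h"
  shows "((\<lambda>x. \<gamma>h h x t) has_real_derivative \<eta>h h x t) (at x)"
  unfolding \<gamma>h_def \<eta>h_def
  by (intro DERIV_cdivide sliding_integral_has_derivative \<gamma>_x_cont assms) (use assms in simp)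

lemma U_bound: obtains B where "0 \<le> B" "\<And>x t. 0 \<le> t \<Longrightarrow> \<bar>U x t\<bar> \<le> B"
proof -
  obtain B where "0 \<le> B" "\<And>s. s \<in> J \<Longrightarrow> \<bar>G s\<bar> \<le> B" by (rule J_bounded[OF G_cont], rule that)
  then show thesis using S_in_J that by simp
qed

lemma U_integrable: "0 \<le> t \<Longrightarrow> set_integrable lebesgue {c..d} (\<lambda>x. U x t)"
  by (rule ES_integrable[OF _ G_cont]) auto

lemma U_integral_cont: "continuous_on {0<..} (\<lambda>t. LINT x:{c..d}|lebesgue. U x t)"
  using L1loc_integral_continuous_Ici[OF U_L1loc continuous_on_const[of _ 1]] by simp

text \<open>The time increment of \<gamma>h is the time integral of the averaged U. That integrand
  is continuous in time by L1 continuity, so the fundamental theorem gives a classical derivative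
  without averaging in t.\<close>

lemma \<gamma>h_t_derivative:
  assumes t: "0 < t" and h: "0 < h"
  shows "((\<lambda>t. \<gamma>h h x t) has_real_derivative Uh h x t) (at t)"
proof -
  define k where "k s = (LINT y:{x..x + h}|lebesgue. U y s)" for s
  have kc: "continuous_on {0<..} k" unfolding k_def by (rule U_integral_cont)
  \<comment> \<open>The integral identity for \<gamma> is available between positive times, hence a
    base point strictly between 0 and t.\<close>
  define r where "r = t / 2"
  have r: "0 < r" "r < t" using t by (simp_all add: r_def)
  have kr: "continuous_on {r..t + 1} k" using r by (intro continuous_on_subset[OF kc]) auto
  have "((\<lambda>s. integral {r..s} k) has_vector_derivative k t) (at t within {r..t + 1})"
    using integral_has_vector_derivative[OF kr, of t] r by simp
  then have "((\<lambda>s. integral {r..s} k) has_vector_derivative k t) (at t within {r<..<t + 1})"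
    by (rule has_vector_derivative_within_subset) auto
  then have "((\<lambda>s. integral {r..s} k) has_real_derivative k t) (at t)"
    using r by (subst (asm) at_within_open) (auto simp: has_real_derivative_iff_has_vector_derivative)
  then have "((\<lambda>s. ((LINT y:{x..x + h}|lebesgue. \<gamma> y r) + integral {r..s} k) / h) has_real_derivative (0 + k t) / h) (at t)"
    by (intro DERIV_cdivide DERIV_add DERIV_const)
  then have "((\<lambda>s. \<gamma>h h x s) has_real_derivative (0 + k t) / h) (at t)"
  proof (rule has_field_derivative_transform_within_open[where S="{r<..<t + 1}"])
    fix s assume s: "s \<in> {r<..<t + 1}"
    have "(LINT y:{x..x + h}|lebesgue. \<gamma> y s) - (LINT y:{x..x + h}|lebesgue. \<gamma> y r) = (LINT t:{r..s}|lebesgue. k t)"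
      unfolding k_def using r s h by (intro \<gamma>_time_integral) auto
    also have "\<dots> = integral {r..s} k"
      using r s by (intro set_lebesgue_integral_eq_integral(2) absolutely_integrable_continuous_real continuous_on_subset[OF kc]) auto
    finally show "((LINT y:{x..x + h}|lebesgue. \<gamma> y r) + integral {r..s} k) / h = \<gamma>h h x s"
      by (simp add: \<gamma>h_def)
  qed (use r in auto)
  then show ?thesis by (simp add: Uh_def k_def)
qed

lemma \<eta>h_bounds:
  assumes "0 \<le> t" "0 < h"
  shows "\<bar>\<eta>h h x t\<bar> \<le> M"
proof -
  have "0 \<le> \<delta> * h" using assms(2) \<delta>_pos by simp
  then have "\<bar>\<gamma> (x + h) t - \<gamma> x t\<bar> \<le> M * h" using \<gamma>_bounds[OF assms(1), of x "x + h"] assms(2) by simp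
  then show ?thesis using assms(2) by (simp add: \<eta>h_def pos_divide_le_eq)
qed

lemma interval_average_bound:
  fixes k :: "real \<Rightarrow> real"
  assumes "set_integrable lebesgue {x..x + h} k" "\<And>y. y \<in> {x..x + h} \<Longrightarrow> \<bar>k y - c\<bar> \<le> B" "0 < h"
  shows "\<bar>(LINT y:{x..x + h}|lebesgue. k y) / h - c\<bar> \<le> B"
proof -
  have const: "(LINT y:{x..x + h}|lebesgue. r) = r * h" "set_integrable lebesgue {x..x + h} (\<lambda>y. r)" for r :: real
    using assms(3) by (simp_all add: set_lebesgue_integral_def set_integrable_def)
  have "(LINT y:{x..x + h}|lebesgue. k y) \<le> (LINT y:{x..x + h}|lebesgue. c + B)"
    using assms(2) by (intro set_integral_mono assms(1) const) (force simp: abs_le_iff)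
  moreover have "(LINT y:{x..x + h}|lebesgue. c - B) \<le> (LINT y:{x..x + h}|lebesgue. k y)"
    using assms(2) by (intro set_integral_mono assms(1) const) (force simp: abs_le_iff)
  ultimately have "\<bar>(LINT y:{x..x + h}|lebesgue. k y) - c * h\<bar> \<le> B * h"
    unfolding const by (simp add: abs_le_iff algebra_simps)
  moreover have "(LINT y:{x..x + h}|lebesgue. k y) / h - c = ((LINT y:{x..x + h}|lebesgue. k y) - c * h) / h"
    using assms(3) by (simp add: diff_divide_distrib)
  ultimately show ?thesis using assms(3) by (simp add: pos_divide_le_eq)
qed

lemma Uh_bound:
  assumes "\<And>x t. 0 \<le> t \<Longrightarrow> \<bar>U x t\<bar> \<le> B" "0 \<le> t" "0 < h"
  shows "\<bar>Uh h x t\<bar> \<le> B"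
  using interval_average_bound[OF U_integrable[OF assms(2)] _ assms(3), of x 0 B] assms by (simp add: Uh_def)

lemma \<gamma>h_near:
  assumes "0 \<le> t" "0 < h"
  shows "\<bar>\<gamma>h h x t - \<gamma> x t\<bar> \<le> M * h"
  unfolding \<gamma>h_def
proof (rule interval_average_bound[OF _ _ assms(2)])
  show "set_integrable lebesgue {x..x + h} (\<lambda>y. \<gamma> y t)"
    by (intro absolutely_integrable_continuous_real \<gamma>_x_cont assms)
  fix y assume "y \<in> {x..x + h}"
  then have y: "x \<le> y" "y - x \<le> h" by auto
  have "0 \<le> \<delta> * (y - x)" using y \<delta>_pos by simp
  moreover have "M * (y - x) \<le> M * h" using y M(1) by (intro mult_left_mono) auto
  ultimately show "\<bar>\<gamma> y t - \<gamma> x t\<bar> \<le> M * h" using \<gamma>_bounds[OF assms(1) y(1)] by linarith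
qed

text \<open>Triangle inequality through the point (x0, t): the move in x costs at most C |x - x0|
  whatever t is, and the rest takes place on the line x = x0.\<close>

lemma continuous_on_half_planeI:
  fixes F :: "real \<Rightarrow> real \<Rightarrow> real"
  assumes x: "\<And>x y t. 0 < t \<Longrightarrow> \<bar>F x t - F y t\<bar> \<le> C * \<bar>x - y\<bar>"
    and t: "\<And>x. continuous_on {0<..} (F x)"
  shows "continuous_on half_plane (\<lambda>(x, t). F x t)"
  unfolding continuous_on_def
proof
  fix z :: "real \<times> real" assume z: "z \<in> half_plane"
  obtain x0 t0 where z_eq: "z = (x0, t0)" by force
  have "continuous_on half_plane (\<lambda>w. C * \<bar>fst w - x0\<bar> + \<bar>F x0 (snd w) - F x0 t0\<bar>)"
    by (intro continuous_intros continuous_on_compose2[OF t, of _ snd]) auto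
  then have "((\<lambda>w. C * \<bar>fst w - x0\<bar> + \<bar>F x0 (snd w) - F x0 t0\<bar>) \<longlongrightarrow> 0) (at z within half_plane)"
    by (rule continuous_on_def[THEN iffD1, rule_format, OF _ z, THEN tendsto_eq_rhs]) (simp add: z_eq)
  then have "((\<lambda>w. (case w of (x, t) \<Rightarrow> F x t) - F x0 t0) \<longlongrightarrow> 0) (at z within half_plane)"
  proof (rule Lim_null_comparison[rotated])
    have "\<bar>F x t - F x0 t0\<bar> \<le> C * \<bar>x - x0\<bar> + \<bar>F x0 t - F x0 t0\<bar>" if "0 < t" for x t
      using x[OF that, of x x0] by linarith
    then show "\<forall>\<^sub>F w in at z within half_plane. norm ((case w of (x, t) \<Rightarrow> F x t) - F x0 t0)
        \<le> C * \<bar>fst w - x0\<bar> + \<bar>F x0 (snd w) - F x0 t0\<bar>"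
      by (auto simp: eventually_at_filter intro!: always_eventually)
  qed
  then show "((\<lambda>(x, t). F x t) \<longlongrightarrow> (case z of (x, t) \<Rightarrow> F x t)) (at z within half_plane)"
    using LIM_zero_cancel by (fastforce simp: z_eq)
qed

lemma Uh_cont:
  assumes h: "0 < h"
  shows "continuous_on half_plane (\<lambda>(x, t). Uh h x t)"
proof -
  obtain B where B: "0 \<le> B" "\<And>x t. 0 \<le> t \<Longrightarrow> \<bar>U x t\<bar> \<le> B" by (rule U_bound, rule that)
  show ?thesis
  proof (rule continuous_on_half_planeI)
    fix x y t :: real assume t: "0 < t"
    have "\<bar>(LINT z:{x..x + h}|lebesgue. U z t) - (LINT z:{y..y + h}|lebesgue. U z t)\<bar> \<le> 2 * B * \<bar>x - y\<bar>"
      by (rule sliding_integral_Lipschitz) (use t B U_integrable h in auto)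
    then show "\<bar>Uh h x t - Uh h y t\<bar> \<le> 2 * B / h * \<bar>x - y\<bar>"
      using h by (simp add: Uh_def diff_divide_distrib[symmetric] divide_right_mono)
  next
    show "continuous_on {0<..} (Uh h x)" for x
      unfolding Uh_def[abs_def] using h by (intro continuous_intros U_integral_cont) simp
  qed
qed

lemma \<eta>h_cont:
  assumes h: "0 < h"
  shows "continuous_on half_plane (\<lambda>(x, t). \<eta>h h x t)"
  unfolding \<eta>h_def case_prod_unfold
  using h by (intro continuous_intros continuous_on_compose2[OF \<gamma>_cont, of _ "\<lambda>w. (fst w + h, snd w)", simplified]
      continuous_on_subset[OF \<gamma>_cont[unfolded case_prod_unfold]]) (auto intro!: continuous_intros)

lemma \<gamma>h_cont:
  assumes h: "0 < h"
  shows "continuous_on half_plane (\<lambda>(x, t). \<gamma>h h x t)"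
proof (rule continuous_on_half_planeI)
  fix x y t :: real assume t: "0 < t"
  show "\<bar>\<gamma>h h x t - \<gamma>h h y t\<bar> \<le> M * \<bar>x - y\<bar>"
    using field_differentiable_bound[of UNIV "\<lambda>x. \<gamma>h h x t" "\<lambda>x. \<eta>h h x t" M x y]
      \<gamma>h_x_derivative[OF t h] \<eta>h_bounds[OF less_imp_le[OF t] h] by simp
next
  show "continuous_on {0<..} (\<gamma>h h x)" for x
    using \<gamma>h_t_derivative[OF _ h] by (intro continuous_at_imp_continuous_on ballI DERIV_isCont) auto
qed

text \<open>The cut at t = 0 is made because \<gamma> is controlled only for t >= 0. Since \<psi>
  vanishes before some positive time, no regularity is lost. The two definitions below are its
  chain-rule derivatives, with \<eta>h and Uh as the derivatives of \<gamma>h.\<close>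

definition \<phi> :: "(real \<Rightarrow> real \<Rightarrow> real) \<Rightarrow> real \<Rightarrow> real \<Rightarrow> real \<Rightarrow> real" where
  "\<phi> \<psi> h x t = (if 0 < t then \<psi> (\<gamma>h h x t) t else 0)"

definition \<phi>x :: "(real \<Rightarrow> real \<Rightarrow> real) \<Rightarrow> real \<Rightarrow> real \<Rightarrow> real \<Rightarrow> real" where
  "\<phi>x \<psi> h x t = (if 0 < t then deriv (\<lambda>y. \<psi> y t) (\<gamma>h h x t) * \<eta>h h x t else 0)"

definition \<phi>t :: "(real \<Rightarrow> real \<Rightarrow> real) \<Rightarrow> real \<Rightarrow> real \<Rightarrow> real \<Rightarrow> real" where
  "\<phi>t \<psi> h x t = (if 0 < t then deriv (\<lambda>s. \<psi> (\<gamma>h h x t) s) t + deriv (\<lambda>y. \<psi> y t) (\<gamma>h h x t) * Uh h x t else 0)"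

lemma \<phi>_derivatives:
  assumes \<psi>: "C1_test_function \<psi>" and h: "0 < h"
  shows "((\<lambda>y. \<phi> \<psi> h y t) has_real_derivative \<phi>x \<psi> h x t) (at x)"
    and "((\<lambda>s. \<phi> \<psi> h x s) has_real_derivative \<phi>t \<psi> h x t) (at t)"
    and "continuous_on UNIV (\<lambda>(x, t). \<phi>x \<psi> h x t)"
    and "continuous_on UNIV (\<lambda>(x, t). \<phi>t \<psi> h x t)"
proof -
  obtain c d p q B where box: "test_box \<psi> c d p q B" by (rule C1_test_function_bounds[OF \<psi>])
  note B = test_boxD[OF box]
  have "Ck_on 1 UNIV (\<lambda>(x, t). \<psi> x t)" using \<psi> by (simp add: C1_test_function_def)
  note der = has_derivative_of_C1[OF this]
  show "((\<lambda>y. \<phi> \<psi> h y t) has_real_derivative \<phi>x \<psi> h x t) (at x)"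
    using DERIV_chain2[where f="\<lambda>y. \<psi> y t" and g="\<lambda>y. \<gamma>h h y t", OF der(4) \<gamma>h_x_derivative[OF _ h]]
    by (cases "0 < t") (simp_all add: \<phi>_def \<phi>x_def)
  show "((\<lambda>s. \<phi> \<psi> h x s) has_real_derivative \<phi>t \<psi> h x t) (at t)"
  proof (cases "0 < t")
    case True
    have "((\<lambda>s. (\<gamma>h h x s, s)) has_derivative (\<lambda>k. (Uh h x t * k, k))) (at t)"
      using \<gamma>h_t_derivative[OF True h, of x] unfolding has_field_derivative_def
      by (intro has_derivative_Pair has_derivative_ident)
    from diff_chain_at[OF this der(1)]
    have "((\<lambda>s. \<psi> (\<gamma>h h x s) s) has_derivative
        (\<lambda>k. deriv (\<lambda>y. \<psi> y t) (\<gamma>h h x t) * (Uh h x t * k) + deriv (\<lambda>s. \<psi> (\<gamma>h h x t) s) t * k)) (at t)"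
      by (simp add: o_def)
    then have "((\<lambda>s. \<psi> (\<gamma>h h x s) s) has_real_derivative \<phi>t \<psi> h x t) (at t)"
      unfolding has_field_derivative_def
      by (rule back_subst[of "\<lambda>D. (_ has_derivative D) _"]) (use True in \<open>auto simp: \<phi>t_def algebra_simps\<close>)
    then show ?thesis
      by (rule has_field_derivative_transform_within_open[where S="{0<..}"]) (use True in \<open>auto simp: \<phi>_def\<close>)
  next
    case False
    have "((\<lambda>s. 0) has_real_derivative 0) (at t)" by simp
    \<comment> \<open>The times below p form a neighbourhood of every t <= 0, and \<psi> vanishes on
      all of them.\<close>
    then have "((\<lambda>s. \<phi> \<psi> h x s) has_real_derivative 0) (at t)"
      by (rule has_field_derivative_transform_within_open[where S="{..<p}"]) (use False B in \<open>auto simp: \<phi>_def\<close>)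
    then show ?thesis using False by (simp add: \<phi>t_def)
  qed
  \<comment> \<open>Two overlapping open sets: the chain-rule formula is continuous on the first,
    and everything is zero on the second.\<close>
  have split: "UNIV = half_plane \<union> UNIV \<times> {..<p}" using B(1) by auto
  have zero: "\<phi>x \<psi> h x t = 0" "\<phi>t \<psi> h x t = 0" if "t < p" for x t
    using that B by (auto simp: \<phi>x_def \<phi>t_def)
  note \<gamma>c = \<gamma>h_cont[OF h, unfolded case_prod_unfold]
  have c1: "continuous_on half_plane (\<lambda>z. deriv (\<lambda>y. \<psi> y (snd z)) (\<gamma>h h (fst z) (snd z)))"
    by (rule continuous_on_compose2[OF der(2), of half_plane "\<lambda>z. (\<gamma>h h (fst z) (snd z), snd z)", simplified])
       (intro continuous_on_Pair \<gamma>c continuous_on_snd continuous_on_id)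
  have c2: "continuous_on half_plane (\<lambda>z. deriv (\<lambda>s. \<psi> (\<gamma>h h (fst z) (snd z)) s) (snd z))"
    by (rule continuous_on_compose2[OF der(3), of half_plane "\<lambda>z. (\<gamma>h h (fst z) (snd z), snd z)", simplified])
       (intro continuous_on_Pair \<gamma>c continuous_on_snd continuous_on_id)
  have "continuous_on half_plane (\<lambda>(x, t). \<phi>x \<psi> h x t)"
    by (rule continuous_on_eq[OF continuous_on_mult[OF c1 \<eta>h_cont[OF h, unfolded case_prod_unfold]]]) (auto simp: \<phi>x_def)
  moreover have "continuous_on half_plane (\<lambda>(x, t). \<phi>t \<psi> h x t)"
    by (rule continuous_on_eq[OF continuous_on_add[OF c2 continuous_on_mult[OF c1 Uh_cont[OF h, unfolded case_prod_unfold]]]])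
       (auto simp: \<phi>t_def)
  moreover have "continuous_on (UNIV \<times> {..<p}) (\<lambda>(x, t). \<phi>x \<psi> h x t)" "continuous_on (UNIV \<times> {..<p}) (\<lambda>(x, t). \<phi>t \<psi> h x t)"
    by (rule continuous_on_eq[OF continuous_on_const[of _ 0]], use zero in auto)+
  ultimately show "continuous_on UNIV (\<lambda>(x, t). \<phi>x \<psi> h x t)" "continuous_on UNIV (\<lambda>(x, t). \<phi>t \<psi> h x t)"
    unfolding split by (intro continuous_on_open_Un open_Times; simp)+
qed

end

lemma lebesgue_integral_Icc_eq_lborel:
  fixes h :: "real \<Rightarrow> real"
  assumes "h \<in> borel_measurable borel" "\<And>x. x \<notin> {c..d} \<Longrightarrow> h x = 0"
  shows "(LINT x:{c..d}|lebesgue. h x) = (LINT x|lborel. h x)"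
proof -
  have "indicat_real {c..d} x *\<^sub>R h x = h x" for x using assms(2)[of x] by (cases "x \<in> {c..d}") auto
  then show ?thesis unfolding set_lebesgue_integral_def
    by (simp only:) (use assms(1) in \<open>simp add: integral_completion\<close>)
qed

section \<open>Substitution in the integrals and passage to the limit h -> 0\<close>

context lagrangian
begin

text \<open>The lower slope bound gives \<delta> |x| <= |\<gamma>(x,t)| + |\<gamma>(0,t)|, and
  \<gamma>(0,.) is bounded on [p, q]. So pulling back by \<gamma> keeps supports bounded in
  x.\<close>

lemma \<gamma>_proper:
  assumes "0 < p"
  obtains R where "0 \<le> R" "\<And>x t. t \<in> {p..q} \<Longrightarrow> \<bar>\<gamma> x t\<bar> \<le> \<rho> \<Longrightarrow> x \<in> {-R..R}"
proof -
  obtain B where B: "\<forall>x\<in>{0..0}. \<forall>t\<in>{p..q}. 0 < t \<longrightarrow> \<bar>\<gamma> x t\<bar> \<le> B" using \<gamma>_bounded by metis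
  show thesis
  proof (rule that[of "\<bar>\<rho> + B\<bar> / \<delta>"])
    fix x t assume t: "t \<in> {p..q}" and x: "\<bar>\<gamma> x t\<bar> \<le> \<rho>"
    have "0 < t" using t assms by simp
    then have "\<delta> * \<bar>x - 0\<bar> \<le> \<bar>\<gamma> x t - \<gamma> 0 t\<bar>" by (intro \<gamma>_dist) simp
    moreover have "\<bar>\<gamma> 0 t\<bar> \<le> B" using B t \<open>0 < t\<close> by simp
    ultimately have "\<delta> * \<bar>x\<bar> \<le> \<bar>\<rho> + B\<bar>" using x by simp
    then have "\<bar>x\<bar> \<le> \<bar>\<rho> + B\<bar> / \<delta>" using \<delta>_pos by (simp add: pos_le_divide_eq mult.commute)
    then show "x \<in> {- (\<bar>\<rho> + B\<bar> / \<delta>)..\<bar>\<rho> + B\<bar> / \<delta>}" by (auto simp: abs_le_iff)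
  qed (use \<delta>_pos in simp)
qed

lemma E_borel_section:
  assumes "continuous_on J E" "w \<in> borel_measurable borel" "\<And>x. w x \<in> J"
  shows "(\<lambda>x. E (w x) :: real) \<in> borel_measurable borel"
proof -
  have "(\<lambda>x. E (max \<alpha> (min \<beta> (w x)))) \<in> borel_measurable borel"
    by (rule measurable_compose[OF assms(2) borel_measurable_continuous_onI[OF clamp_continuous[OF assms(1)]]])
  then show ?thesis using clamp_eq[OF assms(3)] by simp
qed

lemma pullback_measurable:
  assumes "continuous_on UNIV (\<lambda>(x, t). k x t)"
  shows "half_plane_measurable (\<lambda>x t. k (\<gamma> x t) t)"
proof (rule half_plane_measurable_continuous)
  have "continuous_on (UNIV \<times> {0..}) (\<lambda>z. (\<gamma> (fst z) (snd z), snd z))"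
    by (intro continuous_on_Pair \<gamma>_cont[unfolded case_prod_unfold] continuous_on_snd continuous_on_id)
  from continuous_on_compose2[OF assms this]
  show "continuous_on (UNIV \<times> {0..}) (\<lambda>(x, t). k (\<gamma> x t) t)" by (simp add: case_prod_unfold)
qed

text \<open>Fubini reduces to single times, where the one-dimensional substitution applies because
  sections at t > 0 are Borel; a second use of Fubini reassembles the half-plane. The space interval
  is [c, d] before the substitution and [-R, R] after it.\<close>

lemma change_of_variables:
  assumes \<psi>: "C1_test_function \<psi>" and E: "continuous_on J E" and Q: "continuous_on J Q"
  shows "(LINT (x, t):half_plane|lebesgue. deriv (\<lambda>s. \<psi> x s) t * E (\<sigma> x t) + deriv (\<lambda>y. \<psi> y t) x * Q (\<sigma> x t))
    = (LINT (x, t):half_plane|lebesgue.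
        (deriv (\<lambda>s. \<psi> (\<gamma> x t) s) t * E (S x t) + deriv (\<lambda>y. \<psi> y t) (\<gamma> x t) * Q (S x t)) * \<eta> x t)"
proof -
  obtain c d p q B where box: "test_box \<psi> c d p q B" by (rule C1_test_function_bounds[OF \<psi>])
  note B = test_boxD[OF box]
  obtain R where R: "\<And>x t. t \<in> {p..q} \<Longrightarrow> \<bar>\<gamma> x t\<bar> \<le> \<bar>c\<bar> + \<bar>d\<bar> \<Longrightarrow> x \<in> {-R..R}"
    by (rule \<gamma>_proper[OF B(1)], rule that)
  obtain BE where BE: "0 \<le> BE" "\<And>s. s \<in> J \<Longrightarrow> \<bar>E s\<bar> \<le> BE" by (rule J_bounded[OF E], rule that)
  obtain BQ where BQ: "0 \<le> BQ" "\<And>s. s \<in> J \<Longrightarrow> \<bar>Q s\<bar> \<le> BQ" by (rule J_bounded[OF Q], rule that)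
  have "Ck_on 1 UNIV (\<lambda>(x, t). \<psi> x t)" using \<psi> by (simp add: C1_test_function_def)
  note der = has_derivative_of_C1[OF this]
  have tm: "half_plane_measurable (\<lambda>x t. deriv (\<lambda>s. \<psi> x s) t)" and xm: "half_plane_measurable (\<lambda>x t. deriv (\<lambda>y. \<psi> y t) x)"
    by (intro half_plane_measurable_continuous continuous_on_subset[OF der(3)] continuous_on_subset[OF der(2)]; simp)+
  note tgm = pullback_measurable[OF der(3)] and xgm = pullback_measurable[OF der(2)]
  define F where "F e x t = deriv (\<lambda>s. \<psi> x s) t * E e + deriv (\<lambda>y. \<psi> y t) x * Q e" for e x t
  have Fb: "\<bar>F e x t\<bar> \<le> B * BE + B * BQ" if "e \<in> J" for e x t
  proof -
    have "\<bar>deriv (\<lambda>s. \<psi> x s) t * E e\<bar> \<le> B * BE" "\<bar>deriv (\<lambda>y. \<psi> y t) x * Q e\<bar> \<le> B * BQ"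
      unfolding abs_mult using B(2,6,7) BE BQ that by (intro mult_mono; simp)+
    then show ?thesis unfolding F_def by linarith
  qed
  have F0: "F e x t = 0" if "\<not> (x \<in> {c..d} \<and> t \<in> {p..q})" for e x t
    using B(4,5)[OF that] by (simp add: F_def)
  have F0\<gamma>: "F e (\<gamma> x t) t = 0" if "\<not> (x \<in> {-R..R} \<and> t \<in> {p..q})" for e x t
  proof (rule F0, rule notI, elim conjE)
    assume "\<gamma> x t \<in> {c..d}" and t: "t \<in> {p..q}"
    then have "\<bar>\<gamma> x t\<bar> \<le> \<bar>c\<bar> + \<bar>d\<bar>" by auto
    with R[OF t] t that show False by blast
  qed
  have "(LINT (x, t):half_plane|lebesgue. F (\<sigma> x t) x t) = (LINT t:{p..q}|lebesgue. LINT x:{c..d}|lebesgue. F (\<sigma> x t) x t)"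
  proof (rule half_plane_Fubini(2))
    show "half_plane_measurable (\<lambda>x t. F (\<sigma> x t) x t)"
      unfolding F_def
      by (intro half_plane_measurable_add half_plane_measurable_mult tm xm
          ES_meas[OF E \<sigma>_meas \<sigma>_in_J] ES_meas[OF Q \<sigma>_meas \<sigma>_in_J])
    show "\<bar>F (\<sigma> x t) x t\<bar> \<le> B * BE + B * BQ" if "t \<in> {p..q}" for x t
      using that B(1) by (intro Fb \<sigma>_in_J) simp
  qed (use F0 B(1) in auto)
  also have "\<dots> = (LINT t:{p..q}|lebesgue. LINT x:{-R..R}|lebesgue. F (S x t) (\<gamma> x t) t * \<eta> x t)"
  proof (rule set_lebesgue_integral_cong)
    show "\<forall>t. t \<in> {p..q} \<longrightarrow> (LINT x:{c..d}|lebesgue. F (\<sigma> x t) x t) = (LINT x:{-R..R}|lebesgue. F (S x t) (\<gamma> x t) t * \<eta> x t)"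
    proof (intro allI impI)
      fix t assume t: "t \<in> {p..q}"
      have tp: "0 < t" using t B(1) by simp
      interpret increasing_primitive "\<lambda>x. \<gamma> x t" "\<lambda>x. \<eta> x t" by (rule increasing_primitive[OF tp])
      have [measurable]: "(\<lambda>x. deriv (\<lambda>s. \<psi> x s) t) \<in> borel_measurable borel" "(\<lambda>x. deriv (\<lambda>y. \<psi> y t) x) \<in> borel_measurable borel"
      proof -
        have "continuous_on UNIV (\<lambda>x. (x, t))" by (intro continuous_intros)
        from continuous_on_compose2[OF der(3) this subset_UNIV] continuous_on_compose2[OF der(2) this subset_UNIV]
        have "continuous_on UNIV (\<lambda>x. deriv (\<lambda>s. \<psi> x s) t)" "continuous_on UNIV (\<lambda>x. deriv (\<lambda>y. \<psi> y t) x)"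
          by (simp_all only: split_conv)
        then show "(\<lambda>x. deriv (\<lambda>s. \<psi> x s) t) \<in> borel_measurable borel" "(\<lambda>x. deriv (\<lambda>y. \<psi> y t) x) \<in> borel_measurable borel"
          by (simp_all only: borel_measurable_continuous_onI)
      qed
      have [measurable]: "(\<lambda>x. E (\<sigma> x t)) \<in> borel_measurable borel" "(\<lambda>x. Q (\<sigma> x t)) \<in> borel_measurable borel"
        using E_borel_section[OF E \<sigma>_borel[OF tp] \<sigma>_in_J] E_borel_section[OF Q \<sigma>_borel[OF tp] \<sigma>_in_J] tp
        by simp_all
      have m: "(\<lambda>x. F (\<sigma> x t) x t) \<in> borel_measurable borel" unfolding F_def by measurable
      have \<sigma>S: "\<sigma> (\<gamma> y t) t = S y t" for y using tp by (simp add: \<sigma>_eq \<Gamma>_\<gamma>)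
      have m2: "(\<lambda>y. F (S y t) (\<gamma> y t) t * \<eta> y t) \<in> borel_measurable borel"
        using measurable_compose[OF T_borel m] e_borel unfolding \<sigma>S by (rule borel_measurable_times)
      have "(LINT x:{c..d}|lebesgue. F (\<sigma> x t) x t) = (LINT x|lborel. F (\<sigma> x t) x t)"
        by (rule lebesgue_integral_Icc_eq_lborel[OF m]) (rule F0, blast)
      also have "\<dots> = (LINT y|lborel. F (S y t) (\<gamma> y t) t * \<eta> y t)"
        using integral_substitution[OF m] by (simp add: \<sigma>S mult.commute)
      also have "\<dots> = (LINT y:{-R..R}|lebesgue. F (S y t) (\<gamma> y t) t * \<eta> y t)"
        by (rule lebesgue_integral_Icc_eq_lborel[OF m2, symmetric]) (use F0\<gamma> mult_zero_left in metis)
      finally show "(LINT x:{c..d}|lebesgue. F (\<sigma> x t) x t) = (LINT x:{-R..R}|lebesgue. F (S x t) (\<gamma> x t) t * \<eta> x t)" .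
    qed
  qed simp
  also have "\<dots> = (LINT (x, t):half_plane|lebesgue. F (S x t) (\<gamma> x t) t * \<eta> x t)"
  proof (rule half_plane_Fubini(2)[symmetric])
    show "half_plane_measurable (\<lambda>x t. F (S x t) (\<gamma> x t) t * \<eta> x t)"
      unfolding F_def
      by (intro half_plane_measurable_add half_plane_measurable_mult tgm xgm \<eta>_meas
          ES_meas[OF E S_meas S_in_J] ES_meas[OF Q S_meas S_in_J])
    show "\<bar>F (S x t) (\<gamma> x t) t * \<eta> x t\<bar> \<le> (B * BE + B * BQ) * M" if "t \<in> {p..q}" for x t
    proof -
      have t: "0 \<le> t" using that B(1) by simp
      show ?thesis unfolding abs_mult
        using Fb[OF S_in_J[OF t]] \<eta>_pos[OF t, of x] \<eta>_le[OF t, of x] B(2) BE(1) BQ(1) by (intro mult_mono) auto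
    qed
  qed (use F0\<gamma> B(1) in auto)
  finally show ?thesis by (simp add: F_def)
qed

text \<open>Uniformity in h is what dominated convergence requires. For h <= 1 one rectangle serves,
  because \<gamma>h stays within M h <= M of \<gamma>; the bounds for \<eta>h and Uh do not depend
  on h either.\<close>

lemma \<phi>_support:
  assumes \<psi>: "C1_test_function \<psi>"
  obtains R p q B where "0 < p" "0 \<le> B"
    "\<And>h x t. 0 < h \<Longrightarrow> h \<le> 1 \<Longrightarrow> \<not> (x \<in> {-R..R} \<and> t \<in> {p..q}) \<Longrightarrow> \<phi> \<psi> h x t = 0 \<and> \<phi>x \<psi> h x t = 0 \<and> \<phi>t \<psi> h x t = 0"
    "\<And>h x t. 0 < h \<Longrightarrow> \<bar>\<phi>x \<psi> h x t\<bar> \<le> B \<and> \<bar>\<phi>t \<psi> h x t\<bar> \<le> B"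
proof -
  obtain c d p q B where box: "test_box \<psi> c d p q B" by (rule C1_test_function_bounds[OF \<psi>])
  note B = test_boxD[OF box]
  obtain R where R: "0 \<le> R" "\<And>x t. t \<in> {p..q} \<Longrightarrow> \<bar>\<gamma> x t\<bar> \<le> \<bar>c\<bar> + \<bar>d\<bar> + M \<Longrightarrow> x \<in> {-R..R}"
    by (rule \<gamma>_proper[OF B(1)], rule that)
  obtain BU where BU: "0 \<le> BU" "\<And>x t. 0 \<le> t \<Longrightarrow> \<bar>U x t\<bar> \<le> BU" by (rule U_bound, rule that)
  show thesis
  proof (rule that[of p "B * M + (B + B * BU)" R q])
    show "0 \<le> B * M + (B + B * BU)" using B(2) M(1) BU(1) by simp
    fix h :: real assume h: "0 < h"
    show "\<phi> \<psi> h x t = 0 \<and> \<phi>x \<psi> h x t = 0 \<and> \<phi>t \<psi> h x t = 0" if "h \<le> 1" "\<not> (x \<in> {-R..R} \<and> t \<in> {p..q})" for x t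
    proof -
      have "\<not> (\<gamma>h h x t \<in> {c..d} \<and> t \<in> {p..q})"
      proof (rule notI, elim conjE)
        assume g: "\<gamma>h h x t \<in> {c..d}" and t: "t \<in> {p..q}"
        have "0 \<le> t" using t B(1) by simp
        from \<gamma>h_near[OF this h, of x] have "\<bar>\<gamma>h h x t - \<gamma> x t\<bar> \<le> M * h" .
        moreover have "M * h \<le> M" using M(1) h that(1) by (simp add: mult_left_le)
        ultimately have "\<bar>\<gamma> x t\<bar> \<le> \<bar>c\<bar> + \<bar>d\<bar> + M" using g by auto
        with R(2)[OF t] t that(2) show False by blast
      qed
      then show ?thesis using B(3-5) by (simp add: \<phi>_def \<phi>x_def \<phi>t_def)
    qed
    show "\<bar>\<phi>x \<psi> h x t\<bar> \<le> B * M + (B + B * BU) \<and> \<bar>\<phi>t \<psi> h x t\<bar> \<le> B * M + (B + B * BU)" for x t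
    proof (cases "0 < t")
      case True
      have t: "0 \<le> t" using True by simp
      have 1: "\<bar>deriv (\<lambda>y. \<psi> y t) (\<gamma>h h x t) * \<eta>h h x t\<bar> \<le> B * M"
        unfolding abs_mult using B(2,6) \<eta>h_bounds[OF t h] by (intro mult_mono) auto
      have 2: "\<bar>deriv (\<lambda>y. \<psi> y t) (\<gamma>h h x t) * Uh h x t\<bar> \<le> B * BU"
        unfolding abs_mult using B(2,6) Uh_bound[OF BU(2) t h] by (intro mult_mono) auto
      have "0 \<le> B * M" "0 \<le> B * BU" using B(2) M(1) BU(1) by auto
      then show ?thesis
        using True 1 2 B(2) B(7)[of "\<gamma>h h x t" t] abs_triangle_ineq[of "deriv (\<psi> (\<gamma>h h x t)) t"]
        by (auto simp: \<phi>x_def \<phi>t_def intro!: order_trans[OF abs_triangle_ineq])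
    next
      case False
      then show ?thesis using B(2) M(1) BU(1) by (simp add: \<phi>x_def \<phi>t_def)
    qed
  qed (use B R in auto)
qed

lemma \<phi>_C1_test_function:
  assumes \<psi>: "C1_test_function \<psi>" and h: "0 < h" "h \<le> 1"
  shows "C1_test_function (\<phi> \<psi> h)"
proof -
  obtain R p q B where B: "0 < p" "0 \<le> B"
    "\<And>h x t. 0 < h \<Longrightarrow> h \<le> 1 \<Longrightarrow> \<not> (x \<in> {-R..R} \<and> t \<in> {p..q}) \<Longrightarrow> \<phi> \<psi> h x t = 0 \<and> \<phi>x \<psi> h x t = 0 \<and> \<phi>t \<psi> h x t = 0"
    "\<And>h x t. 0 < h \<Longrightarrow> \<bar>\<phi>x \<psi> h x t\<bar> \<le> B \<and> \<bar>\<phi>t \<psi> h x t\<bar> \<le> B"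
    by (rule \<phi>_support[OF \<psi>], rule that)
  have "supported_in_upper (\<phi> \<psi> h)" by (rule supported_in_upperI[OF _ B(1)]) (use B(3)[OF h] in blast)
  moreover have "Ck_on 1 UNIV (\<lambda>(x, t). \<phi> \<psi> h x t)" by (rule C1_from_partials[OF \<phi>_derivatives[OF \<psi> h(1)]])
  ultimately show ?thesis by (simp add: C1_test_function_def)
qed

text \<open>All three are averages over intervals shrinking to a continuity point from the right.
  For U, continuity of v/\<eta> passes through the clamped G.\<close>

lemma averages_tendsto:
  assumes t: "0 < t" and x: "x \<notin> D t"
  defines "h \<equiv> \<lambda>n. inverse (real (Suc n))"
  shows "(\<lambda>n. \<gamma>h (h n) x t) \<longlonglongrightarrow> \<gamma> x t" "(\<lambda>n. \<eta>h (h n) x t) \<longlonglongrightarrow> \<eta> x t" "(\<lambda>n. Uh (h n) x t) \<longlonglongrightarrow> U x t"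
proof -
  have t0: "0 \<le> t" using t by simp
  have h: "0 < h n" "h \<longlonglongrightarrow> 0" for n unfolding h_def by (simp_all only: LIMSEQ_inverse_real_of_nat) simp
  have "isCont (\<lambda>y. \<gamma> y t) x" using \<gamma>_x_cont[OF t0, of UNIV] by (simp add: continuous_on_eq_continuous_at)
  then show "(\<lambda>n. \<gamma>h (h n) x t) \<longlonglongrightarrow> \<gamma> x t"
    unfolding \<gamma>h_def by (intro average_tendsto h absolutely_integrable_continuous_real \<gamma>_x_cont t0)
  have "\<eta>h (h n) x t = (LINT y:{x..x + h n}|lebesgue. \<eta> y t) / h n" for n
    using \<gamma>_diff[OF t0, of x "x + h n"] h(1)[of n] by (simp add: \<eta>h_def)
  moreover have "isCont (\<lambda>y. \<eta> y t) x" using x by (simp add: D_def)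
  ultimately show "(\<lambda>n. \<eta>h (h n) x t) \<longlonglongrightarrow> \<eta> x t"
    using average_tendsto[OF \<eta>_integrable[OF t0] _ h] by simp
  have "isCont (\<lambda>y. S y t) x" using x \<eta>_pos[OF t0, of x] by (intro isCont_divide) (auto simp: D_def)
  moreover have "isCont (\<lambda>s. G (max \<alpha> (min \<beta> s))) (S x t)"
    using clamp_continuous[OF G_cont] by (simp add: continuous_on_eq_continuous_at)
  ultimately have "isCont (\<lambda>y. G (max \<alpha> (min \<beta> (S y t)))) x" by (rule isCont_o2)
  then have "isCont (\<lambda>y. U y t) x" using clamp_eq[OF S_in_J[OF t0]] by simp
  then show "(\<lambda>n. Uh (h n) x t) \<longlonglongrightarrow> U x t"
    unfolding Uh_def by (intro average_tendsto h U_integrable t0)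
qed

text \<open>Formulated for any continuous pair (E, Q), as it serves twice: convex extensions lead to
  the entropy inequality, E = id with Q = g to the equation itself.\<close>

lemma transformed_integral_limit:
  assumes \<psi>: "C1_test_function \<psi>" and E: "continuous_on J E" and Q: "continuous_on J Q"
  shows "(\<lambda>n. LINT (x, t):half_plane|lebesgue.
      \<phi>t \<psi> (inverse (real (Suc n))) x t * (\<eta> x t * E (S x t))
      + \<phi>x \<psi> (inverse (real (Suc n))) x t * (Q (S x t) - U x t * E (S x t)))
    \<longlonglongrightarrow> (LINT (x, t):half_plane|lebesgue. deriv (\<lambda>s. \<psi> x s) t * E (\<sigma> x t) + deriv (\<lambda>y. \<psi> y t) x * Q (\<sigma> x t))"
proof -
  define h where "h n = inverse (real (Suc n))" for n
  have h: "0 < h n" "h n \<le> 1" for n by (simp_all add: h_def inverse_le_1_iff)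
  obtain R p q B where B: "0 < p" "0 \<le> B"
    "\<And>h x t. 0 < h \<Longrightarrow> h \<le> 1 \<Longrightarrow> \<not> (x \<in> {-R..R} \<and> t \<in> {p..q}) \<Longrightarrow> \<phi> \<psi> h x t = 0 \<and> \<phi>x \<psi> h x t = 0 \<and> \<phi>t \<psi> h x t = 0"
    "\<And>h x t. 0 < h \<Longrightarrow> \<bar>\<phi>x \<psi> h x t\<bar> \<le> B \<and> \<bar>\<phi>t \<psi> h x t\<bar> \<le> B"
    by (rule \<phi>_support[OF \<psi>], rule that)
  obtain BE where BE: "0 \<le> BE" "\<And>s. s \<in> J \<Longrightarrow> \<bar>E s\<bar> \<le> BE" by (rule J_bounded[OF E], rule that)
  obtain BQ where BQ: "0 \<le> BQ" "\<And>s. s \<in> J \<Longrightarrow> \<bar>Q s\<bar> \<le> BQ" by (rule J_bounded[OF Q], rule that)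
  obtain BU where BU: "0 \<le> BU" "\<And>x t. 0 \<le> t \<Longrightarrow> \<bar>U x t\<bar> \<le> BU" by (rule U_bound, rule that)
  have "Ck_on 1 UNIV (\<lambda>(x, t). \<psi> x t)" using \<psi> by (simp add: C1_test_function_def)
  note der = has_derivative_of_C1[OF this]
  note tgm = pullback_measurable[OF der(3)] and xgm = pullback_measurable[OF der(2)]
  have "(\<lambda>n. LINT (x, t):half_plane|lebesgue. \<phi>t \<psi> (h n) x t * (\<eta> x t * E (S x t)) + \<phi>x \<psi> (h n) x t * (Q (S x t) - U x t * E (S x t)))
    \<longlonglongrightarrow> (LINT (x, t):half_plane|lebesgue.
        (deriv (\<lambda>s. \<psi> (\<gamma> x t) s) t * E (S x t) + deriv (\<lambda>y. \<psi> y t) (\<gamma> x t) * Q (S x t)) * \<eta> x t)"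
  proof (rule half_plane_dominated_convergence)
    have "half_plane_measurable (\<lambda>x t. \<phi>t \<psi> (h n) x t)" "half_plane_measurable (\<lambda>x t. \<phi>x \<psi> (h n) x t)" for n
      by (intro half_plane_measurable_continuous continuous_on_subset[OF \<phi>_derivatives(3)[OF \<psi> h(1)]]
          continuous_on_subset[OF \<phi>_derivatives(4)[OF \<psi> h(1)]]; simp)+
    then show "half_plane_measurable (\<lambda>x t. \<phi>t \<psi> (h n) x t * (\<eta> x t * E (S x t)) + \<phi>x \<psi> (h n) x t * (Q (S x t) - U x t * E (S x t)))" for n
      by (intro half_plane_measurable_add half_plane_measurable_mult half_plane_measurable_diff \<eta>_meas U_meas
          ES_meas[OF E S_meas S_in_J] ES_meas[OF Q S_meas S_in_J])
    show "half_plane_measurable (\<lambda>x t. (deriv (\<lambda>s. \<psi> (\<gamma> x t) s) t * E (S x t) + deriv (\<lambda>y. \<psi> y t) (\<gamma> x t) * Q (S x t)) * \<eta> x t)"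
      by (intro half_plane_measurable_add half_plane_measurable_mult tgm xgm \<eta>_meas
          ES_meas[OF E S_meas S_in_J] ES_meas[OF Q S_meas S_in_J])
    show "\<bar>\<phi>t \<psi> (h n) x t * (\<eta> x t * E (S x t)) + \<phi>x \<psi> (h n) x t * (Q (S x t) - U x t * E (S x t))\<bar>
       \<le> B * (M * BE) + B * (BQ + BU * BE)" if "t \<in> {p..q}" for n x t
    proof -
      have t: "0 \<le> t" using that B(1) by simp
      have "\<bar>\<eta> x t * E (S x t)\<bar> \<le> M * BE" "\<bar>U x t * E (S x t)\<bar> \<le> BU * BE"
        unfolding abs_mult using BE BE(2)[OF S_in_J[OF t, of x]] BU BU(2)[OF t, of x] \<eta>_pos[OF t, of x] \<eta>_le[OF t, of x] M(1)
        by (intro mult_mono; simp)+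
      then have 1: "\<bar>\<eta> x t * E (S x t)\<bar> \<le> M * BE" "\<bar>Q (S x t) - U x t * E (S x t)\<bar> \<le> BQ + BU * BE"
        using BQ(2)[OF S_in_J[OF t, of x]] by linarith+
      have "\<bar>\<phi>t \<psi> (h n) x t * (\<eta> x t * E (S x t))\<bar> \<le> B * (M * BE)"
        "\<bar>\<phi>x \<psi> (h n) x t * (Q (S x t) - U x t * E (S x t))\<bar> \<le> B * (BQ + BU * BE)"
        unfolding abs_mult[of "\<phi>t \<psi> (h n) x t"] abs_mult[of "\<phi>x \<psi> (h n) x t"]
        using B(2) B(4)[OF h(1)[of n], of x t] 1 by (intro mult_mono; simp)+
      then show ?thesis by linarith
    qed
    show "\<phi>t \<psi> (h n) x t * (\<eta> x t * E (S x t)) + \<phi>x \<psi> (h n) x t * (Q (S x t) - U x t * E (S x t)) = 0"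
      if "\<not> (x \<in> {-R..R} \<and> t \<in> {p..q})" for n x t
      using B(3)[OF h that] by simp
    show "AE x in lebesgue. (\<lambda>n. \<phi>t \<psi> (h n) x t * (\<eta> x t * E (S x t)) + \<phi>x \<psi> (h n) x t * (Q (S x t) - U x t * E (S x t)))
       \<longlonglongrightarrow> (deriv (\<lambda>s. \<psi> (\<gamma> x t) s) t * E (S x t) + deriv (\<lambda>y. \<psi> y t) (\<gamma> x t) * Q (S x t)) * \<eta> x t"
      if t: "0 < t" for t
      using AE_D[OF t]
    proof eventually_elim
      fix x assume x: "x \<notin> D t"
      note lim = averages_tendsto[OF t x, folded h_def]
      have "isCont (\<lambda>(x, t). deriv (\<lambda>s. \<psi> x s) t) (\<gamma> x t, t)" "isCont (\<lambda>(x, t). deriv (\<lambda>y. \<psi> y t) x) (\<gamma> x t, t)"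
        using der(2,3) by (simp_all add: continuous_on_eq_continuous_at)
      from isCont_tendsto_compose[OF this(1) tendsto_Pair[OF lim(1) tendsto_const]]
        isCont_tendsto_compose[OF this(2) tendsto_Pair[OF lim(1) tendsto_const]]
      have l: "(\<lambda>n. deriv (\<lambda>s. \<psi> (\<gamma>h (h n) x t) s) t) \<longlonglongrightarrow> deriv (\<lambda>s. \<psi> (\<gamma> x t) s) t"
        "(\<lambda>n. deriv (\<lambda>y. \<psi> y t) (\<gamma>h (h n) x t)) \<longlonglongrightarrow> deriv (\<lambda>y. \<psi> y t) (\<gamma> x t)" by simp_all
      have "(\<lambda>n. \<phi>t \<psi> (h n) x t * (\<eta> x t * E (S x t)) + \<phi>x \<psi> (h n) x t * (Q (S x t) - U x t * E (S x t)))
       \<longlonglongrightarrow> (deriv (\<lambda>s. \<psi> (\<gamma> x t) s) t + deriv (\<lambda>y. \<psi> y t) (\<gamma> x t) * U x t) * (\<eta> x t * E (S x t))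
          + deriv (\<lambda>y. \<psi> y t) (\<gamma> x t) * \<eta> x t * (Q (S x t) - U x t * E (S x t))"
        using t unfolding \<phi>t_def \<phi>x_def by (simp only: if_True) (intro tendsto_intros l lim)
      \<comment> \<open>The two terms containing U cancel, and \<eta> factors out.\<close>
      then show "(\<lambda>n. \<phi>t \<psi> (h n) x t * (\<eta> x t * E (S x t)) + \<phi>x \<psi> (h n) x t * (Q (S x t) - U x t * E (S x t)))
       \<longlonglongrightarrow> (deriv (\<lambda>s. \<psi> (\<gamma> x t) s) t * E (S x t) + deriv (\<lambda>y. \<psi> y t) (\<gamma> x t) * Q (S x t)) * \<eta> x t"
        by (simp add: algebra_simps)
    qed
  qed (use B in auto)
  then show ?thesis unfolding change_of_variables[OF assms] h_def .
qed

end

section \<open>Entropies\<close>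

text \<open>The state space is the part \<eta> > 0 of the sector \<alpha> \<eta> <= v <= \<beta>
  \<eta>, an intersection of half-planes.\<close>

lemma convex_state_space:
  assumes "J = {\<alpha>..\<beta>}"
  shows "convex (state_space J)"
proof (rule convexI)
  fix x y :: "real \<times> real" and u w :: real
  assume xy: "x \<in> state_space J" "y \<in> state_space J" and uw: "0 \<le> u" "0 \<le> w" "u + w = 1"
  obtain x1 x2 y1 y2 where e: "x = (x1, x2)" "y = (y1, y2)" by force
  have p: "x1 > 0" "y1 > 0" and b: "\<alpha> * x1 \<le> x2" "x2 \<le> \<beta> * x1" "\<alpha> * y1 \<le> y2" "y2 \<le> \<beta> * y1"
    using xy assms by (auto simp: state_space_def e pos_le_divide_eq pos_divide_le_eq)
  have pos: "u * x1 + w * y1 > 0"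
    using p uw by (cases "u = 0") (auto intro: add_pos_nonneg)
  moreover have "\<alpha> * (u * x1 + w * y1) \<le> u * x2 + w * y2" "u * x2 + w * y2 \<le> \<beta> * (u * x1 + w * y1)"
    using mult_left_mono[OF b(1) uw(1)] mult_left_mono[OF b(3) uw(2)]
      mult_left_mono[OF b(2) uw(1)] mult_left_mono[OF b(4) uw(2)] by (simp_all add: algebra_simps)
  ultimately show "u *\<^sub>R x + w *\<^sub>R y \<in> state_space J"
    using assms by (simp add: state_space_def e pos_le_divide_eq pos_divide_le_eq)
qed

lemma convex_on_perspective:
  assumes E: "convex_on J E" and J: "J = {\<alpha>..\<beta>}"
  shows "convex_on (state_space J) (\<lambda>(\<eta>, v). \<eta> * E (v / \<eta>))"
proof (rule convex_onI[OF _ convex_state_space[OF J]])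
  fix t :: real and x y :: "real \<times> real"
  assume t: "0 < t" "t < 1" and xy: "x \<in> state_space J" "y \<in> state_space J"
  obtain x1 x2 y1 y2 where e: "x = (x1, x2)" "y = (y1, y2)" by force
  have p: "x1 > 0" "y1 > 0" and s: "x2 / x1 \<in> J" "y2 / y1 \<in> J" using xy by (auto simp: state_space_def e)
  define z where "z = (1 - t) * x1 + t * y1"
  have z: "z > 0" using p t by (simp add: z_def add_pos_pos)
  \<comment> \<open>The quotient of a convex combination is a convex combination of the quotients,
    with weights proportional to the first components; l is the weight of the second
    quotient.\<close>
  define l where "l = t * y1 / z"
  have l: "0 \<le> l" "l \<le> 1" and l1: "1 - l = (1 - t) * x1 / z"
    using p t z by (auto simp: l_def z_def field_simps)
  have "E ((1 - l) *\<^sub>R (x2 / x1) + l *\<^sub>R (y2 / y1)) \<le> (1 - l) * E (x2 / x1) + l * E (y2 / y1)"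
    by (rule convex_onD[OF E l s])
  moreover have "(1 - l) *\<^sub>R (x2 / x1) + l *\<^sub>R (y2 / y1) = ((1 - t) * x2 + t * y2) / z"
    unfolding l1 using p by (simp add: l_def add_divide_distrib)
  ultimately have "z * E (((1 - t) * x2 + t * y2) / z) \<le> z * ((1 - l) * E (x2 / x1) + l * E (y2 / y1))"
    using z by (intro mult_left_mono) auto
  also have "\<dots> = (1 - t) * (x1 * E (x2 / x1)) + t * (y1 * E (y2 / y1))"
    unfolding l1 using z by (simp add: l_def distrib_left)
  finally show "(case (1 - t) *\<^sub>R x + t *\<^sub>R y of (\<eta>, v) \<Rightarrow> \<eta> * E (v / \<eta>))
      \<le> (1 - t) * (case x of (\<eta>, v) \<Rightarrow> \<eta> * E (v / \<eta>)) + t * (case y of (\<eta>, v) \<Rightarrow> \<eta> * E (v / \<eta>))"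
    by (simp add: e z_def)
qed

context lagrangian
begin

lemma ratio_Ck: "Ck_on k (state_space J) (\<lambda>z. snd z * inverse (fst z))"
proof (rule Ck_on_mult)
  show "Ck_on k (state_space J) snd" by (rule Ck_on_linear[OF bounded_linear_snd])
  show "Ck_on k (state_space J) (\<lambda>z. inverse (fst z))"
    by (rule Ck_on_compose_real[OF Ck_on_inverse[OF order_refl] Ck_on_linear[OF bounded_linear_fst]])
       (auto simp: state_space_def)
qed

lemma compose_ratio_Ck:
  assumes "Ck_on k J E"
  shows "Ck_on k (state_space J) (\<lambda>z. E (snd z * inverse (fst z)) :: real)"
  by (rule Ck_on_compose_real[OF assms ratio_Ck]) (auto simp: state_space_def divide_inverse)

text \<open>With s = v/\<eta> the partial derivatives of \<eta> E(v/\<eta>) are E - s E' and E'.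
  From g = s G one has g' = G + s G', so Q - G E has derivative -G' (E - s E') in s; multiplied by
  the differential of v/\<eta> this is the flux relation of the system.\<close>

lemma system_extension:
  assumes ext: "scalar_convex_extension J g E Q"
  shows "system_convex_extension J G (\<lambda>(\<eta>, v). \<eta> * E (v / \<eta>)) (\<lambda>(\<eta>, v). Q (v / \<eta>) - G (v / \<eta>) * E (v / \<eta>))"
  unfolding system_convex_extension_def
proof (intro conjI)
  have E: "Ck_on k J E" for k using ext by (simp add: scalar_convex_extension_def smooth_on_def)
  have Q: "Ck_on 1 J Q" using ext by (simp add: scalar_convex_extension_def)
  show "smooth_on (state_space J) (\<lambda>(\<eta>, v). \<eta> * E (v / \<eta>))"
    using Ck_on_mult[OF Ck_on_linear[OF bounded_linear_fst] compose_ratio_Ck[OF E]]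
    by (intro smooth_onI) (simp add: case_prod_unfold divide_inverse)
  show "convex_on (state_space J) (\<lambda>(\<eta>, v). \<eta> * E (v / \<eta>))"
    using ext by (intro convex_on_perspective[OF _ J_eq]) (simp add: scalar_convex_extension_def)
  show "Ck_on 1 (state_space J) (\<lambda>(\<eta>, v). Q (v / \<eta>) - G (v / \<eta>) * E (v / \<eta>))"
    using Ck_on_diff[OF compose_ratio_Ck[OF Q] Ck_on_mult[OF compose_ratio_Ck[OF G_Ck] compose_ratio_Ck[OF E]]]
    by (simp add: case_prod_unfold divide_inverse)
  show "\<forall>(\<eta>, v)\<in>state_space J. \<exists>E\<eta> Ev.
       ((\<lambda>(\<eta>, v). \<eta> * E (v / \<eta>)) has_derivative (\<lambda>(h, k). E\<eta> * h + Ev * k)) (at (\<eta>, v) within state_space J) \<and>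
       ((\<lambda>(\<eta>, v). Q (v / \<eta>) - G (v / \<eta>) * E (v / \<eta>)) has_derivative
        (\<lambda>(h, k). E\<eta> * (v / \<eta>\<^sup>2) * deriv G (v / \<eta>) * h + - (E\<eta> * (1 / \<eta>) * deriv G (v / \<eta>)) * k))
        (at (\<eta>, v) within state_space J)"
  proof clarify
    fix \<eta> v :: real assume W: "(\<eta>, v) \<in> state_space J"
    define s where "s = v / \<eta>"
    have \<eta>: "\<eta> > 0" and s: "s \<in> J" using W by (auto simp: state_space_def s_def)
    have s0: "s \<noteq> 0" using s J_pos by auto
    obtain E' where E': "(E has_real_derivative E') (at s within J)"
      and Q': "(Q has_real_derivative E' * deriv g s) (at s within J)"
      using ext s unfolding scalar_convex_extension_def by blast
    have G': "(G has_real_derivative deriv G s) (at s within J)"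
      using G_deriv(1)[OF s] by (rule has_field_derivative_at_within)
    let ?r = "\<lambda>z :: real \<times> real. snd z / fst z"
    let ?r' = "\<lambda>z :: real \<times> real. snd z / \<eta> - v * fst z / \<eta>\<^sup>2"
    have r: "(?r has_derivative ?r') (at (\<eta>, v) within state_space J)"
      using \<eta> by (auto intro!: derivative_eq_intros simp: field_simps power2_eq_square)
    have rJ: "?r ` state_space J \<subseteq> J" by (auto simp: state_space_def)
    have comp: "((\<lambda>z. e (?r z)) has_derivative (\<lambda>z. e' * ?r' z)) (at (\<eta>, v) within state_space J)"
      if "(e has_real_derivative e') (at s within J)" for e e'
    proof -
      have "(e has_derivative (*) e') (at (?r (\<eta>, v)) within ?r ` state_space J)"
        using that rJ unfolding has_field_derivative_def by (auto simp: s_def intro: has_derivative_subset)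
      from diff_chain_within[OF r this] show ?thesis by (simp add: o_def)
    qed
    have "((\<lambda>z. fst z * E (?r z)) has_derivative (\<lambda>z. fst (\<eta>, v) * (E' * ?r' z) + fst z * E (?r (\<eta>, v)))) (at (\<eta>, v) within state_space J)"
      by (intro has_derivative_mult comp[OF E'] has_derivative_fst has_derivative_ident)
    also have "(\<lambda>z. fst (\<eta>, v) * (E' * ?r' z) + fst z * E (?r (\<eta>, v))) = (\<lambda>(h, k). (E s - s * E') * h + E' * k)"
      using \<eta> by (auto simp: s_def field_simps power2_eq_square)
    finally have 1: "((\<lambda>(\<eta>, v). \<eta> * E (v / \<eta>)) has_derivative (\<lambda>(h, k). (E s - s * E') * h + E' * k)) (at (\<eta>, v) within state_space J)"
      by (simp add: case_prod_unfold)
    have "deriv g s = G s + s * deriv G s"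
      using s0 G_deriv(2)[OF s] by (simp add: G_def field_simps power2_eq_square)
    then have coeff: "E' * deriv g s - (G s * E' + deriv G s * E s) = - (deriv G s * (E s - s * E'))"
      by (simp add: algebra_simps)
    have "((\<lambda>\<sigma>. Q \<sigma> - G \<sigma> * E \<sigma>) has_real_derivative - (deriv G s * (E s - s * E'))) (at s within J)"
      unfolding coeff[symmetric] using DERIV_diff[OF Q' DERIV_mult[OF G' E']] by (simp add: algebra_simps)
    from comp[OF this]
    have "((\<lambda>z. Q (?r z) - G (?r z) * E (?r z)) has_derivative (\<lambda>z. - (deriv G s * (E s - s * E')) * ?r' z)) (at (\<eta>, v) within state_space J)" .
    also have "(\<lambda>z. - (deriv G s * (E s - s * E')) * ?r' z) =
       (\<lambda>(h, k). (E s - s * E') * (v / \<eta>\<^sup>2) * deriv G s * h + - ((E s - s * E') * (1 / \<eta>) * deriv G s) * k)"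
    proof
      fix z :: "real \<times> real"
      show "- (deriv G s * (E s - s * E')) * ?r' z = (case z of (h, k) \<Rightarrow>
          (E s - s * E') * (v / \<eta>\<^sup>2) * deriv G s * h + - ((E s - s * E') * (1 / \<eta>) * deriv G s) * k)"
        by (cases z) (simp add: algebra_simps diff_divide_distrib)
    qed
    finally have 2: "((\<lambda>(\<eta>, v). Q (v / \<eta>) - G (v / \<eta>) * E (v / \<eta>)) has_derivative
       (\<lambda>(h, k). (E s - s * E') * (v / \<eta>\<^sup>2) * deriv G s * h + - ((E s - s * E') * (1 / \<eta>) * deriv G s) * k)) (at (\<eta>, v) within state_space J)"
      by (simp add: case_prod_unfold)
    show "\<exists>E\<eta> Ev.
       ((\<lambda>(\<eta>, v). \<eta> * E (v / \<eta>)) has_derivative (\<lambda>(h, k). E\<eta> * h + Ev * k)) (at (\<eta>, v) within state_space J) \<and>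
       ((\<lambda>(\<eta>, v). Q (v / \<eta>) - G (v / \<eta>) * E (v / \<eta>)) has_derivative
        (\<lambda>(h, k). E\<eta> * (v / \<eta>\<^sup>2) * deriv G (v / \<eta>) * h + - (E\<eta> * (1 / \<eta>) * deriv G (v / \<eta>)) * k))
        (at (\<eta>, v) within state_space J)"
      using 1 2 unfolding s_def by blast
  qed
qed

section \<open>Entropy inequality and conservation law for \<sigma>\<close>

lemma \<sigma>_entropy:
  assumes ext: "scalar_convex_extension J g E Q" and \<psi>: "C1_test_function \<psi>" "\<And>x t. 0 \<le> \<psi> x t"
  shows "0 \<le> (LINT (x, t):half_plane|lebesgue. deriv (\<lambda>s. \<psi> x s) t * E (\<sigma> x t) + deriv (\<lambda>y. \<psi> y t) x * Q (\<sigma> x t))"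
proof (rule LIMSEQ_le_const[OF transformed_integral_limit[OF \<psi>(1)]])
  have "Ck_on 0 J E" "Ck_on 1 J Q" using ext by (simp_all add: scalar_convex_extension_def smooth_on_def)
  then show "continuous_on J E" "continuous_on J Q" using Ck_on_mono[of 0 J Q] by (simp_all add: One_nat_def)
  have "0 \<le> (LINT (x, t):half_plane|lebesgue. \<phi>t \<psi> h x t * (\<eta> x t * E (S x t)) + \<phi>x \<psi> h x t * (Q (S x t) - U x t * E (S x t)))"
    if h: "0 < h" "h \<le> 1" for h
  proof -
    have "\<forall>x t. 0 \<le> \<phi> \<psi> h x t" using \<psi>(2) by (simp add: \<phi>_def)
    then have "0 \<le> (LINT (x, t):half_plane|lebesgue.
         deriv (\<lambda>s. \<phi> \<psi> h x s) t * (\<lambda>(\<eta>, v). \<eta> * E (v / \<eta>)) (\<eta> x t, v x t)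
         + deriv (\<lambda>y. \<phi> \<psi> h y t) x * (\<lambda>(\<eta>, v). Q (v / \<eta>) - G (v / \<eta>) * E (v / \<eta>)) (\<eta> x t, v x t))"
      using solution system_extension[OF ext] \<phi>_C1_test_function[OF \<psi>(1) h]
      unfolding admissible_weak_solution_def by blast
    moreover have "deriv (\<lambda>s. \<phi> \<psi> h x s) t = \<phi>t \<psi> h x t" "deriv (\<lambda>y. \<phi> \<psi> h y t) x = \<phi>x \<psi> h x t" for x t
      using \<phi>_derivatives(1,2)[OF \<psi>(1) h(1)] by (auto intro: DERIV_imp_deriv)
    ultimately show ?thesis by simp
  qed
  then show "\<exists>N. \<forall>n\<ge>N. 0 \<le> (LINT (x, t):half_plane|lebesgue.
      \<phi>t \<psi> (inverse (real (Suc n))) x t * (\<eta> x t * E (S x t))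
      + \<phi>x \<psi> (inverse (real (Suc n))) x t * (Q (S x t) - U x t * E (S x t)))"
    by (simp add: inverse_le_1_iff del: of_nat_Suc)
qed

text \<open>The function \<phi> is only known to be C1, so the weak formulation of v_t = 0, stated
  for smooth test functions, is not applied to it. Instead v is replaced by \<sigma>0 on every time
  slice, and the time integral, taken first, is a difference of boundary values of \<phi>.\<close>

lemma integral_\<phi>t_v:
  assumes \<psi>: "C1_test_function \<psi>" and h: "0 < h" "h \<le> 1"
  shows "(LINT (x, t):half_plane|lebesgue. \<phi>t \<psi> h x t * v x t) = 0"
proof -
  obtain R p q B where B: "0 < p" "0 \<le> B"
    "\<And>h x t. 0 < h \<Longrightarrow> h \<le> 1 \<Longrightarrow> \<not> (x \<in> {-R..R} \<and> t \<in> {p..q}) \<Longrightarrow> \<phi> \<psi> h x t = 0 \<and> \<phi>x \<psi> h x t = 0 \<and> \<phi>t \<psi> h x t = 0"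
    "\<And>h x t. 0 < h \<Longrightarrow> \<bar>\<phi>x \<psi> h x t\<bar> \<le> B \<and> \<bar>\<phi>t \<psi> h x t\<bar> \<le> B"
    by (rule \<phi>_support[OF \<psi>], rule that)
  \<comment> \<open>The time interval strictly contains [p, q], so that \<phi> vanishes at both of
    its ends.\<close>
  define p' q' where "p' = p / 2" and "q' = max p q + 1"
  have p': "0 < p'" "p' < p" "q < q'" "p' \<le> q'" using B(1) by (simp_all add: p'_def q'_def)
  have out: "\<phi> \<psi> h x t = 0" "\<phi>t \<psi> h x t = 0" if "\<not> (x \<in> {-R..R} \<and> t \<in> {p..q})" for x t
    using B(3)[OF h that] by auto
  have tm: "half_plane_measurable (\<lambda>x t. \<phi>t \<psi> h x t)"
    by (intro half_plane_measurable_continuous continuous_on_subset[OF \<phi>_derivatives(4)[OF \<psi> h(1)]]) simp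
  have bnd: "\<bar>\<phi>t \<psi> h x t * w\<bar> \<le> B * C" if "\<bar>w\<bar> \<le> C" for w x t C
    unfolding abs_mult using B(2) B(4)[OF h(1)] that by (intro mult_mono) auto
  have "(LINT (x, t):half_plane|lebesgue. \<phi>t \<psi> h x t * v x t)
      = (LINT t:{p'..q'}|lebesgue. LINT x:{-R..R}|lebesgue. \<phi>t \<psi> h x t * v x t)"
  proof (rule half_plane_Fubini(2))
    show "half_plane_measurable (\<lambda>x t. \<phi>t \<psi> h x t * v x t)" by (intro half_plane_measurable_mult tm v_meas)
    show "\<bar>\<phi>t \<psi> h x t * v x t\<bar> \<le> B * M" if "t \<in> {p'..q'}" for x t
      using that p'(1) by (intro bnd v_le) simp
    show "\<phi>t \<psi> h x t * v x t = 0" if "\<not> (x \<in> {-R..R} \<and> t \<in> {p'..q'})" for x t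
      using out(2)[of x t] that p' by auto
  qed (rule p'(1))
  also have "\<dots> = (LINT t:{p'..q'}|lebesgue. LINT x:{-R..R}|lebesgue. \<phi>t \<psi> h x t * \<sigma>0 x)"
  proof (rule set_lebesgue_integral_cong)
    show "\<forall>t. t \<in> {p'..q'} \<longrightarrow> (LINT x:{-R..R}|lebesgue. \<phi>t \<psi> h x t * v x t) = (LINT x:{-R..R}|lebesgue. \<phi>t \<psi> h x t * \<sigma>0 x)"
    proof (intro allI impI)
      fix t assume "t \<in> {p'..q'}"
      then have "0 \<le> t" using p'(1) by simp
      from v_eq[OF this]
      have "AE x in lebesgue. indicat_real {-R..R} x *\<^sub>R (\<phi>t \<psi> h x t * v x t) = indicat_real {-R..R} x *\<^sub>R (\<phi>t \<psi> h x t * \<sigma>0 x)"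
        by eventually_elim simp
      then show "(LINT x:{-R..R}|lebesgue. \<phi>t \<psi> h x t * v x t) = (LINT x:{-R..R}|lebesgue. \<phi>t \<psi> h x t * \<sigma>0 x)"
        unfolding set_lebesgue_integral_def
        by (rule integral_lebesgue_cong_AE)
    qed
  qed simp
  also have "\<dots> = (LINT x:{-R..R}|lebesgue. LINT t:{p'..q'}|lebesgue. \<phi>t \<psi> h x t * \<sigma>0 x)"
  proof -
    have m: "half_plane_measurable (\<lambda>x t. \<phi>t \<psi> h x t * \<sigma>0 x)"
      by (intro half_plane_measurable_mult tm half_plane_measurable_fst \<sigma>0_borel)
    have z: "\<phi>t \<psi> h x t * \<sigma>0 x = 0" if "\<not> (x \<in> {-R..R} \<and> t \<in> {p'..q'})" for x t
      using out(2)[of x t] that p' by auto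
    show ?thesis
      using half_plane_Fubini(2)[OF m bnd[OF \<sigma>0_bounds(3)] z p'(1)]
        half_plane_Fubini(3)[OF m bnd[OF \<sigma>0_bounds(3)] z p'(1)] by simp
  qed
  also have "\<dots> = (LINT x:{-R..R}|lebesgue. 0)"
  proof (rule set_lebesgue_integral_cong)
    have "(LINT t:{p'..q'}|lebesgue. \<phi>t \<psi> h x t * \<sigma>0 x) = 0" for x
    proof -
      have "((\<lambda>t. \<phi>t \<psi> h x t) has_integral (\<phi> \<psi> h x q' - \<phi> \<psi> h x p')) {p'..q'}"
      proof (rule fundamental_theorem_of_calculus)
        show "p' \<le> q'" using p' by simp
        fix t show "((\<lambda>t. \<phi> \<psi> h x t) has_vector_derivative \<phi>t \<psi> h x t) (at t within {p'..q'})"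
          using \<phi>_derivatives(2)[OF \<psi> h(1), of x t]
          by (auto simp: has_real_derivative_iff_has_vector_derivative[symmetric] intro: has_field_derivative_at_within)
      qed
      then have "integral {p'..q'} (\<lambda>t. \<phi>t \<psi> h x t) = 0" using out(1)[of x p'] out(1)[of x q'] p' by (simp add: integral_unique)
      moreover have "continuous_on {p'..q'} (\<lambda>t. case (x, t) of (x, t) \<Rightarrow> \<phi>t \<psi> h x t)"
        by (rule continuous_on_compose2[OF \<phi>_derivatives(4)[OF \<psi> h(1)]]) (auto intro!: continuous_intros)
      ultimately have "(LINT t:{p'..q'}|lebesgue. \<phi>t \<psi> h x t) = 0"
        by (subst set_lebesgue_integral_eq_integral(2)) (auto intro!: absolutely_integrable_continuous_real)
      then show ?thesis by simp
    qed
    then show "\<forall>x. x \<in> {-R..R} \<longrightarrow> (LINT t:{p'..q'}|lebesgue. \<phi>t \<psi> h x t * \<sigma>0 x) = 0" by simp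
  qed simp
  finally show ?thesis by (simp add: set_lebesgue_integral_def)
qed

text \<open>For E = id the transformed density is \<eta> S = v, and for Q = g the transformed flux
  g(S) - G(S) S is 0. Every approximating integral is therefore that of \<open>\<phi>t\<close> times
  v, which vanishes.\<close>

lemma \<sigma>_weak:
  assumes \<psi>: "C1_test_function \<psi>"
  shows "(LINT (x, t):half_plane|lebesgue. deriv (\<lambda>s. \<psi> x s) t * \<sigma> x t + deriv (\<lambda>y. \<psi> y t) x * g (\<sigma> x t)) = 0"
proof (rule LIMSEQ_unique)
  have gc: "continuous_on J g" using Ck_on_subset[OF g_Ck[of 0], of J] by simp
  show "(\<lambda>n. LINT (x, t):half_plane|lebesgue.
      \<phi>t \<psi> (inverse (real (Suc n))) x t * (\<eta> x t * S x t)
      + \<phi>x \<psi> (inverse (real (Suc n))) x t * (g (S x t) - U x t * S x t))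
    \<longlonglongrightarrow> (LINT (x, t):half_plane|lebesgue. deriv (\<lambda>s. \<psi> x s) t * \<sigma> x t + deriv (\<lambda>y. \<psi> y t) x * g (\<sigma> x t))"
    using transformed_integral_limit[OF \<psi> continuous_on_id gc] by simp
  have "(LINT (x, t):half_plane|lebesgue.
      \<phi>t \<psi> h x t * (\<eta> x t * S x t) + \<phi>x \<psi> h x t * (g (S x t) - U x t * S x t)) = 0" if h: "0 < h" "h \<le> 1" for h
  proof -
    have "\<phi>t \<psi> h x t * (\<eta> x t * S x t) + \<phi>x \<psi> h x t * (g (S x t) - U x t * S x t) = \<phi>t \<psi> h x t * v x t" if "0 < t" for x t
    proof -
      have "S x t \<noteq> 0" "\<eta> x t \<noteq> 0" using that \<eta>_pos[of t x] S_in_J[of t x] J_pos by auto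
      then show ?thesis by (simp add: G_def)
    qed
    then have "(LINT (x, t):half_plane|lebesgue.
      \<phi>t \<psi> h x t * (\<eta> x t * S x t) + \<phi>x \<psi> h x t * (g (S x t) - U x t * S x t))
      = (LINT (x, t):half_plane|lebesgue. \<phi>t \<psi> h x t * v x t)"
      by (intro set_lebesgue_integral_cong half_plane_in_lebesgue) (auto simp: algebra_simps)
    then show ?thesis by (simp add: integral_\<phi>t_v[OF \<psi> h])
  qed
  then show "(\<lambda>n. LINT (x, t):half_plane|lebesgue.
      \<phi>t \<psi> (inverse (real (Suc n))) x t * (\<eta> x t * S x t)
      + \<phi>x \<psi> (inverse (real (Suc n))) x t * (g (S x t) - U x t * S x t)) \<longlonglongrightarrow> 0"
    by (simp add: inverse_le_1_iff del: of_nat_Suc)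
qed

lemma \<sigma>_admissible: "admissible_weak_solution J g (scalar_convex_extension J g) \<sigma>0 \<sigma>"
  unfolding admissible_weak_solution_def weak_solution_def
proof (intro conjI allI impI)
  show "\<sigma> x t \<in> J" if "0 \<le> t" for x t using that by (rule \<sigma>_in_J)
  show "bounded ((\<lambda>(x, t). \<sigma> x t) ` (UNIV \<times> {0..}))"
    using \<sigma>_bound by (auto simp: bounded_iff intro!: exI[of _ \<beta>])
  show "(LINT (x, t):UNIV \<times> {0<..}|lebesgue.
           deriv (\<lambda>s. \<psi> x s) t *\<^sub>R \<sigma> x t + deriv (\<lambda>y. \<psi> y t) x *\<^sub>R g (\<sigma> x t)) = 0" if "test_function \<psi>" for \<psi>
    using \<sigma>_weak[OF test_function_imp_C1[OF that]] by simp
  show "0 \<le> (LINT (x, t):UNIV \<times> {0<..}|lebesgue.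
           deriv (\<lambda>s. \<psi> x s) t * E (\<sigma> x t) + deriv (\<lambda>y. \<psi> y t) x * Q (\<sigma> x t))"
    if "scalar_convex_extension J g E Q \<and> C1_test_function \<psi> \<and> (\<forall>x t. 0 \<le> \<psi> x t)" for E Q \<psi>
    using that by (intro \<sigma>_entropy) auto
qed (rule \<sigma>_meas \<sigma>_L1loc \<sigma>_initial)+

end

theorem theorem2p4:
  fixes f g G \<sigma>0 :: "real \<Rightarrow> real"
    and a b L K :: real
    and J :: "real set"
    and \<eta> v \<gamma> \<sigma> :: "real \<Rightarrow> real \<Rightarrow> real"
  assumes f_smooth: "smooth_on UNIV f"
    and ab: "a \<le> b"
    and J_def: "J = {a + L..b + L}"
    and J_pos: "J \<subseteq> {0<..}"
    and K: "K < (INF \<sigma>\<in>J. \<sigma> * deriv f (\<sigma> - L) - f (\<sigma> - L))"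
    and g_def: "g = (\<lambda>\<sigma>. f (\<sigma> - L) + K)"
    and G_def: "G = (\<lambda>\<sigma>. g \<sigma> / \<sigma>)"
    and \<sigma>0_range: "\<forall>x. \<sigma>0 x \<in> J"
    and \<sigma>0_BV: "bounded_total_variation \<sigma>0"
    and solution: "admissible_weak_solution (state_space J) (system_flux G) (system_convex_extension J G)
                     (\<lambda>x. (1, \<sigma>0 x)) (\<lambda>x t. (\<eta> x t, v x t))"
    and solution_BV: "in_C_BV2 \<eta> v"
    and \<gamma>: "lagrangian_map \<eta> (\<lambda>x t. G (v x t / \<eta> x t)) \<gamma>"
    and \<sigma>_def: "\<sigma> = (\<lambda>x t. v (inv (\<lambda>y. \<gamma> y t) x) t / \<eta> (inv (\<lambda>y. \<gamma> y t) x) t)"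
  shows "admissible_weak_solution J g (scalar_convex_extension J g) \<sigma>0 \<sigma>"
proof -
  interpret lagrangian f g G \<sigma>0 a b L K J \<eta> v \<gamma> \<sigma>
    by unfold_locales fact+
  show ?thesis by (rule \<sigma>_admissible)
qed

end
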